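(* Let $(\varGamma,C)$ be a one-dimensional split-step SUSYQW whose coin $C$ is anisotropic, and suppose both limit coins $C(\mathrm{L})$ and $C(\mathrm{R})$ are nontrivial. Then: (A1) $(\varGamma,C)$ is Fredholm if and only if $|p|\neq|a(\mathrm{L})|$ and $|p|\neq |a(\mathrm{R})|$. (A2) In this case \[ \operatorname{ind}(\varGamma,C)=\begin{cases} +\operatorname{sgn} p, & |a(\mathrm{R})|<|p|<|a(\mathrm{L})|,\\ -\operatorname{sgn} p, & |a(\mathrm{L})|<|p|<|a(\mathrm{R})|,\\ 0, & \text{otherwise.}\end{cases} \]
   Context: Let $\mathcal H=\ell^2(\mathbb Z,\mathbb C^2)$, identified with $\ell^2(\mathbb Z)\oplus\ell^2(\mathbb Z)$. Let $L$ be the left shift on $\ell^2(\mathbb Z)$, $(L\Psi)(x)=\Psi(x+1)$, so $(L^*\Psi)(x)=\Psi(x-1)$. A (one-dimensional) split-step SUSYQW is the pair $(\varGamma,C)$ of operators on $\mathcal H$ given in block form by $\varGamma=\begin{pmatrix} p & qL\\ \overline{q}L^* & -p\end{pmatrix}$, $C=\begin{pmatrix} a_1 & \overline{b}\\ b & a_2\end{pmatrix}$, where $p\in\mathbb R$, $q\in\mathbb C\setminus\{0\}$, $p^2+|q|^2=1$, $\theta=\operatorname{Arg} q$, and $a_1,a_2:\mathbb Z\to\mathbb R$, $b:\mathbb Z\to\mathbb C$ are sequences (identified with multiplication operators) satisfying $a_j(x)^2+|b(x)|^2=1$ ($j=1,2$) and $b(x)(a_1(x)+a_2(x))=0$ for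 all $x\in\mathbb Z$. Then $\varGamma$ and $C$ are unitary involutions. The supercharge is $Q=[\varGamma,C]/(2i)$ and $H=Q^2$. With $\mathcal H_\pm=\ker(\varGamma\mp1)$, $Q$ anticommutes with $\varGamma$, so $Q_\pm:=Q|_{\mathcal H_\pm}:\mathcal H_\pm\to\mathcal H_\mp$ and $H_\pm:=H|_{\mathcal H_\pm}$. $(\varGamma,C)$ is called Fredholm if $Q_+$ is a Fredholm operator, and its Witten index is $\operatorname{ind}(\varGamma,C)=\dim\ker H_+-\dim\ker H_-$. The coin $C$ is anisotropic if the limits $C(\mathrm L)=\lim_{x\to-\infty}C(x)$ and $C(\mathrm R)=\lim_{x\to+\infty}C(x)$ exist, where $C(x)=\begin{pmatrix} a_1(x)&\overline{b(x)}\\ b(x)&a_2(x)\end{pmatrix}$; write $a_j(\sharp),b(\sharp)$ for the entries of $C(\sharp)$, $\sharp\in\{\mathrm L,\mathrm R\}$. A $2\times 2$ unitary Hermitian matrix is trivial if it equals $\pm I$. If $C(\sharp)$ is nontrivial then $a_1(\sharp)=-a_2(\sharp)$, and one writes $a(\sharp):=a_1(\sharp)$, so $a(\sharp)^2+|b(\sharp)|^2=1$. *)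

theory Defs
  imports "HOL-Analysis.Analysis" "HOL-Library.Function_Algebras"
begin

text \<open>The Hilbert space l2(Z,C^2) is identified with l2(Z) (+) l2(Z); elements are
  represented as pairs of component functions (psi1, psi2).\<close>

type_synonym state = "(int \<Rightarrow> complex) \<times> (int \<Rightarrow> complex)"

definition hscale :: "complex \<Rightarrow> state \<Rightarrow> state" where
  "hscale c \<psi> = (\<lambda>x. c * fst \<psi> x, \<lambda>x. c * snd \<psi> x)"

definition cspan :: "state set \<Rightarrow> state set" where
  "cspan S = module.span hscale S"

definition cdim :: "state set \<Rightarrow> nat" where
  "cdim V = vector_space.dim hscale V"

definition Hspace :: "state set" where
  "Hspace = {\<psi>. (\<lambda>x. (cmod (fst \<psi> x))^2) summable_on UNIV \<and>
                 (\<lambda>x. (cmod (snd \<psi> x))^2) summable_on UNIV}"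

definition hnorm :: "state \<Rightarrow> real" where
  "hnorm \<psi> = sqrt (infsum (\<lambda>x. (cmod (fst \<psi> x))^2 + (cmod (snd \<psi> x))^2) UNIV)"

definition H_closed :: "state set \<Rightarrow> bool" where
  "H_closed S \<longleftrightarrow> (\<forall>u \<phi>. (\<forall>n. u n \<in> S) \<and> \<phi> \<in> Hspace \<and>
        ((\<lambda>n. hnorm (u n - \<phi>)) \<longlonglongrightarrow> 0) \<longrightarrow> \<phi> \<in> S)"

definition Lshift :: "(int \<Rightarrow> complex) \<Rightarrow> int \<Rightarrow> complex" where
  "Lshift f = (\<lambda>x. f (x + 1))"

definition Lshift_adj :: "(int \<Rightarrow> complex) \<Rightarrow> int \<Rightarrow> complex" where
  "Lshift_adj f = (\<lambda>x. f (x - 1))"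

definition Gam :: "real \<Rightarrow> complex \<Rightarrow> state \<Rightarrow> state" where
  "Gam p q \<psi> = (\<lambda>x. complex_of_real p * fst \<psi> x + q * Lshift (snd \<psi>) x,
                 \<lambda>x. cnj q * Lshift_adj (fst \<psi>) x - complex_of_real p * snd \<psi> x)"

definition Coin :: "(int \<Rightarrow> real) \<Rightarrow> (int \<Rightarrow> real) \<Rightarrow> (int \<Rightarrow> complex) \<Rightarrow> state \<Rightarrow> state" where
  "Coin a1 a2 b \<psi> = (\<lambda>x. complex_of_real (a1 x) * fst \<psi> x + cnj (b x) * snd \<psi> x,
                      \<lambda>x. b x * fst \<psi> x + complex_of_real (a2 x) * snd \<psi> x)"

definition Qop :: "real \<Rightarrow> complex \<Rightarrow> (int \<Rightarrow> real) \<Rightarrow> (int \<Rightarrow> real) \<Rightarrow> (int \<Rightarrow> complex) \<Rightarrow> state \<Rightarrow> state" where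
  "Qop p q a1 a2 b \<psi> =
     hscale (1 / (2 * \<i>)) (Gam p q (Coin a1 a2 b \<psi>) - Coin a1 a2 b (Gam p q \<psi>))"

definition Hop :: "real \<Rightarrow> complex \<Rightarrow> (int \<Rightarrow> real) \<Rightarrow> (int \<Rightarrow> real) \<Rightarrow> (int \<Rightarrow> complex) \<Rightarrow> state \<Rightarrow> state" where
  "Hop p q a1 a2 b \<psi> = Qop p q a1 a2 b (Qop p q a1 a2 b \<psi>)"

definition Hplus :: "real \<Rightarrow> complex \<Rightarrow> state set" where
  "Hplus p q = {\<psi> \<in> Hspace. Gam p q \<psi> = \<psi>}"

definition Hminus :: "real \<Rightarrow> complex \<Rightarrow> state set" where
  "Hminus p q = {\<psi> \<in> Hspace. Gam p q \<psi> = - \<psi>}"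

text \<open>(Gamma, C) is Fredholm iff Q_+ : H_+ -> H_- is Fredholm: finite-dimensional kernel,
  closed range and finite-dimensional cokernel (range has a finite-dimensional complement).\<close>
definition is_fredholm :: "real \<Rightarrow> complex \<Rightarrow> (int \<Rightarrow> real) \<Rightarrow> (int \<Rightarrow> real) \<Rightarrow> (int \<Rightarrow> complex) \<Rightarrow> bool" where
  "is_fredholm p q a1 a2 b \<longleftrightarrow>
     (\<exists>F. finite F \<and> {\<psi> \<in> Hplus p q. Qop p q a1 a2 b \<psi> = 0} \<subseteq> cspan F) \<and>
     H_closed (Qop p q a1 a2 b ` Hplus p q) \<and>
     (\<exists>F. finite F \<and> F \<subseteq> Hminus p q \<and>
          Hminus p q \<subseteq> cspan (Qop p q a1 a2 b ` Hplus p q \<union> F))"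

definition witten_index :: "real \<Rightarrow> complex \<Rightarrow> (int \<Rightarrow> real) \<Rightarrow> (int \<Rightarrow> real) \<Rightarrow> (int \<Rightarrow> complex) \<Rightarrow> int" where
  "witten_index p q a1 a2 b =
     int (cdim {\<psi> \<in> Hplus p q. Hop p q a1 a2 b \<psi> = 0}) -
     int (cdim {\<psi> \<in> Hminus p q. Hop p q a1 a2 b \<psi> = 0})"

definition trivial_coin :: "real \<Rightarrow> real \<Rightarrow> complex \<Rightarrow> bool" where
  "trivial_coin a1 a2 b \<longleftrightarrow> (a1 = 1 \<and> a2 = 1 \<and> b = 0) \<or> (a1 = -1 \<and> a2 = -1 \<and> b = 0)"

end

theory Submission
  imports Defs
begin

text \<open>
  Write \<open>M = (\<Gamma>C + C\<Gamma>)/2\<close>, so that \<open>Q\<^sup>2 = 1 - M\<^sup>2\<close>. For a constant coin with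
  \<open>|p| \<noteq> |a|\<close> the norm of \<open>M\<close> is at most \<open>|p||a| + |q||b| < 1\<close>, and this persists for coins close to
  a constant one. Hence \<open>Q\<close> is invertible once the coin is replaced by its limit away from a half-line, and
  gluing the two half-line inverses inverts \<open>Q\<close> up to finitely many sites. Conversely, if
  \<open>|p| = |a|\<close> at one end, the symbol of \<open>Q\<^sub>+\<close> there has a zero on the unit circle, and a gliding hump
  argument shows that the range is not closed.

  For the index, \<open>ker Q\<close> on either eigenspace of \<open>\<Gamma>\<close> splits into joint eigenstates of \<open>\<Gamma>\<close> and \<open>C\<close>,
  which obey a first-order recursion. Multiplication by \<open>c\<^sup>x\<close> with \<open>c = -(1+p)/(1-p)\<close> maps formal
  joint eigenstates with \<open>\<Gamma> = 1\<close> to those with \<open>\<Gamma> = -1\<close>, so the two kernels differ only in the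
  decay conditions at infinity. For \<open>p > 0\<close>, the conditions differ at an end exactly if \<open>|a| < p\<close> there,
  and then precisely one eigenvalue of \<open>C\<close> can supply the extra solution.
\<close>

section \<open>Square-summable functions\<close>

text \<open>The contraction constant is a sharpened AM-GM inequality: since
  \<open>p^2 + |q|^2 = a^2 + |b|^2 = 1\<close>, the number \<open>2 - 2 (|p||a| + |q||b|)\<close>
  equals \<open>(|p| - |a|)^2 + (|q| - |b|)^2\<close>, which vanishes exactly at the thresholds of
  (A1). Zeros of \<open>b\<close> may cut the line into many pieces, and neither kernel is computed.
  Both are compared with a common part \<open>Kboth\<close>, which absorbs all compactly supported
  kernel states, and only its codimension in each kernel is determined. A reflection of the line
  exchanges the two kernels together with the two ends, so a single count, made at the right end,
  suffices; the change from \<open>(p, q)\<close> to \<open>(-p, -q)\<close> turns \<Gamma> into its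
  negative and reduces everything to \<open>p \<ge> 0\<close>. The coin converges without any rate,
  so no asymptotics of eigenstates are available. A joint eigenstate with eigenvalues s of \<Gamma>
  and e of C is only compared with geometric sequences, and the outcome at an end depends on the
  sign of \<open>s p - e a\<close> there. This is never 0 in the Fredholm case.\<close>

text \<open>A bound on the \<open>\<ell>\<^sup>2\<close> norm stated through finite subsets, which avoids infinite sums.\<close>

definition l2_bound :: "('i \<Rightarrow> complex) \<Rightarrow> real \<Rightarrow> bool" where
  "l2_bound f c \<longleftrightarrow> 0 \<le> c \<and> (\<forall>A. finite A \<longrightarrow> L2_set (\<lambda>x. cmod (f x)) A \<le> c)"

lemma l2_bound_nonneg: "l2_bound f c \<Longrightarrow> 0 \<le> c"
  by (simp add: l2_bound_def)

lemma l2_bound_mono: "l2_bound f c \<Longrightarrow> c \<le> d \<Longrightarrow> l2_bound f d"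
  unfolding l2_bound_def by (meson order_trans)

lemma l2_bound_zero: "l2_bound (\<lambda>x. 0) 0"
  by (simp add: l2_bound_def L2_set_def)

lemma l2_bound_pointwise:
  assumes "l2_bound f c"
  shows "cmod (f x) \<le> c"
proof -
  have "L2_set (\<lambda>x. cmod (f x)) {x} \<le> c"
    using assms unfolding l2_bound_def by blast
  then show ?thesis by simp
qed

lemma l2_bound_dominated:
  assumes "l2_bound f c" "\<And>x. cmod (g x) \<le> k * cmod (f x)" "0 \<le> k"
  shows "l2_bound g (k * c)"
  unfolding l2_bound_def
proof (intro conjI allI impI)
  show "0 \<le> k * c" using assms by (simp add: l2_bound_nonneg)
  fix A :: "'a set" assume "finite A"
  have "L2_set (\<lambda>x. cmod (g x)) A \<le> L2_set (\<lambda>x. k * cmod (f x)) A"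
    by (rule L2_set_mono) (use assms in auto)
  also have "\<dots> = k * L2_set (\<lambda>x. cmod (f x)) A"
    using assms by (simp add: L2_set_right_distrib)
  also have "\<dots> \<le> k * c"
    using assms \<open>finite A\<close> unfolding l2_bound_def by (intro mult_left_mono) auto
  finally show "L2_set (\<lambda>x. cmod (g x)) A \<le> k * c" .
qed

lemma l2_bound_mult:
  assumes "l2_bound f c" "\<And>x. cmod (m x) \<le> k"
  shows "l2_bound (\<lambda>x. m x * f x) (k * c)"
proof -
  \<comment> \<open>The index type has no named element; any point will do, as \<open>k\<close>
    dominates a norm there.\<close>
  have "0 \<le> k" using assms(2)[of undefined] norm_ge_zero order_trans by blast
  then show ?thesis
    using assms by (intro l2_bound_dominated[OF assms(1)]) (auto simp: norm_mult mult_right_mono)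
qed

lemma l2_bound_add:
  assumes "l2_bound f c" "l2_bound g d"
  shows "l2_bound (\<lambda>x. f x + g x) (c + d)"
  unfolding l2_bound_def
proof (intro conjI allI impI)
  show "0 \<le> c + d" using assms by (simp add: l2_bound_nonneg)
  fix A :: "'a set" assume A: "finite A"
  have "L2_set (\<lambda>x. cmod (f x + g x)) A \<le> L2_set (\<lambda>x. cmod (f x) + cmod (g x)) A"
    by (rule L2_set_mono) (auto simp: norm_triangle_ineq)
  also have "\<dots> \<le> L2_set (\<lambda>x. cmod (f x)) A + L2_set (\<lambda>x. cmod (g x)) A"
    by (rule L2_set_triangle_ineq)
  also have "\<dots> \<le> c + d" using assms A unfolding l2_bound_def by (intro add_mono) auto
  finally show "L2_set (\<lambda>x. cmod (f x + g x)) A \<le> c + d" .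
qed

lemma l2_bound_diff:
  assumes "l2_bound f c" "l2_bound g d"
  shows "l2_bound (\<lambda>x. f x - g x) (c + d)"
proof -
  have "l2_bound (\<lambda>x. - g x) (1 * d)" by (rule l2_bound_dominated[OF assms(2)]) auto
  then show ?thesis using l2_bound_add[OF assms(1)] by fastforce
qed

lemma l2_bound_reindex:
  fixes f :: "'a \<Rightarrow> complex" and h :: "'b \<Rightarrow> 'a"
  assumes "l2_bound f c" "inj h"
  shows "l2_bound (\<lambda>x. f (h x)) c"
  unfolding l2_bound_def
proof (intro conjI allI impI)
  show "0 \<le> c" using assms by (simp add: l2_bound_nonneg)
  fix A :: "'b set" assume A: "finite A"
  have "L2_set (\<lambda>x. cmod (f (h x))) A = L2_set (\<lambda>x. cmod (f x)) (h ` A)"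
    unfolding L2_set_def using assms(2)
    by (subst sum.reindex) (auto simp: inj_on_def inj_def)
  also have "\<dots> \<le> c" using assms A unfolding l2_bound_def by auto
  finally show "L2_set (\<lambda>x. cmod (f (h x))) A \<le> c" .
qed

lemma l2_bound_imp_summable:
  assumes "l2_bound f c"
  shows "(\<lambda>x. (cmod (f x))^2) summable_on UNIV" "infsum (\<lambda>x. (cmod (f x))^2) UNIV \<le> c^2"
proof -
  have *: "sum (\<lambda>x. (cmod (f x))^2) A \<le> c^2" if "finite A" for A
    using assms that unfolding l2_bound_def L2_set_def
    by (metis real_sqrt_le_iff real_sqrt_abs abs_of_nonneg)
  show S: "(\<lambda>x. (cmod (f x))^2) summable_on UNIV"
    by (rule nonneg_bdd_above_summable_on) (auto intro!: bdd_aboveI[of _ "c^2"] *)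
  show "infsum (\<lambda>x. (cmod (f x))^2) UNIV \<le> c^2"
    by (rule infsum_le_finite_sums[OF S]) (use * in auto)
qed

lemma summable_imp_l2_bound:
  assumes "(\<lambda>x. (cmod (f x))^2) summable_on UNIV"
  shows "l2_bound f (sqrt (infsum (\<lambda>x. (cmod (f x))^2) UNIV))"
  unfolding l2_bound_def L2_set_def
proof (intro conjI allI impI)
  fix A :: "'a set" assume A: "finite A"
  show "sqrt (\<Sum>i\<in>A. (cmod (f i))\<^sup>2) \<le> sqrt (\<Sum>\<^sub>\<infinity>x. (cmod (f x))\<^sup>2)"
    by (intro real_sqrt_le_mono finite_sum_le_infsum assms A) auto
qed (simp add: infsum_nonneg)

lemma summable_sq_iff_l2_bound:
  "(\<lambda>x. (cmod (f x))^2) summable_on UNIV \<longleftrightarrow> (\<exists>c. l2_bound f c)"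
  using l2_bound_imp_summable summable_imp_l2_bound by blast

text \<open>On a finite set the norm is continuous in finitely many values, so the bound on the
  partial sums survives the pointwise limit. This replaces completeness in the Neumann series and in
  the hump series.\<close>

lemma l2_bound_sums:
  assumes u: "\<And>n. l2_bound (u n) (c n)" and c: "summable c"
    and U: "\<And>x. (\<lambda>n. u n x) sums U x"
  shows "l2_bound U (suminf c)"
  unfolding l2_bound_def
proof (intro conjI allI impI)
  show "0 \<le> suminf c" using c u l2_bound_nonneg suminf_nonneg by blast
  fix A :: "'a set" assume A: "finite A"
  have part: "l2_bound (\<lambda>x. \<Sum>n<k. u n x) (\<Sum>n<k. c n)" for k
    by (induction k) (use l2_bound_add[OF _ u] l2_bound_zero in auto)
  have "L2_set (\<lambda>x. cmod (\<Sum>n<k. u n x)) A \<le> suminf c" for k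
  proof -
    have "L2_set (\<lambda>x. cmod (\<Sum>n<k. u n x)) A \<le> (\<Sum>n<k. c n)"
      using part A unfolding l2_bound_def by blast
    also have "\<dots> \<le> suminf c" using c u l2_bound_nonneg by (intro sum_le_suminf) auto
    finally show ?thesis .
  qed
  moreover have "(\<lambda>k. L2_set (\<lambda>x. cmod (\<Sum>n<k. u n x)) A) \<longlonglongrightarrow> L2_set (\<lambda>x. cmod (U x)) A"
    unfolding L2_set_def using U[unfolded sums_def] by (intro tendsto_intros)
  ultimately show "L2_set (\<lambda>x. cmod (U x)) A \<le> suminf c"
    by (intro LIMSEQ_le_const2) auto
qed

lemma l2_bound_finite_support:
  assumes "finite A" "\<And>x. x \<notin> A \<Longrightarrow> f x = 0"
  shows "l2_bound f (L2_set (\<lambda>x. cmod (f x)) A)"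
  unfolding l2_bound_def
proof (intro conjI allI impI)
  fix B :: "'a set" assume B: "finite B"
  have "sum (\<lambda>x. (cmod (f x))^2) B \<le> sum (\<lambda>x. (cmod (f x))^2) A"
  proof -
    have "sum (\<lambda>x. (cmod (f x))^2) B = sum (\<lambda>x. (cmod (f x))^2) (B \<inter> A)"
      by (rule sum.mono_neutral_right) (use assms B in auto)
    also have "\<dots> \<le> sum (\<lambda>x. (cmod (f x))^2) A" by (rule sum_mono2) (use assms in auto)
    finally show ?thesis .
  qed
  then show "L2_set (\<lambda>x. cmod (f x)) B \<le> L2_set (\<lambda>x. cmod (f x)) A"
    unfolding L2_set_def by simp
qed simp

section \<open>States, the supercharge and its Neumann inverse\<close>

interpretation hs: vector_space hscale
  by unfold_locales (auto simp: hscale_def algebra_simps prod_eq_iff)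

lemma fst_hscale [simp]: "fst (hscale c \<psi>) x = c * fst \<psi> x"
  and snd_hscale [simp]: "snd (hscale c \<psi>) x = c * snd \<psi> x"
  by (simp_all add: hscale_def)

lemma state_eqI:
  "(\<And>x. fst \<psi> x = fst \<phi> x) \<Longrightarrow> (\<And>x. snd \<psi> x = snd \<phi> x) \<Longrightarrow> \<psi> = (\<phi> :: state)"
  by (auto simp: prod_eq_iff)

text \<open>Bounding the components separately suits \<open>M\<close>, which is nearly diagonal in
  them; compared with \<open>hnorm\<close> it costs at most a factor 2.\<close>

definition state_bound :: "state \<Rightarrow> real \<Rightarrow> bool" where
  "state_bound \<psi> c \<longleftrightarrow> l2_bound (fst \<psi>) c \<and> l2_bound (snd \<psi>) c"

lemma state_bound_nonneg: "state_bound \<psi> c \<Longrightarrow> 0 \<le> c"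
  unfolding state_bound_def using l2_bound_nonneg by blast

lemma state_bound_pointwise:
  "state_bound \<psi> c \<Longrightarrow> cmod (fst \<psi> x) \<le> c" "state_bound \<psi> c \<Longrightarrow> cmod (snd \<psi> x) \<le> c"
  unfolding state_bound_def by (auto intro: l2_bound_pointwise)

lemma Hspace_iff_state_bound: "\<psi> \<in> Hspace \<longleftrightarrow> (\<exists>c. state_bound \<psi> c)"
proof
  assume "\<psi> \<in> Hspace"
  then obtain c d where "l2_bound (fst \<psi>) c" "l2_bound (snd \<psi>) d"
    unfolding Hspace_def by (auto simp: summable_sq_iff_l2_bound)
  then show "\<exists>c. state_bound \<psi> c"
    unfolding state_bound_def by (metis l2_bound_mono max.cobounded1 max.cobounded2)
next
  assume "\<exists>c. state_bound \<psi> c"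
  then show "\<psi> \<in> Hspace"
    unfolding Hspace_def state_bound_def by (auto simp: summable_sq_iff_l2_bound)
qed

lemma hnorm_sq_split:
  assumes "\<psi> \<in> Hspace"
  shows "infsum (\<lambda>x. (cmod (fst \<psi> x))^2 + (cmod (snd \<psi> x))^2) UNIV =
    infsum (\<lambda>x. (cmod (fst \<psi> x))^2) UNIV + infsum (\<lambda>x. (cmod (snd \<psi> x))^2) UNIV"
  using assms unfolding Hspace_def by (intro infsum_add) auto

lemma state_bound_hnorm:
  assumes "\<psi> \<in> Hspace"
  shows "state_bound \<psi> (hnorm \<psi>)"
proof -
  have "sqrt (infsum (\<lambda>x. (cmod (fst \<psi> x))^2) UNIV) \<le> hnorm \<psi>"
    "sqrt (infsum (\<lambda>x. (cmod (snd \<psi> x))^2) UNIV) \<le> hnorm \<psi>"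
    unfolding hnorm_def hnorm_sq_split[OF assms] by (auto simp: infsum_nonneg)
  then show ?thesis
    using assms summable_imp_l2_bound l2_bound_mono unfolding state_bound_def Hspace_def by blast
qed

lemma hnorm_le:
  assumes "state_bound \<psi> c"
  shows "hnorm \<psi> \<le> 2 * c"
proof -
  have "\<psi> \<in> Hspace" using assms Hspace_iff_state_bound by blast
  then have "hnorm \<psi> \<le> sqrt (c^2 + c^2)"
    using assms unfolding hnorm_def state_bound_def hnorm_sq_split[OF \<open>\<psi> \<in> Hspace\<close>]
    by (intro real_sqrt_le_mono add_mono l2_bound_imp_summable(2)) auto
  also have "\<dots> \<le> sqrt ((2*c)^2)" by (intro real_sqrt_le_mono) (simp add: power2_eq_square)
  also have "\<dots> = 2 * c" using state_bound_nonneg[OF assms] by (simp add: real_sqrt_mult)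
  finally show ?thesis .
qed

lemma state_bound_add:
  "state_bound \<psi> c \<Longrightarrow> state_bound \<phi> d \<Longrightarrow> state_bound (\<psi> + \<phi>) (c + d)"
  unfolding state_bound_def by (auto simp: plus_fun_def intro: l2_bound_add)

lemma state_bound_diff:
  "state_bound \<psi> c \<Longrightarrow> state_bound \<phi> d \<Longrightarrow> state_bound (\<psi> - \<phi>) (c + d)"
  unfolding state_bound_def by (auto simp: fun_diff_def intro: l2_bound_diff)

lemma state_bound_hscale: "state_bound \<psi> c \<Longrightarrow> state_bound (hscale k \<psi>) (cmod k * c)"
  unfolding state_bound_def hscale_def by (auto intro: l2_bound_mult)

lemma Hspace_add: "\<psi> \<in> Hspace \<Longrightarrow> \<phi> \<in> Hspace \<Longrightarrow> \<psi> + \<phi> \<in> Hspace"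
  using Hspace_iff_state_bound state_bound_add by metis

lemma Hspace_diff: "\<psi> \<in> Hspace \<Longrightarrow> \<phi> \<in> Hspace \<Longrightarrow> \<psi> - \<phi> \<in> Hspace"
  using Hspace_iff_state_bound state_bound_diff by metis

lemma Hspace_hscale: "\<psi> \<in> Hspace \<Longrightarrow> hscale k \<psi> \<in> Hspace"
  using Hspace_iff_state_bound state_bound_hscale by metis

lemma Hspace_zero: "0 \<in> Hspace"
  by (simp add: Hspace_def)

lemma subspace_Hspace: "hs.subspace Hspace"
  unfolding hs.subspace_def using Hspace_add Hspace_hscale Hspace_zero by blast

lemma state_zero_if_bounds_vanish:
  assumes "\<And>n. state_bound \<psi> (c n)" "c \<longlonglongrightarrow> 0"
  shows "\<psi> = 0"
proof (rule state_eqI)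
  fix x
  have "cmod (fst \<psi> x) \<le> c n" "cmod (snd \<psi> x) \<le> c n" for n
    using state_bound_pointwise[OF assms(1)] by auto
  then have "cmod (fst \<psi> x) \<le> 0" "cmod (snd \<psi> x) \<le> 0"
    using LIMSEQ_le_const[OF assms(2), of "cmod (fst \<psi> x)"]
      LIMSEQ_le_const[OF assms(2), of "cmod (snd \<psi> x)"] by auto
  then show "fst \<psi> x = fst 0 x" "snd \<psi> x = snd 0 x" by auto
qed

text \<open>\<Gamma> and C use finitely many values per site, so they commute with pointwise series
  without any continuity argument.\<close>

definition pointwise_sums :: "(nat \<Rightarrow> state) \<Rightarrow> state \<Rightarrow> bool" where
  "pointwise_sums u U \<longleftrightarrow>
     (\<forall>x. (\<lambda>n. fst (u n) x) sums fst U x) \<and> (\<forall>x. (\<lambda>n. snd (u n) x) sums snd U x)"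

lemma pointwise_sums_unique: "pointwise_sums u U \<Longrightarrow> pointwise_sums u V \<Longrightarrow> U = V"
  unfolding pointwise_sums_def by (intro state_eqI) (auto intro: sums_unique2)

lemma pointwise_sums_state_bound:
  assumes "\<And>n. state_bound (u n) (c n)" "summable c" "pointwise_sums u U"
  shows "state_bound U (suminf c)"
  using assms l2_bound_sums[of "\<lambda>n. fst (u n)" c "fst U"] l2_bound_sums[of "\<lambda>n. snd (u n)" c "snd U"]
  unfolding state_bound_def pointwise_sums_def by auto

lemma pointwise_sums_exists:
  assumes "\<And>n. state_bound (u n) (c n)" "summable c"
  shows "\<exists>U. pointwise_sums u U"
proof -
  have "cmod (fst (u n) x) \<le> c n" "cmod (snd (u n) x) \<le> c n" for n x
    using state_bound_pointwise[OF assms(1)] by auto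
  then have "summable (\<lambda>n. fst (u n) x)" "summable (\<lambda>n. snd (u n) x)" for x
    by (auto intro!: summable_comparison_test'[OF assms(2), of 0])
  then have "pointwise_sums u (\<lambda>x. \<Sum>n. fst (u n) x, \<lambda>x. \<Sum>n. snd (u n) x)"
    unfolding pointwise_sums_def by (auto simp: summable_sums)
  then show ?thesis by blast
qed

lemma pointwise_sums_Gam: "pointwise_sums u U \<Longrightarrow> pointwise_sums (\<lambda>n. Gam p q (u n)) (Gam p q U)"
  unfolding pointwise_sums_def Gam_def Lshift_def Lshift_adj_def
  by (auto intro!: sums_add sums_diff sums_mult)

lemma pointwise_sums_Coin:
  "pointwise_sums u U \<Longrightarrow> pointwise_sums (\<lambda>n. Coin a1 a2 b (u n)) (Coin a1 a2 b U)"
  unfolding pointwise_sums_def Coin_def by (auto intro!: sums_add sums_diff sums_mult)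

lemma pointwise_sums_add:
  "pointwise_sums u U \<Longrightarrow> pointwise_sums v V \<Longrightarrow> pointwise_sums (\<lambda>n. u n + v n) (U + V)"
  unfolding pointwise_sums_def by (auto intro!: sums_add)

lemma pointwise_sums_hscale:
  "pointwise_sums u U \<Longrightarrow> pointwise_sums (\<lambda>n. hscale k (u n)) (hscale k U)"
  unfolding pointwise_sums_def by (auto intro!: sums_mult)

lemma pointwise_sums_Suc:
  "pointwise_sums u U \<Longrightarrow> pointwise_sums (\<lambda>n. u (Suc n)) (U - u 0)"
  unfolding pointwise_sums_def
  by (auto simp: sums_Suc_iff[of "\<lambda>n. fst (u n) x" for x] sums_Suc_iff[of "\<lambda>n. snd (u n) x" for x])

lemma Gam_add: "Gam p q (\<psi> + \<phi>) = Gam p q \<psi> + Gam p q \<phi>"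
  and Gam_diff: "Gam p q (\<psi> - \<phi>) = Gam p q \<psi> - Gam p q \<phi>"
  and Gam_minus: "Gam p q (- \<psi>) = - Gam p q \<psi>"
  and Gam_hscale: "Gam p q (hscale k \<psi>) = hscale k (Gam p q \<psi>)"
  by (auto intro!: state_eqI simp: Gam_def Lshift_def Lshift_adj_def algebra_simps)

lemma Gam_neg: "Gam (- p) (- q) \<psi> = - Gam p q \<psi>"
  by (rule state_eqI) (simp_all add: Gam_def Lshift_def Lshift_adj_def)

lemma Coin_add: "Coin a1 a2 b (\<psi> + \<phi>) = Coin a1 a2 b \<psi> + Coin a1 a2 b \<phi>"
  and Coin_diff: "Coin a1 a2 b (\<psi> - \<phi>) = Coin a1 a2 b \<psi> - Coin a1 a2 b \<phi>"
  and Coin_minus: "Coin a1 a2 b (- \<psi>) = - Coin a1 a2 b \<psi>"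
  and Coin_hscale: "Coin a1 a2 b (hscale k \<psi>) = hscale k (Coin a1 a2 b \<psi>)"
  by (auto intro!: state_eqI simp: Coin_def algebra_simps)

lemma Qop_add: "Qop p q a1 a2 b (\<psi> + \<phi>) = Qop p q a1 a2 b \<psi> + Qop p q a1 a2 b \<phi>"
  and Qop_diff: "Qop p q a1 a2 b (\<psi> - \<phi>) = Qop p q a1 a2 b \<psi> - Qop p q a1 a2 b \<phi>"
  and Qop_hscale: "Qop p q a1 a2 b (hscale k \<psi>) = hscale k (Qop p q a1 a2 b \<psi>)"
  by (auto intro!: state_eqI
      simp: Qop_def Gam_add Gam_diff Gam_hscale Coin_add Coin_diff Coin_hscale algebra_simps)

lemma Qop_zero: "Qop p q a1 a2 b 0 = 0"
  using Qop_diff[of p q a1 a2 b 0 0] by simp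

text \<open>\<open>Q\<close> has range one. This is what allows the coin to be replaced, and states
  to be cut, away from the site under consideration.\<close>

lemma Qop_local:
  assumes "\<And>y. \<bar>y - x\<bar> \<le> 1 \<Longrightarrow> a1 y = a1' y \<and> a2 y = a2' y \<and> b y = b' y"
    and "\<And>y. \<bar>y - x\<bar> \<le> 1 \<Longrightarrow> fst \<psi> y = fst \<phi> y \<and> snd \<psi> y = snd \<phi> y"
  shows "fst (Qop p q a1 a2 b \<psi>) x = fst (Qop p q a1' a2' b' \<phi>) x"
    "snd (Qop p q a1 a2 b \<psi>) x = snd (Qop p q a1' a2' b' \<phi>) x"
proof -
  have "a1 y = a1' y \<and> a2 y = a2' y \<and> b y = b' y \<and> fst \<psi> y = fst \<phi> y \<and> snd \<psi> y = snd \<phi> y"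
    if "y \<in> {x - 1, x, x + 1}" for y
    using assms[of y] that by auto
  then show "fst (Qop p q a1 a2 b \<psi>) x = fst (Qop p q a1' a2' b' \<phi>) x"
    "snd (Qop p q a1 a2 b \<psi>) x = snd (Qop p q a1' a2' b' \<phi>) x"
    by (simp_all add: Qop_def Gam_def Coin_def Lshift_def Lshift_adj_def)
qed

definition anticomm :: "real \<Rightarrow> complex \<Rightarrow> (int \<Rightarrow> real) \<Rightarrow> (int \<Rightarrow> real) \<Rightarrow> (int \<Rightarrow> complex) \<Rightarrow> state \<Rightarrow> state" where
  "anticomm p q a1 a2 b \<psi> =
     hscale (1/2) (Gam p q (Coin a1 a2 b \<psi>) + Coin a1 a2 b (Gam p q \<psi>))"

lemma pointwise_sums_anticomm:
  "pointwise_sums u U \<Longrightarrow>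
   pointwise_sums (\<lambda>n. anticomm p q a1 a2 b (u n)) (anticomm p q a1 a2 b U)"
  unfolding anticomm_def
  by (intro pointwise_sums_hscale pointwise_sums_add pointwise_sums_Gam pointwise_sums_Coin)

section \<open>Algebra and norm bounds of a walk\<close>

locale walk =
  fixes p :: real and q :: complex
    and a1 a2 :: "int \<Rightarrow> real" and b :: "int \<Rightarrow> complex"
  assumes pq: "p^2 + (cmod q)^2 = 1" and q0: "q \<noteq> 0"
    and coin1: "\<And>x. (a1 x)^2 + (cmod (b x))^2 = 1"
    and coin2: "\<And>x. (a2 x)^2 + (cmod (b x))^2 = 1"
    and coin3: "\<And>x. b x * complex_of_real (a1 x + a2 x) = 0"
begin

abbreviation "\<Gamma> \<equiv> Gam p q"
abbreviation "C \<equiv> Coin a1 a2 b"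
abbreviation "Q \<equiv> Qop p q a1 a2 b"
abbreviation "M \<equiv> anticomm p q a1 a2 b"

lemma pq_complex: "complex_of_real p * complex_of_real p + q * cnj q = 1"
  using pq by (simp add: power2_eq_square flip: complex_norm_square of_real_mult of_real_power of_real_add)

lemma coin_complex:
  "complex_of_real (a1 x) * complex_of_real (a1 x) + b x * cnj (b x) = 1"
  "complex_of_real (a2 x) * complex_of_real (a2 x) + b x * cnj (b x) = 1"
  using coin1[of x] coin2[of x]
  by (simp_all add: power2_eq_square flip: complex_norm_square of_real_mult of_real_power of_real_add)

lemma p_bounds: "\<bar>p\<bar> < 1" "-1 < p" "p < 1"
proof -
  have "0 < (cmod q)^2" using q0 by simp
  then have "p^2 < 1" using pq by linarith
  then show "\<bar>p\<bar> < 1" by (simp add: abs_square_less_1)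
  then show "-1 < p" "p < 1" by auto
qed

lemma entry_bounds: "\<bar>a1 x\<bar> \<le> 1" "\<bar>a2 x\<bar> \<le> 1" "cmod (b x) \<le> 1" "cmod q \<le> 1"
proof -
  have "(a1 x)^2 \<le> 1" "(a2 x)^2 \<le> 1" "(cmod (b x))^2 \<le> 1" "(cmod q)^2 \<le> 1"
    using coin1[of x] coin2[of x] pq zero_le_power2[of "a1 x"] zero_le_power2[of p]
      zero_le_power2[of "cmod (b x)"] by linarith+
  then show "\<bar>a1 x\<bar> \<le> 1" "\<bar>a2 x\<bar> \<le> 1" "cmod (b x) \<le> 1" "cmod q \<le> 1"
    by (auto simp: abs_square_le_1 power_le_one_iff)
qed

lemma Gam_Gam: "\<Gamma> (\<Gamma> \<psi>) = \<psi>"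
proof (rule state_eqI)
  fix x
  have "fst (\<Gamma> (\<Gamma> \<psi>)) x = (complex_of_real p * complex_of_real p + q * cnj q) * fst \<psi> x"
    by (simp add: Gam_def Lshift_def Lshift_adj_def algebra_simps)
  then show "fst (\<Gamma> (\<Gamma> \<psi>)) x = fst \<psi> x" by (simp add: pq_complex)
  have "snd (\<Gamma> (\<Gamma> \<psi>)) x = (complex_of_real p * complex_of_real p + q * cnj q) * snd \<psi> x"
    by (simp add: Gam_def Lshift_def Lshift_adj_def algebra_simps)
  then show "snd (\<Gamma> (\<Gamma> \<psi>)) x = snd \<psi> x" by (simp add: pq_complex)
qed

lemma Coin_Coin: "C (C \<psi>) = \<psi>"
proof (rule state_eqI)
  fix x
  have z: "b x * (complex_of_real (a1 x) + complex_of_real (a2 x)) = 0"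
    using coin3[of x] by simp
  then have z': "cnj (b x) * (complex_of_real (a1 x) + complex_of_real (a2 x)) = 0"
    by auto
  have "fst (C (C \<psi>)) x = (complex_of_real (a1 x) * complex_of_real (a1 x) + b x * cnj (b x)) * fst \<psi> x
      + cnj (b x) * (complex_of_real (a1 x) + complex_of_real (a2 x)) * snd \<psi> x"
    by (simp add: Coin_def algebra_simps)
  then show "fst (C (C \<psi>)) x = fst \<psi> x" unfolding z' coin_complex by simp
  have "snd (C (C \<psi>)) x = (complex_of_real (a2 x) * complex_of_real (a2 x) + b x * cnj (b x)) * snd \<psi> x
      + b x * (complex_of_real (a1 x) + complex_of_real (a2 x)) * fst \<psi> x"
    by (simp add: Coin_def algebra_simps)
  then show "snd (C (C \<psi>)) x = snd \<psi> x" unfolding z coin_complex by simp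
qed

text \<open>As \<Gamma> and C are involutions, both squares expand into 1/2 and a quarter of the
  words \<open>\<Gamma>C\<Gamma>C\<close> and \<open>C\<Gamma>C\<Gamma>\<close>, with opposite signs
  of the words.\<close>

lemma Q_squared: "Q (Q \<psi>) = \<psi> - M (M \<psi>)"
proof -
  define k :: complex where "k = 1 / (2 * \<i>)"
  have kk: "k * k = - 1/4" by (simp add: k_def)
  have kk': "k * (k * z) = - z/4" for z
    using kk by (simp flip: mult.assoc)
  show ?thesis
    unfolding Qop_def anticomm_def k_def[symmetric]
    by (rule state_eqI)
      (simp_all add: Gam_add Gam_diff Gam_hscale Coin_add Coin_diff Coin_hscale
        Gam_Gam Coin_Coin kk' field_simps)
qed

lemma Gam_Q: "\<Gamma> (Q \<psi>) = - Q (\<Gamma> \<psi>)"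
  unfolding Qop_def Gam_hscale Gam_diff Gam_Gam
  by (simp add: state_eqI algebra_simps)

lemma state_bound_Gam:
  assumes "state_bound \<psi> c"
  shows "state_bound (\<Gamma> \<psi>) (2 * c)"
proof -
  have inj: "inj (\<lambda>x::int. x + 1)" "inj (\<lambda>x::int. x - 1)" by (auto simp: inj_def)
  have "l2_bound (\<lambda>x. complex_of_real p * fst \<psi> x + q * snd \<psi> (x + 1)) (1 * c + 1 * c)"
    "l2_bound (\<lambda>x. cnj q * fst \<psi> (x - 1) - complex_of_real p * snd \<psi> x) (1 * c + 1 * c)"
    using assms p_bounds entry_bounds(4) unfolding state_bound_def
    by (intro l2_bound_add l2_bound_diff l2_bound_mult l2_bound_reindex[OF _ inj(1)]
        l2_bound_reindex[OF _ inj(2)]; simp)+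
  then show ?thesis by (simp add: state_bound_def Gam_def Lshift_def Lshift_adj_def)
qed

lemma state_bound_Coin:
  assumes "state_bound \<psi> c"
  shows "state_bound (C \<psi>) (2 * c)"
proof -
  have "l2_bound (\<lambda>x. complex_of_real (a1 x) * fst \<psi> x + cnj (b x) * snd \<psi> x) (1 * c + 1 * c)"
    "l2_bound (\<lambda>x. b x * fst \<psi> x + complex_of_real (a2 x) * snd \<psi> x) (1 * c + 1 * c)"
    using assms entry_bounds unfolding state_bound_def
    by (intro l2_bound_add l2_bound_mult; simp)+
  then show ?thesis by (simp add: state_bound_def Coin_def)
qed

lemma state_bound_Q:
  assumes "state_bound \<psi> c"
  shows "state_bound (Q \<psi>) (4 * c)"
proof -
  have "state_bound (Q \<psi>) (cmod (1 / (2 * \<i>)) * (2 * (2 * c) + 2 * (2 * c)))"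
    unfolding Qop_def
    by (intro state_bound_hscale state_bound_diff state_bound_Gam state_bound_Coin assms)
  then show ?thesis by (simp add: norm_divide)
qed

lemma Hspace_Gam: "\<psi> \<in> Hspace \<Longrightarrow> \<Gamma> \<psi> \<in> Hspace"
  and Hspace_Coin: "\<psi> \<in> Hspace \<Longrightarrow> C \<psi> \<in> Hspace"
  and Hspace_Q: "\<psi> \<in> Hspace \<Longrightarrow> Q \<psi> \<in> Hspace"
  using Hspace_iff_state_bound state_bound_Gam state_bound_Coin state_bound_Q by metis+

text \<open>The only entries of \<open>M\<close> mixing the components contain
  \<open>a1 x + a2 (x + 1)\<close>, which is small where the coin is close to a constant nontrivial
  one. Inside a component, the diagonal term gives |p|A and the two hopping terms give |q|B/2
  each.\<close>

lemma state_bound_anticomm: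
  assumes \<psi>: "state_bound \<psi> c"
    and A: "\<And>x. \<bar>a1 x\<bar> \<le> A" "\<And>x. \<bar>a2 x\<bar> \<le> A"
    and B: "\<And>x. cmod (b x) \<le> B" and \<eta>: "\<And>x. \<bar>a1 x + a2 (x + 1)\<bar> \<le> \<eta>"
  shows "state_bound (M \<psi>) ((\<bar>p\<bar> * A + cmod q * B + \<eta>) * c)"
proof -
  have f: "l2_bound (fst \<psi>) c" "l2_bound (snd \<psi>) c"
    using \<psi> by (auto simp: state_bound_def)
  have inj: "inj (\<lambda>x::int. x + 1)" "inj (\<lambda>x::int. x - 1)" by (auto simp: inj_def)
  note shift = l2_bound_reindex[OF _ inj(1)] l2_bound_reindex[OF _ inj(2)]
  have \<eta>': "\<bar>a1 (x - 1) + a2 x\<bar> \<le> \<eta>" for x using \<eta>[of "x - 1"] by simp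
  have off: "cmod (q * complex_of_real (a1 x + a2 (x + 1)) / 2) \<le> \<eta>"
    "cmod (cnj q * complex_of_real (a1 (x - 1) + a2 x) / 2) \<le> \<eta>" for x
  proof -
    have "cmod q * \<bar>a1 x + a2 (x + 1)\<bar> \<le> 1 * \<eta>" "cmod q * \<bar>a1 (x - 1) + a2 x\<bar> \<le> 1 * \<eta>"
      using \<eta>[of x] \<eta>'[of x] entry_bounds(4) by (intro mult_mono; simp)+
    moreover have "0 \<le> \<eta>" using \<eta>[of 0] by linarith
    ultimately show "cmod (q * complex_of_real (a1 x + a2 (x + 1)) / 2) \<le> \<eta>"
      "cmod (cnj q * complex_of_real (a1 (x - 1) + a2 x) / 2) \<le> \<eta>"
      by (auto simp: norm_mult norm_divide simp del: of_real_add)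
  qed
  have diag: "cmod (complex_of_real (p * a1 x)) \<le> \<bar>p\<bar> * A"
    "cmod (complex_of_real (- p * a2 x)) \<le> \<bar>p\<bar> * A" for x
    using A[of x] by (auto simp: norm_mult abs_mult mult_left_mono simp del: of_real_mult)
  have hop: "cmod (q * b x / 2) \<le> cmod q * B / 2" "cmod (cnj q * cnj (b x) / 2) \<le> cmod q * B / 2" for x
    using B[of x] by (auto simp: norm_mult norm_divide mult_left_mono)
  have "fst (M \<psi>) = (\<lambda>x. complex_of_real (p * a1 x) * fst \<psi> x
       + (q * b (x + 1) / 2 * fst \<psi> (x + 1) + cnj q * cnj (b x) / 2 * fst \<psi> (x - 1))
       + q * complex_of_real (a1 x + a2 (x + 1)) / 2 * snd \<psi> (x + 1))"
    by (rule ext) (simp add: anticomm_def Gam_def Coin_def Lshift_def Lshift_adj_def field_simps)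
  moreover have "l2_bound (\<lambda>x. complex_of_real (p * a1 x) * fst \<psi> x
       + (q * b (x + 1) / 2 * fst \<psi> (x + 1) + cnj q * cnj (b x) / 2 * fst \<psi> (x - 1))
       + q * complex_of_real (a1 x + a2 (x + 1)) / 2 * snd \<psi> (x + 1))
     (\<bar>p\<bar> * A * c + (cmod q * B / 2 * c + cmod q * B / 2 * c) + \<eta> * c)"
    by (intro l2_bound_add l2_bound_mult diag hop off shift f)
  moreover have "snd (M \<psi>) = (\<lambda>x. complex_of_real (- p * a2 x) * snd \<psi> x
       + (q * b x / 2 * snd \<psi> (x + 1) + cnj q * cnj (b (x - 1)) / 2 * snd \<psi> (x - 1))
       + cnj q * complex_of_real (a1 (x - 1) + a2 x) / 2 * fst \<psi> (x - 1))"
    by (rule ext) (simp add: anticomm_def Gam_def Coin_def Lshift_def Lshift_adj_def field_simps)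
  moreover have "l2_bound (\<lambda>x. complex_of_real (- p * a2 x) * snd \<psi> x
       + (q * b x / 2 * snd \<psi> (x + 1) + cnj q * cnj (b (x - 1)) / 2 * snd \<psi> (x - 1))
       + cnj q * complex_of_real (a1 (x - 1) + a2 x) / 2 * fst \<psi> (x - 1))
     (\<bar>p\<bar> * A * c + (cmod q * B / 2 * c + cmod q * B / 2 * c) + \<eta> * c)"
    by (intro l2_bound_add l2_bound_mult diag hop off shift f)
  moreover have "\<bar>p\<bar> * A * c + (cmod q * B / 2 * c + cmod q * B / 2 * c) + \<eta> * c
      = (\<bar>p\<bar> * A + cmod q * B + \<eta>) * c"
    by (simp add: field_simps)
  ultimately show ?thesis
    unfolding state_bound_def by simp
qed

end

section \<open>Invertibility of Q when M is a strict contraction\<close>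

locale contractive_walk = walk +
  fixes \<rho> :: real
  assumes \<rho>: "0 \<le> \<rho>" "\<rho> < 1"
    and M_contract: "\<And>\<psi> c. state_bound \<psi> c \<Longrightarrow> state_bound (M \<psi>) (\<rho> * c)"
begin

lemma M_iterate_bound: "state_bound \<psi> c \<Longrightarrow> state_bound (((\<lambda>\<phi>. M (M \<phi>)) ^^ n) \<psi>) ((\<rho>^2)^n * c)"
  by (induction n) (auto dest!: M_contract simp: power2_eq_square mult.assoc)

lemma \<rho>_sq: "\<rho>^2 < 1"
  using \<rho> by (simp add: abs_square_less_1)

text \<open>A kernel state is fixed by \<open>M\<^sup>2\<close>, whose iterates shrink every bound
  to 0.\<close>

lemma Q_injective:
  assumes "\<psi> \<in> Hspace" "Q \<psi> = 0"
  shows "\<psi> = 0"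
proof -
  obtain c where c: "state_bound \<psi> c" using assms(1) Hspace_iff_state_bound by blast
  have "M (M \<psi>) = \<psi>" using Q_squared[of \<psi>] assms(2) by (simp add: Qop_zero)
  then have "((\<lambda>\<phi>. M (M \<phi>)) ^^ n) \<psi> = \<psi>" for n by (induction n) auto
  then have "state_bound \<psi> ((\<rho>^2)^n * c)" for n using M_iterate_bound[OF c, of n] by simp
  moreover have "(\<lambda>n. (\<rho>^2)^n * c) \<longlonglongrightarrow> 0"
    using \<rho>_sq by (intro tendsto_mult_left_zero LIMSEQ_power_zero) simp
  ultimately show ?thesis by (rule state_zero_if_bounds_vanish)
qed

text \<open>Neumann series: since \<open>Q\<^sup>2 = 1 - M\<^sup>2\<close>, the inverse of \<open>Q\<close> is \<open>Q \<Sum> M\<^bsup>2n\<^esup>\<close>.\<close>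

lemma Q_surjective:
  assumes c: "state_bound g c"
  shows "\<exists>\<psi>. state_bound \<psi> (4 / (1 - \<rho>^2) * c) \<and> Q \<psi> = g"
proof -
  define u where "u n = ((\<lambda>\<phi>. M (M \<phi>)) ^^ n) g" for n
  have u: "state_bound (u n) ((\<rho>^2)^n * c)" for n
    unfolding u_def by (rule M_iterate_bound[OF c])
  have s: "(\<lambda>n. (\<rho>^2)^n * c) sums (1 / (1 - \<rho>^2) * c)"
    using \<rho>_sq by (intro sums_mult2 geometric_sums) simp
  obtain h where h: "pointwise_sums u h"
    using pointwise_sums_exists[OF u sums_summable[OF s]] by blast
  have hb: "state_bound h (1 / (1 - \<rho>^2) * c)"
    using pointwise_sums_state_bound[OF u sums_summable[OF s] h] sums_unique[OF s] by simp
  \<comment> \<open>Applying \<open>M\<close> twice shifts the series by one, so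
    \<open>h - M (M h)\<close> is its first term \<open>g\<close>.\<close>
  have "pointwise_sums (\<lambda>n. M (M (u n))) (M (M h))"
    by (intro pointwise_sums_anticomm h)
  moreover have "(\<lambda>n. M (M (u n))) = (\<lambda>n. u (Suc n))" by (simp add: u_def)
  ultimately have "M (M h) = h - u 0"
    using pointwise_sums_unique[OF _ pointwise_sums_Suc[OF h]] by simp
  then have "Q (Q h) = g" by (simp add: Q_squared u_def)
  moreover have "state_bound (Q h) (4 / (1 - \<rho>^2) * c)"
    using state_bound_Q[OF hb] by simp
  ultimately show ?thesis by blast
qed

end

section \<open>Gluing half-line inverses\<close>

text \<open>Finite-dimensional spaces are closed. The induction eliminates one coordinate
  \<open>a\<close>: if some \<open>w\<close> in \<open>W\<close> has \<open>w a = 1\<close>,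
  subtracting \<open>f a\<close> times \<open>w\<close> sends \<open>W\<close> to its part vanishing
  at \<open>a\<close> and respects pointwise limits.\<close>

lemma finite_support_subspace_closed:
  fixes W :: "('i \<Rightarrow> complex) set"
  assumes "finite A"
    and "\<And>f g. f \<in> W \<Longrightarrow> g \<in> W \<Longrightarrow> (\<lambda>x. f x + g x) \<in> W"
    and "\<And>k f. f \<in> W \<Longrightarrow> (\<lambda>x. k * f x) \<in> W"
    and "\<And>f x. f \<in> W \<Longrightarrow> x \<notin> A \<Longrightarrow> f x = 0"
    and "\<And>n. u n \<in> W" and "\<And>x. (\<lambda>n::nat. u n x) \<longlonglongrightarrow> v x"
  shows "v \<in> W"
  using assms
proof (induction A arbitrary: W u v rule: finite_induct)
  case empty
  have "v x = u 0 x" for x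
    using empty.prems(3)[OF empty.prems(4)] empty.prems(5)[of x] LIMSEQ_const_iff[of 0 "v x"]
    by simp
  then have "v = u 0" by (rule ext)
  then show ?case using empty.prems(4) by simp
next
  case (insert a A)
  note add = insert.prems(1) and scale = insert.prems(2)
  show ?case
  proof (cases "\<forall>f\<in>W. f a = 0")
    case True
    then have "\<And>f x. f \<in> W \<Longrightarrow> x \<notin> A \<Longrightarrow> f x = 0"
      using insert.prems(3) by (metis insertE)
    then show ?thesis using insert.IH[OF add scale _ insert.prems(4,5)] by blast
  next
    case False
    then obtain w0 where w0: "w0 \<in> W" "w0 a \<noteq> 0" by blast
    define w where "w = (\<lambda>x. inverse (w0 a) * w0 x)"
    have w: "w \<in> W" "w a = 1" using w0 scale by (auto simp: w_def)
    define W' where "W' = {f \<in> W. f a = 0}"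
    define v' where "v' = (\<lambda>x. v x + (- v a) * w x)"
    define u' where "u' n = (\<lambda>x. u n x + (- u n a) * w x)" for n
    have "v' \<in> W'"
    proof (rule insert.IH)
      show "(\<lambda>x. f x + g x) \<in> W'" if "f \<in> W'" "g \<in> W'" for f g
        using that add by (auto simp: W'_def)
      show "(\<lambda>x. k * f x) \<in> W'" if "f \<in> W'" for k f
        using that scale by (auto simp: W'_def)
      show "f x = 0" if "f \<in> W'" "x \<notin> A" for f x
        using that insert.prems(3) by (cases "x = a") (auto simp: W'_def)
      show "u' n \<in> W'" for n
      proof -
        have "u' n \<in> W" unfolding u'_def by (rule add[OF insert.prems(4) scale[OF w(1)]])
        then show ?thesis by (simp add: W'_def u'_def w(2))
      qed
      show "(\<lambda>n. u' n x) \<longlonglongrightarrow> v' x" for x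
        unfolding u'_def v'_def using insert.prems(5) by (intro tendsto_intros)
    qed
    then have "(\<lambda>x. v' x + v a * w x) \<in> W"
      by (intro add scale[OF w(1)]) (simp add: W'_def)
    then show ?thesis by (simp add: v'_def)
  qed
qed

section \<open>Finitely supported states and gluing at the origin\<close>

definition supported_on :: "int set \<Rightarrow> state set" where
  "supported_on A = {\<psi>. \<forall>x. x \<notin> A \<longrightarrow> fst \<psi> x = 0 \<and> snd \<psi> x = 0}"

definition site_states :: "int set \<Rightarrow> state set" where
  "site_states A = (\<lambda>x. (\<lambda>y. if y = x then 1 else 0, \<lambda>y. 0)) ` A \<union>
     (\<lambda>x. (\<lambda>y. 0, \<lambda>y. if y = x then 1 else 0)) ` A"

lemma supported_on_subset_span:
  assumes "finite A"
  shows "supported_on A \<subseteq> hs.span (site_states A)"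
  using assms
proof (induction A rule: finite_induct)
  case empty
  have "\<psi> = 0" if "\<psi> \<in> supported_on {}" for \<psi>
    using that by (intro state_eqI) (auto simp: supported_on_def)
  then show ?case using hs.span_zero by blast
next
  case (insert a A)
  show ?case
  proof
    fix \<psi> assume \<psi>: "\<psi> \<in> supported_on (insert a A)"
    define d1 d2 :: state where "d1 = (\<lambda>y. if y = a then 1 else 0, \<lambda>y. 0)"
      and "d2 = (\<lambda>y. 0, \<lambda>y. if y = a then 1 else 0)"
    have d: "d1 \<in> hs.span (site_states (insert a A))" "d2 \<in> hs.span (site_states (insert a A))"
      by (auto intro!: hs.span_base simp: site_states_def d1_def d2_def)
    define \<phi> where "\<phi> = \<psi> - (hscale (fst \<psi> a) d1 + hscale (snd \<psi> a) d2)"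
    have "\<phi> \<in> supported_on A"
      using \<psi> by (auto simp: supported_on_def \<phi>_def d1_def d2_def)
    moreover have "hs.span (site_states A) \<subseteq> hs.span (site_states (insert a A))"
      by (intro hs.span_mono) (auto simp: site_states_def)
    ultimately have "\<phi> \<in> hs.span (site_states (insert a A))"
      using insert.IH by blast
    then have "\<phi> + (hscale (fst \<psi> a) d1 + hscale (snd \<psi> a) d2) \<in> hs.span (site_states (insert a A))"
      by (intro hs.span_add hs.span_scale d)
    then show "\<psi> \<in> hs.span (site_states (insert a A))" by (simp add: \<phi>_def)
  qed
qed

lemma supported_on_subset_Hspace:
  assumes "finite A"
  shows "supported_on A \<subseteq> Hspace"
proof
  fix \<psi> assume "\<psi> \<in> supported_on A"
  then have "l2_bound (fst \<psi>) (L2_set (\<lambda>x. cmod (fst \<psi> x)) A)" "l2_bound (snd \<psi>) (L2_set (\<lambda>x. cmod (snd \<psi> x)) A)"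
    by (auto intro!: l2_bound_finite_support assms simp: supported_on_def)
  then show "\<psi> \<in> Hspace"
    unfolding Hspace_def by (auto simp: summable_sq_iff_l2_bound)
qed

lemma site_states_subset: "site_states A \<subseteq> supported_on A"
  by (auto simp: site_states_def supported_on_def)

lemma finite_site_states: "finite A \<Longrightarrow> finite (site_states A)"
  by (auto simp: site_states_def)

definition glue :: "state \<Rightarrow> state \<Rightarrow> state" where
  "glue \<psi> \<phi> = (\<lambda>x. if 0 \<le> x then fst \<psi> x else fst \<phi> x, \<lambda>x. if 0 \<le> x then snd \<psi> x else snd \<phi> x)"

lemma l2_bound_glue:
  assumes "l2_bound f c" "l2_bound g d"
  shows "l2_bound (\<lambda>x::int. if 0 \<le> x then f x else g x) (c + d)"
proof -
  have "l2_bound (\<lambda>x. (if 0 \<le> x then 1 else 0) * f x + (if 0 \<le> x then 0 else 1) * g x) (1 * c + 1 * d)"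
    by (intro l2_bound_add l2_bound_mult assms) auto
  moreover have "(\<lambda>x. (if 0 \<le> x then 1 else 0) * f x + (if 0 \<le> x then 0 else 1) * g x)
      = (\<lambda>x. if 0 \<le> x then f x else g x)" by auto
  ultimately show ?thesis by simp
qed

lemma state_bound_glue:
  "state_bound \<psi> c \<Longrightarrow> state_bound \<phi> d \<Longrightarrow> state_bound (glue \<psi> \<phi>) (c + d)"
  by (simp add: state_bound_def glue_def l2_bound_glue)

lemma glue_in_Hspace: "\<psi> \<in> Hspace \<Longrightarrow> \<phi> \<in> Hspace \<Longrightarrow> glue \<psi> \<phi> \<in> Hspace"
  using Hspace_iff_state_bound state_bound_glue by metis

context contractive_walk
begin

text \<open>Preimages of the generators span the preimage, because \<open>Q\<close> is bijective
  here. It is meant for half-line truncations of kernel states, whose images live on finitely many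
  sites.\<close>

lemma preimage_span_finite:
  assumes "finite S" "S \<subseteq> Hspace"
  shows "\<exists>F. finite F \<and> (\<forall>\<psi>\<in>Hspace. Q \<psi> \<in> hs.span S \<longrightarrow> \<psi> \<in> hs.span F)"
proof -
  have "\<exists>\<psi>\<in>Hspace. Q \<psi> = s" if "s \<in> S" for s
    using that assms(2) Q_surjective Hspace_iff_state_bound by blast
  then obtain h where h: "\<And>s. s \<in> S \<Longrightarrow> h s \<in> Hspace \<and> Q (h s) = s" by metis
  define V where "V = Q ` (hs.span (h ` S) \<inter> Hspace)"
  have "hs.subspace V"
    unfolding V_def
    using hs.subspace_inter[OF hs.subspace_span subspace_Hspace]
    by (auto simp: hs.subspace_def image_iff) (metis Qop_zero Int_iff, metis Qop_add Int_iff, metis Qop_hscale Int_iff)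
  moreover have "S \<subseteq> V"
    unfolding V_def using h by (force intro: hs.span_base)
  ultimately have SV: "hs.span S \<subseteq> V" by (rule hs.span_minimal[rotated])
  have "\<psi> \<in> hs.span (h ` S)" if \<psi>: "\<psi> \<in> Hspace" "Q \<psi> \<in> hs.span S" for \<psi>
  proof -
    have "Q \<psi> \<in> V" using \<psi> SV by blast
    then obtain w where w: "w \<in> hs.span (h ` S)" "w \<in> Hspace" "Q w = Q \<psi>"
      unfolding V_def by auto
    have "\<psi> - w = 0"
      by (rule Q_injective) (use w \<psi> in \<open>simp_all add: Hspace_diff Qop_diff\<close>)
    then show ?thesis using w by simp
  qed
  then show ?thesis using assms(1) by blast
qed

end

section \<open>Walks that agree with a contractive model on each half-line\<close>

locale glued_walk = walk p q a1 a2 b + R: contractive_walk p q r1 r2 rb \<rho>R +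
  L: contractive_walk p q l1 l2 lb \<rho>L
  for p q a1 a2 b r1 r2 rb \<rho>R l1 l2 lb \<rho>L +
  fixes N :: int
  assumes N: "0 \<le> N"
    and right: "\<And>x. N \<le> x \<Longrightarrow> a1 x = r1 x \<and> a2 x = r2 x \<and> b x = rb x"
    and left: "\<And>x. x \<le> - N \<Longrightarrow> a1 x = l1 x \<and> a2 x = l2 x \<and> b x = lb x"
begin

text \<open>The margin exceeds the range of \<open>Q\<close>, so that outside the core neither the
  seam at 0 nor a site where coin and model differ is visible.\<close>

abbreviation "core \<equiv> {- (N + 2)..N + 2}"

lemma Q_right:
  assumes "x > N + 2" "\<And>y. 0 \<le> y \<Longrightarrow> fst \<psi> y = fst \<phi> y \<and> snd \<psi> y = snd \<phi> y"
  shows "fst (Q \<psi>) x = fst (R.Q \<phi>) x" "snd (Q \<psi>) x = snd (R.Q \<phi>) x"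
  using assms N by (intro Qop_local right; auto)+

lemma Q_left:
  assumes "x < - (N + 2)" "\<And>y. y < 0 \<Longrightarrow> fst \<psi> y = fst \<phi> y \<and> snd \<psi> y = snd \<phi> y"
  shows "fst (Q \<psi>) x = fst (L.Q \<phi>) x" "snd (Q \<psi>) x = snd (L.Q \<phi>) x"
  using assms N by (intro Qop_local left; auto)+

text \<open>Solving with each model and gluing the solutions at 0 is exact away from the core.
  \<open>K\<close> does not depend on \<open>g\<close>, which is what closedness of the range relies
  on.\<close>

lemma parametrix:
  obtains K where "\<And>g c. state_bound g c \<Longrightarrow>
    \<exists>\<psi>. state_bound \<psi> (K * c) \<and> Q \<psi> - g \<in> supported_on core"
proof -
  define KR KL where "KR = 4 / (1 - \<rho>R^2)" and "KL = 4 / (1 - \<rho>L^2)"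
  have "\<exists>\<psi>. state_bound \<psi> ((KR + KL) * c) \<and> Q \<psi> - g \<in> supported_on core"
    if g: "state_bound g c" for g c
  proof -
    obtain \<psi>R where \<psi>R: "state_bound \<psi>R (KR * c)" "R.Q \<psi>R = g"
      using R.Q_surjective[OF g] unfolding KR_def by blast
    obtain \<psi>L where \<psi>L: "state_bound \<psi>L (KL * c)" "L.Q \<psi>L = g"
      using L.Q_surjective[OF g] unfolding KL_def by blast
    have "state_bound (glue \<psi>R \<psi>L) ((KR + KL) * c)"
      using state_bound_glue[OF \<psi>R(1) \<psi>L(1)] by (simp add: algebra_simps)
    moreover have "fst (Q (glue \<psi>R \<psi>L) - g) x = 0 \<and> snd (Q (glue \<psi>R \<psi>L) - g) x = 0" if "x \<notin> core" for x
      using that Q_right[of x "glue \<psi>R \<psi>L" \<psi>R] Q_left[of x "glue \<psi>R \<psi>L" \<psi>L] \<psi>R(2) \<psi>L(2)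
      by (cases "x > N + 2") (simp_all add: glue_def)
    then have "Q (glue \<psi>R \<psi>L) - g \<in> supported_on core" unfolding supported_on_def by blast
    ultimately show ?thesis by blast
  qed
  then show thesis using that by blast
qed

text \<open>Cutting a kernel state at 0 gives two halves, which the respective models map to states
  on the core. Each half thus lies in the preimage of a finite-dimensional space under an injective
  map.\<close>

lemma kernel_finite_dim: "\<exists>F. finite F \<and> {\<psi> \<in> Hspace. Q \<psi> = 0} \<subseteq> hs.span F"
proof -
  have S: "finite (site_states core)" "site_states core \<subseteq> Hspace"
    using site_states_subset supported_on_subset_Hspace[of core] finite_site_states by auto
  obtain FR where FR: "finite FR" "\<And>\<psi>. \<psi> \<in> Hspace \<Longrightarrow> R.Q \<psi> \<in> hs.span (site_states core) \<Longrightarrow> \<psi> \<in> hs.span FR"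
    using R.preimage_span_finite[OF S] by blast
  obtain FL where FL: "finite FL" "\<And>\<psi>. \<psi> \<in> Hspace \<Longrightarrow> L.Q \<psi> \<in> hs.span (site_states core) \<Longrightarrow> \<psi> \<in> hs.span FL"
    using L.preimage_span_finite[OF S] by blast
  have "\<psi> \<in> hs.span (FR \<union> FL)" if \<psi>: "\<psi> \<in> Hspace" "Q \<psi> = 0" for \<psi>
  proof -
    have fin: "hs.span (site_states core) \<supseteq> supported_on core"
      by (rule supported_on_subset_span) simp
    have "fst (R.Q (glue \<psi> 0)) x = 0 \<and> snd (R.Q (glue \<psi> 0)) x = 0" if "x \<notin> core" for x
      using that Q_right[of x \<psi> "glue \<psi> 0"] Qop_local[of x r1 r1 r2 r2 rb rb "glue \<psi> 0" 0 p q] N \<psi>(2)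
      by (cases "x > N + 2") (simp_all add: glue_def Qop_zero)
    then have "R.Q (glue \<psi> 0) \<in> supported_on core" unfolding supported_on_def by blast
    then have R: "glue \<psi> 0 \<in> hs.span FR"
      using FR(2) fin glue_in_Hspace[OF \<psi>(1) Hspace_zero] by blast
    have "fst (L.Q (glue 0 \<psi>)) x = 0 \<and> snd (L.Q (glue 0 \<psi>)) x = 0" if "x \<notin> core" for x
      using that Q_left[of x \<psi> "glue 0 \<psi>"] Qop_local[of x l1 l1 l2 l2 lb lb "glue 0 \<psi>" 0 p q] N \<psi>(2)
      by (cases "x > N + 2") (simp_all add: glue_def Qop_zero)
    then have "L.Q (glue 0 \<psi>) \<in> supported_on core" unfolding supported_on_def by blast
    then have L: "glue 0 \<psi> \<in> hs.span FL"
      using FL(2) fin glue_in_Hspace[OF Hspace_zero \<psi>(1)] by blast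
    have "glue \<psi> 0 + glue 0 \<psi> \<in> hs.span (FR \<union> FL)"
      using R L hs.span_mono[of FR "FR \<union> FL"] hs.span_mono[of FL "FR \<union> FL"]
      by (intro hs.span_add) auto
    moreover have "glue \<psi> 0 + glue 0 \<psi> = \<psi>"
      by (rule state_eqI) (auto simp: glue_def)
    ultimately show ?thesis by simp
  qed
  then show ?thesis using FR(1) FL(1) by (intro exI[of _ "FR \<union> FL"]) auto
qed

text \<open>The parametrix corrects both \<phi> and the errors \<open>u n - \<phi>\<close>. What is
  left over lies in the range and on the core, a finite-dimensional space, and converges to the
  defect \<open>Q \<omega> - \<phi>\<close>. That space is closed, so the defect, and with it
  \<phi>, is in the range.\<close>

lemma range_closed:
  assumes u: "\<And>n. u n \<in> Q ` Hspace" and \<phi>: "\<phi> \<in> Hspace" and lim: "(\<lambda>n. hnorm (u n - \<phi>)) \<longlonglongrightarrow> 0"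
  shows "\<phi> \<in> Q ` Hspace"
proof -
  obtain K where K: "\<And>g c. state_bound g c \<Longrightarrow>
    \<exists>\<psi>. state_bound \<psi> (K * c) \<and> Q \<psi> - g \<in> supported_on core"
    using parametrix by blast
  obtain \<omega> where \<omega>: "\<omega> \<in> Hspace" "Q \<omega> - \<phi> \<in> supported_on core"
    using K \<phi> Hspace_iff_state_bound by meson
  have d: "u n - \<phi> \<in> Hspace" for n
    using u[of n] by (auto intro!: Hspace_diff[OF _ \<phi>] Hspace_Q)
  obtain \<xi> where \<xi>: "\<And>n. state_bound (\<xi> n) (K * hnorm (u n - \<phi>))"
    "\<And>n. Q (\<xi> n) - (u n - \<phi>) \<in> supported_on core"
    using K[OF state_bound_hnorm[OF d]] by metis
  \<comment> \<open>The two \<phi> cancel: \<open>e n = Q (\<omega> + \<xi> n) - u n\<close> is in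
    the range as well as supported on the core.\<close>
  define e where "e n = (Q \<omega> - \<phi>) + (Q (\<xi> n) - (u n - \<phi>))" for n
  \<comment> \<open>Flattens the two components into one scalar function, to which the closedness of
    finitely supported subspaces applies.\<close>
  define emb :: "state \<Rightarrow> int \<times> bool \<Rightarrow> complex"
    where "emb \<psi> = (\<lambda>(x, i). if i then fst \<psi> x else snd \<psi> x)" for \<psi>
  have inj_emb: "\<psi> = \<psi>'" if "emb \<psi> = emb \<psi>'" for \<psi> \<psi>'
  proof (rule state_eqI)
    fix x
    show "fst \<psi> x = fst \<psi>' x" using fun_cong[OF that, of "(x, True)"] by (simp add: emb_def)
    show "snd \<psi> x = snd \<psi>' x" using fun_cong[OF that, of "(x, False)"] by (simp add: emb_def)
  qed
  define W where "W = emb ` (supported_on core \<inter> Q ` Hspace)"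
  have "emb (Q \<omega> - \<phi>) \<in> W"
  proof (rule finite_support_subspace_closed[of "core \<times> UNIV" W "\<lambda>n. emb (e n)"])
    show "finite (core \<times> (UNIV :: bool set))" by simp
    show "(\<lambda>x. f x + g x) \<in> W" if fg: "f \<in> W" "g \<in> W" for f g
    proof -
      obtain \<psi> \<psi>' where "f = emb (Q \<psi>)" "g = emb (Q \<psi>')" "\<psi> \<in> Hspace" "\<psi>' \<in> Hspace"
        "Q \<psi> \<in> supported_on core" "Q \<psi>' \<in> supported_on core"
        using fg unfolding W_def by auto
      then have "(\<lambda>x. f x + g x) = emb (Q (\<psi> + \<psi>'))" "\<psi> + \<psi>' \<in> Hspace"
        "Q (\<psi> + \<psi>') \<in> supported_on core"
        by (auto simp: emb_def Qop_add Hspace_add supported_on_def)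
      then show ?thesis unfolding W_def by blast
    qed
    show "(\<lambda>x. k * f x) \<in> W" if f: "f \<in> W" for k f
    proof -
      obtain \<psi> where "f = emb (Q \<psi>)" "\<psi> \<in> Hspace" "Q \<psi> \<in> supported_on core"
        using f unfolding W_def by auto
      then have "(\<lambda>x. k * f x) = emb (Q (hscale k \<psi>))" "hscale k \<psi> \<in> Hspace"
        "Q (hscale k \<psi>) \<in> supported_on core"
        by (auto simp: emb_def Qop_hscale Hspace_hscale supported_on_def)
      then show ?thesis unfolding W_def by blast
    qed
    show "f x = 0" if "f \<in> W" "x \<notin> core \<times> UNIV" for f x
      using that unfolding W_def supported_on_def emb_def by (cases x) (auto simp del: atLeastAtMost_iff)
    show "emb (e n) \<in> W" for n
    proof -
      have "e n \<in> supported_on core"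
        using \<omega>(2) \<xi>(2)[of n] unfolding e_def by (simp add: supported_on_def)
      moreover have "e n \<in> Q ` Hspace"
      proof -
        obtain \<psi> where \<psi>: "\<psi> \<in> Hspace" "u n = Q \<psi>" using u[of n] by blast
        have "\<xi> n \<in> Hspace" using \<xi>(1) Hspace_iff_state_bound by blast
        then have "\<omega> + \<xi> n - \<psi> \<in> Hspace" using \<omega>(1) \<psi>(1) Hspace_add Hspace_diff by simp
        moreover have "e n = Q (\<omega> + \<xi> n - \<psi>)"
          unfolding e_def \<psi>(2) by (simp add: Qop_add Qop_diff)
        ultimately show ?thesis by blast
      qed
      ultimately show ?thesis unfolding W_def by blast
    qed
    have b1: "state_bound (Q (\<xi> n)) (4 * (K * hnorm (u n - \<phi>)))" for n
      by (rule state_bound_Q[OF \<xi>(1)])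
    have b2: "state_bound (u n - \<phi>) (hnorm (u n - \<phi>))" for n
      by (rule state_bound_hnorm[OF d])
    have b: "state_bound (e n - (Q \<omega> - \<phi>)) (4 * (K * hnorm (u n - \<phi>)) + hnorm (u n - \<phi>))" for n
      using state_bound_diff[OF b1[of n] b2[of n]] by (simp add: e_def algebra_simps)
    have l: "(\<lambda>n. 4 * (K * hnorm (u n - \<phi>)) + hnorm (u n - \<phi>)) \<longlonglongrightarrow> 0"
      using tendsto_add[OF tendsto_mult[OF tendsto_const[of 4] tendsto_mult[OF tendsto_const[of K] lim]] lim]
      by simp
    have "(\<lambda>n. fst (e n) x - fst (Q \<omega> - \<phi>) x) \<longlonglongrightarrow> 0" "(\<lambda>n. snd (e n) x - snd (Q \<omega> - \<phi>) x) \<longlonglongrightarrow> 0" for x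
      using state_bound_pointwise[OF b, where x = x]
      by (auto intro!: Lim_null_comparison[OF _ l])
    then have "(\<lambda>n. fst (e n) x) \<longlonglongrightarrow> fst (Q \<omega> - \<phi>) x" "(\<lambda>n. snd (e n) x) \<longlonglongrightarrow> snd (Q \<omega> - \<phi>) x" for x
      using Lim_null by blast+
    then show "(\<lambda>n. emb (e n) x) \<longlonglongrightarrow> emb (Q \<omega> - \<phi>) x" for x
      by (cases x) (auto simp: emb_def)
  qed
  then obtain \<psi> where "\<psi> \<in> Hspace" "emb (Q \<psi>) = emb (Q \<omega> - \<phi>)"
    unfolding W_def by auto
  then have "\<psi> \<in> Hspace" "Q \<psi> = Q \<omega> - \<phi>" using inj_emb by blast+
  then have "\<omega> - \<psi> \<in> Hspace" "\<phi> = Q (\<omega> - \<psi>)" using \<omega>(1) by (auto simp: Hspace_diff Qop_diff)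
  then show ?thesis by blast
qed

lemma fredholm: "is_fredholm p q a1 a2 b"
proof -
  \<comment> \<open>\<open>P 1\<close> and \<open>P (-1)\<close> are the projections onto the
    eigenspaces of \<Gamma>. Since \<open>Q\<close> anticommutes with \<Gamma>, it intertwines them,
    which carries all three Fredholm properties from \<open>Q\<close> over to
    \<open>Q\<^sub>+\<close>.\<close>
  define P where "P s \<psi> = hscale (1/2) (\<psi> + hscale s (\<Gamma> \<psi>))" for s \<psi>
  have P_plus: "P 1 \<psi> \<in> Hplus p q" and P_minus: "P (-1) \<psi> \<in> Hminus p q" if "\<psi> \<in> Hspace" for \<psi>
  proof -
    have "P s \<psi> \<in> Hspace" for s
      unfolding P_def using that Hspace_Gam Hspace_hscale Hspace_add by simp
    moreover have "\<Gamma> (P 1 \<psi>) = P 1 \<psi>" "\<Gamma> (P (-1) \<psi>) = - P (-1) \<psi>"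
      unfolding P_def by (auto intro!: state_eqI simp: Gam_hscale Gam_add Gam_diff Gam_minus Gam_Gam field_simps)
    ultimately show "P 1 \<psi> \<in> Hplus p q" "P (-1) \<psi> \<in> Hminus p q"
      by (simp_all add: Hplus_def Hminus_def)
  qed
  have QP: "Q (P 1 \<psi>) = P (-1) (Q \<psi>)" for \<psi>
    unfolding P_def by (simp add: Qop_hscale Qop_add Gam_Q hs.scale_minus_right hs.scale_minus_left)
  have P_fix: "P (-1) \<psi> = \<psi>" if "\<psi> \<in> Hminus p q" for \<psi>
    using that unfolding P_def Hminus_def by (auto intro!: state_eqI simp: field_simps)
  have subH: "Hplus p q \<subseteq> Hspace" "Hminus p q \<subseteq> Hspace" by (auto simp: Hplus_def Hminus_def)
  have P_lin: "P (-1) (\<psi> + \<phi>) = P (-1) \<psi> + P (-1) \<phi>" "P (-1) (hscale k \<psi>) = hscale k (P (-1) \<psi>)"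
    "P (-1) 0 = 0" for \<psi> \<phi> k
    unfolding P_def by (auto intro!: state_eqI simp: Gam_add Gam_diff Gam_minus Gam_hscale field_simps)
      (simp_all add: Gam_def Lshift_def Lshift_adj_def)
  have 1: "\<exists>F. finite F \<and> {\<psi> \<in> Hplus p q. Q \<psi> = 0} \<subseteq> cspan F"
    using kernel_finite_dim subH unfolding cspan_def by blast
  have 2: "H_closed (Q ` Hplus p q)"
    unfolding H_closed_def
  proof (intro allI impI, elim conjE)
    fix u \<phi> assume u: "\<forall>n. u n \<in> Q ` Hplus p q" and \<phi>: "\<phi> \<in> Hspace"
      and lim: "(\<lambda>n. hnorm (u n - \<phi>)) \<longlonglongrightarrow> 0"
    have "\<phi> \<in> Q ` Hspace" using range_closed[OF _ \<phi> lim] u subH by blast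
    then obtain \<psi> where \<psi>: "\<psi> \<in> Hspace" "\<phi> = Q \<psi>" by blast
    have anti: "\<Gamma> (u n) = - u n" for n
    proof -
      obtain \<psi>' where "\<psi>' \<in> Hplus p q" "u n = Q \<psi>'" using u by blast
      then show ?thesis by (simp add: Gam_Q Hplus_def)
    qed
    \<comment> \<open>The limit stays in the eigenspace: \<Gamma> contributes a factor 2 and the
      identity 1 to the bound by the error.\<close>
    have "state_bound (\<Gamma> \<phi> + \<phi>) (3 * hnorm (u n - \<phi>))" for n
    proof -
      obtain \<psi>' where "\<psi>' \<in> Hspace" "u n = Q \<psi>'" using u subH by (metis imageE subsetD)
      then have b: "state_bound (u n - \<phi>) (hnorm (u n - \<phi>))"
        by (intro state_bound_hnorm Hspace_diff[OF _ \<phi>]) (simp add: Hspace_Q)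
      have "\<Gamma> \<phi> + \<phi> = hscale (-1) (\<Gamma> (u n - \<phi>) + (u n - \<phi>))"
        by (rule state_eqI) (simp_all add: Gam_diff anti)
      moreover have "state_bound (hscale (-1) (\<Gamma> (u n - \<phi>) + (u n - \<phi>)))
          (cmod (-1) * (2 * hnorm (u n - \<phi>) + hnorm (u n - \<phi>)))"
        by (intro state_bound_hscale state_bound_add state_bound_Gam b)
      ultimately show ?thesis by (simp only: norm_minus_cancel norm_one) simp
    qed
    moreover have "(\<lambda>n. 3 * hnorm (u n - \<phi>)) \<longlonglongrightarrow> 0" using tendsto_mult[OF tendsto_const[of 3] lim] by simp
    ultimately have "\<Gamma> \<phi> + \<phi> = 0" by (rule state_zero_if_bounds_vanish)
    then have "\<phi> \<in> Hminus p q" using \<phi> by (simp add: Hminus_def eq_neg_iff_add_eq_0)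
    then have "\<phi> = Q (P 1 \<psi>)" using P_fix QP \<psi> by simp
    then show "\<phi> \<in> Q ` Hplus p q" using P_plus[OF \<psi>(1)] by blast
  qed
  have 3: "\<exists>F. finite F \<and> F \<subseteq> Hminus p q \<and> Hminus p q \<subseteq> cspan (Q ` Hplus p q \<union> F)"
  proof (intro exI conjI)
    let ?S = "site_states core"
    have S: "finite ?S" "?S \<subseteq> Hspace"
      using site_states_subset supported_on_subset_Hspace[of core] finite_site_states by auto
    show "finite (P (-1) ` ?S)" using S by simp
    show "P (-1) ` ?S \<subseteq> Hminus p q" using P_minus S by blast
    show "Hminus p q \<subseteq> cspan (Q ` Hplus p q \<union> P (-1) ` ?S)"
    proof
      fix g assume g: "g \<in> Hminus p q"
      obtain K where K: "\<And>g c. state_bound g c \<Longrightarrow>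
        \<exists>\<psi>. state_bound \<psi> (K * c) \<and> Q \<psi> - g \<in> supported_on core"
        using parametrix by blast
      obtain \<psi> where \<psi>: "\<psi> \<in> Hspace" "Q \<psi> - g \<in> supported_on core"
        using K g subH Hspace_iff_state_bound by (meson subsetD)
      let ?V = "{\<phi>. P (-1) \<phi> \<in> hs.span (P (-1) ` ?S)}"
      let ?U = "hs.span (Q ` Hplus p q \<union> P (-1) ` ?S)"
      have "hs.subspace ?V"
        unfolding hs.subspace_def using P_lin hs.span_zero hs.span_add hs.span_scale by auto
      moreover have "?S \<subseteq> ?V" using hs.span_base by blast
      ultimately have "hs.span ?S \<subseteq> ?V" by (rule hs.span_minimal[rotated])
      then have "P (-1) (Q \<psi> - g) \<in> hs.span (P (-1) ` ?S)"
        using \<psi>(2) supported_on_subset_span[of core] by auto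
      \<comment> \<open>Projecting keeps \<open>g\<close>, turns \<psi> into a state of
        \<open>Hplus\<close>, and moves the defect into the span of the projected site
        states.\<close>
      moreover have "P (-1) (Q \<psi> - g) = Q (P 1 \<psi>) - g"
        using P_lin(1)[of "Q \<psi> - g" g] P_fix[OF g] QP by (simp add: algebra_simps)
      ultimately have "Q (P 1 \<psi>) - g \<in> ?U"
        using hs.span_mono[of "P (-1) ` ?S" "Q ` Hplus p q \<union> P (-1) ` ?S"] by auto
      moreover have "Q (P 1 \<psi>) \<in> ?U"
        using P_plus[OF \<psi>(1)] by (intro hs.span_base) blast
      ultimately have "Q (P 1 \<psi>) - (Q (P 1 \<psi>) - g) \<in> ?U"
        by (rule hs.span_diff[rotated])
      then show "g \<in> cspan (Q ` Hplus p q \<union> P (-1) ` ?S)" by (simp add: cspan_def)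
    qed
  qed
  show ?thesis unfolding is_fredholm_def using 1 2 3 by blast
qed

end

section \<open>Tridiagonal operators without closed range\<close>

definition tridiag :: "(int \<Rightarrow> complex) \<Rightarrow> (int \<Rightarrow> complex) \<Rightarrow> (int \<Rightarrow> complex) \<Rightarrow>
    (int \<Rightarrow> complex) \<Rightarrow> int \<Rightarrow> complex" where
  "tridiag A B D f x = A x * f (x - 1) + B x * f x + D x * f (x + 1)"

definition tridiag_range_closed :: "(int \<Rightarrow> complex) \<Rightarrow> (int \<Rightarrow> complex) \<Rightarrow> (int \<Rightarrow> complex) \<Rightarrow> bool" where
  "tridiag_range_closed A B D \<longleftrightarrow> (\<forall>u g \<epsilon>. (\<forall>n::nat. \<exists>c. l2_bound (u n) c) \<and>
     (\<forall>n. l2_bound (\<lambda>x. tridiag A B D (u n) x - g x) (\<epsilon> n)) \<and> \<epsilon> \<longlonglongrightarrow> 0 \<longrightarrow>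
     (\<exists>h c. l2_bound h c \<and> tridiag A B D h = g))"

lemma tridiag_range_closedD:
  assumes "tridiag_range_closed A B D" "\<And>n::nat. \<exists>c. l2_bound (u n) c"
    "\<And>n. l2_bound (\<lambda>x. tridiag A B D (u n) x - g x) (\<epsilon> n)" "\<epsilon> \<longlonglongrightarrow> 0"
  shows "\<exists>h c. l2_bound h c \<and> tridiag A B D h = g"
  using assms(1)[unfolded tridiag_range_closed_def, THEN spec[of _ u], THEN spec[of _ g], THEN spec[of _ \<epsilon>]]
    assms(2-) by blast

lemma l2_bound_finite_support_le:
  assumes "finite E" "\<And>x. x \<notin> E \<Longrightarrow> f x = 0" "\<And>x. cmod (f x) \<le> k"
  shows "l2_bound f (sqrt (card E) * k)"
proof -
  have k: "0 \<le> k" using assms(3)[of undefined] norm_ge_zero order_trans by blast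
  have "L2_set (\<lambda>x. cmod (f x)) E \<le> L2_set (\<lambda>x. k) E"
    by (rule L2_set_mono) (use assms in auto)
  also have "\<dots> = sqrt (card E) * k" using k by (simp add: L2_set_def real_sqrt_mult)
  finally have "L2_set (\<lambda>x. cmod (f x)) E \<le> sqrt (card E) * k" .
  moreover have "l2_bound f (L2_set (\<lambda>x. cmod (f x)) E)"
    by (rule l2_bound_finite_support) (use assms in auto)
  ultimately show ?thesis using l2_bound_mono by blast
qed

text \<open>Approximate eigenfunctions for the value \<open>0\<close>: plane waves \<open>\<zeta>\<^sup>x\<close> at a zero \<open>\<zeta>\<close> of the
  limiting symbol, cut off to a long interval far to the right.\<close>

lemma tridiag_hump_exists:
  assumes bd: "\<And>x. cmod (A x) \<le> K" "\<And>x. cmod (B x) \<le> K" "\<And>x. cmod (D x) \<le> K"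
    and lim: "(A \<longlongrightarrow> \<alpha>) at_top" "(B \<longlongrightarrow> \<beta>) at_top" "(D \<longlongrightarrow> \<delta>) at_top"
    and \<zeta>: "cmod \<zeta> = 1" "\<alpha> + \<beta> * \<zeta> + \<delta> * \<zeta>^2 = 0" and e: "0 < e"
  shows "\<exists>f s t. n0 \<le> s \<and> s \<le> t \<and> (\<forall>x. x \<notin> {s..t} \<longrightarrow> f x = 0) \<and>
    (\<Sum>x=s..t. (cmod (f x))^2) = 1 \<and> l2_bound (tridiag A B D f) e"
proof -
  define S where "S x = A x + B x * \<zeta> + D x * \<zeta>^2" for x
  have "(S \<longlongrightarrow> \<alpha> + \<beta> * \<zeta> + \<delta> * \<zeta>^2) at_top"
    unfolding S_def by (intro tendsto_intros lim)
  then have "\<forall>\<^sub>F x in at_top. cmod (S x) < e / 2"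
    using e \<zeta>(2) by (auto simp: tendsto_iff dest: spec[of _ "e / 2"])
  then obtain n1 where n1: "\<And>x. n1 \<le> x \<Longrightarrow> cmod (S x) < e / 2"
    by (auto simp: eventually_at_top_linorder)
  define s where "s = max n0 n1"
  have K0: "0 \<le> K" using bd(1)[of 0] norm_ge_zero order_trans by blast
  \<comment> \<open>The at most four boundary sites contribute at most sqrt 4 times 3K / sqrt m, so
    the length m of the hump is chosen with 6K / sqrt m at most e / 2.\<close>
  have "filterlim (\<lambda>m::nat. sqrt (real m)) at_top sequentially"
    by (intro filterlim_compose[OF sqrt_at_top] filterlim_real_sequentially)
  then have "\<forall>\<^sub>F m::nat in sequentially. sqrt (real m) \<ge> 12 * K / e + 1"
    by (simp add: filterlim_at_top)
  then obtain m0 where m0: "\<And>m. m \<ge> m0 \<Longrightarrow> sqrt (real m) \<ge> 12 * K / e + 1"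
    by (auto simp: eventually_sequentially)
  define m where "m = max m0 1"
  have m: "m \<ge> 1" "12 * K / e + 1 \<le> sqrt (real m)" using m0[of m] by (auto simp: m_def)
  then have cpos: "0 < sqrt (real m)" by simp
  have "12 * K / e \<le> sqrt (real m)" using m by linarith
  then have mK: "6 * K / sqrt (real m) \<le> e / 2"
    using cpos e by (simp add: field_simps)
  define t where "t = s + int m - 1"
  define I :: "int \<Rightarrow> complex" where "I x = (if x \<in> {s..t} then 1 else 0)" for x
  define c :: complex where "c = 1 / sqrt (real m)"
  have cc: "cmod c = 1 / sqrt (real m)" by (simp add: c_def norm_divide)
  define f where "f x = c * \<zeta> powi x * I x" for x
  have \<zeta>0: "\<zeta> \<noteq> 0" using \<zeta>(1) by auto
  have z1: "cmod (\<zeta> powi x) = 1" for x by (simp add: norm_power_int \<zeta>(1))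
  define W where "W x = A x * I (x - 1) + B x * \<zeta> * I x + D x * \<zeta>^2 * I (x + 1)" for x
  have T: "tridiag A B D f x = c * \<zeta> powi (x - 1) * W x" for x
  proof -
    have "\<zeta> powi x = \<zeta> powi (x - 1) * \<zeta>" "\<zeta> powi (x + 1) = \<zeta> powi (x - 1) * \<zeta>^2"
      using \<zeta>0 power_int_add[of \<zeta> "x - 1" 1] power_int_add[of \<zeta> "x - 1" 2]
      by (auto simp: add.commute)
    then show ?thesis by (simp add: tridiag_def f_def W_def algebra_simps)
  qed
  have Tn: "cmod (tridiag A B D f x) = cmod (W x) / sqrt (real m)" for x
    unfolding T by (simp add: norm_mult z1 cc)
  have W3: "cmod (W x) \<le> 3 * K" for x
  proof -
    have "cmod (A x * I (x - 1)) \<le> K" "cmod (B x * \<zeta> * I x) \<le> K" "cmod (D x * \<zeta>^2 * I (x + 1)) \<le> K"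
      using bd[of x] K0 by (auto simp: I_def norm_mult norm_power \<zeta>(1))
    then show ?thesis
      using norm_triangle_ineq[of "A x * I (x - 1) + B x * \<zeta> * I x" "D x * \<zeta>^2 * I (x + 1)"]
        norm_triangle_ineq[of "A x * I (x - 1)" "B x * \<zeta> * I x"] unfolding W_def by linarith
  qed
  \<comment> \<open>Around these sites the cut-off is not constant on three neighbours and only the
    crude bound 3K on \<open>W\<close> is available. At all others \<open>W\<close> is either 0 or
    the symbol value \<open>S\<close>, which is small.\<close>
  define E where "E = {s - 1, s, t, t + 1}"
  define g1 where "g1 x = (if x \<in> E then tridiag A B D f x else 0)" for x
  define g2 where "g2 x = (if x \<in> E then 0 else tridiag A B D f x)" for x
  have "l2_bound g1 (sqrt (card E) * (3 * K / sqrt (real m)))"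
    by (rule l2_bound_finite_support_le)
      (use W3 Tn K0 in \<open>auto simp: g1_def E_def intro!: divide_right_mono\<close>)
  moreover have "sqrt (card E) * (3 * K / sqrt (real m)) \<le> 2 * (3 * K / sqrt (real m))"
  proof (rule mult_right_mono)
    have "card E \<le> 4" using card_length[of "[s - 1, s, t, t + 1]"] by (simp add: E_def)
    then show "sqrt (card E) \<le> 2" by (intro real_le_lsqrt) auto
  qed (use K0 in auto)
  ultimately have b1: "l2_bound g1 (e / 2)"
    using mK by (elim l2_bound_mono) simp
  have g2: "g2 x = 0" if "x \<notin> {s..t}" for x
  proof (cases "x \<in> E")
    case False
    then have "x < s - 1 \<or> x > t + 1" using that by (auto simp: E_def)
    then have "W x = 0" by (auto simp: W_def I_def)
    then show ?thesis by (simp add: g2_def T)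
  qed (simp add: g2_def)
  have g2': "cmod (g2 x) \<le> (e / 2) / sqrt (real m)" for x
  proof (cases "x \<in> E \<or> x \<notin> {s..t}")
    case True
    then show ?thesis using g2[of x] e by (auto simp: g2_def)
  next
    case False
    then have x: "s < x" "x < t" by (auto simp: E_def)
    then have "W x = S x" by (simp add: W_def I_def S_def)
    moreover have "cmod (S x) \<le> e / 2" using n1[of x] x by (simp add: s_def)
    ultimately have "cmod (W x) / sqrt (real m) \<le> (e / 2) / sqrt (real m)"
      by (intro divide_right_mono) auto
    then show ?thesis using False by (auto simp: g2_def Tn)
  qed
  have "l2_bound g2 (sqrt (card {s..t}) * ((e / 2) / sqrt (real m)))"
    by (rule l2_bound_finite_support_le) (use g2 g2' in auto)
  moreover have "card {s..t} = m" by (simp add: t_def)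
  ultimately have b2: "l2_bound g2 (e / 2)" using cpos by simp
  have "l2_bound (\<lambda>x. g1 x + g2 x) (e / 2 + e / 2)" by (rule l2_bound_add[OF b1 b2])
  moreover have "(\<lambda>x. g1 x + g2 x) = tridiag A B D f" by (auto simp: g1_def g2_def)
  ultimately have "l2_bound (tridiag A B D f) e" by simp
  moreover have "(\<Sum>x=s..t. (cmod (f x))^2) = 1"
  proof -
    have "(\<Sum>x=s..t. (cmod (f x))^2) = (\<Sum>x=s..t. 1 / real m)"
      by (rule sum.cong) (auto simp: f_def I_def norm_mult z1 cc power_divide)
    also have "\<dots> = 1" using m by (simp add: t_def)
    finally show ?thesis .
  qed
  moreover have "n0 \<le> s" "s \<le> t" using m(1) by (auto simp: s_def t_def)
  moreover have "\<forall>x. x \<notin> {s..t} \<longrightarrow> f x = 0" by (simp add: f_def I_def)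
  ultimately show ?thesis by blast
qed

text \<open>The cross product of the rows solves both equations. If it vanishes, the rows are
  parallel, and a vector supported on the first two coordinates does the job.\<close>

lemma two_equations_three_unknowns:
  fixes u v :: "nat \<Rightarrow> complex"
  shows "\<exists>c. (\<exists>i<3. c i \<noteq> 0) \<and> (\<Sum>i<3. c i * u i) = 0 \<and> (\<Sum>i<3. c i * v i) = 0"
proof -
  have s3: "(\<Sum>i<3. h i) = h 0 + h 1 + h 2" for h :: "nat \<Rightarrow> complex"
    by (simp add: eval_nat_numeral)
  define k where "k a b d i = (if i = (0::nat) then a else if i = 1 then b else d :: complex)" for a b d i
  have ks: "(\<Sum>i<3. k a b d i * h i) = a * h 0 + b * h 1 + d * h 2" for a b d h
    unfolding s3 by (simp add: k_def)
  have kn: "\<exists>i<3. k a b d i \<noteq> 0" if "a \<noteq> 0 \<or> b \<noteq> 0 \<or> d \<noteq> 0" for a b d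
  proof -
    have "k a b d 0 = a" "k a b d 1 = b" "k a b d 2 = d" by (simp_all add: k_def)
    then have "k a b d 0 \<noteq> 0 \<or> k a b d 1 \<noteq> 0 \<or> k a b d 2 \<noteq> 0" using that by metis
    moreover have "(0::nat) < 3" "(1::nat) < 3" "(2::nat) < 3" by simp_all
    ultimately show ?thesis by metis
  qed
  have ex: "\<exists>c. (\<exists>i<3. c i \<noteq> 0) \<and> (\<Sum>i<3. c i * u i) = 0 \<and> (\<Sum>i<3. c i * v i) = 0"
    if "a \<noteq> 0 \<or> b \<noteq> 0 \<or> d \<noteq> 0" "a * u 0 + b * u 1 + d * u 2 = 0" "a * v 0 + b * v 1 + d * v 2 = 0" for a b d
    using kn[OF that(1)] that(2,3) ks by (intro exI[of _ "k a b d"]) simp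
  define x y z where "x = u 1 * v 2 - u 2 * v 1" and "y = u 2 * v 0 - u 0 * v 2" and "z = u 0 * v 1 - u 1 * v 0"
  show ?thesis
  proof (cases "x = 0 \<and> y = 0 \<and> z = 0")
    case False
    then show ?thesis by (intro ex[of x y z]) (auto simp: x_def y_def z_def algebra_simps)
  next
    case True
    then have xyz: "u 1 * v 2 = u 2 * v 1" "u 2 * v 0 = u 0 * v 2" "u 0 * v 1 = u 1 * v 0"
      by (auto simp: x_def y_def z_def)
    consider "u 0 \<noteq> 0 \<or> u 1 \<noteq> 0" | "v 0 \<noteq> 0 \<or> v 1 \<noteq> 0" | "u 0 = 0" "v 0 = 0" by blast
    then show ?thesis
    proof cases
      case 1
      then show ?thesis using xyz by (intro ex[of "u 1" "- u 0" 0]) (auto simp: algebra_simps)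
    next
      case 2
      then show ?thesis using xyz by (intro ex[of "v 1" "- v 0" 0]) (auto simp: algebra_simps)
    next
      case 3
      then show ?thesis by (intro ex[of 1 0 0]) auto
    qed
  qed
qed

text \<open>Gliding hump: three interlaced families of humps yield three limit points of the range.
  If all were attained, the differences to the formal preimages would be three
  solutions of a second-order recursion, hence dependent near \<open>+\<infinity>\<close>; but no nontrivial
  combination of the hump series is square summable.\<close>

lemma tridiag_range_not_closed:
  assumes bd: "\<And>x. cmod (A x) \<le> K" "\<And>x. cmod (B x) \<le> K" "\<And>x. cmod (D x) \<le> K"
    and lim: "(A \<longlongrightarrow> \<alpha>) at_top" "(B \<longlongrightarrow> \<beta>) at_top" "(D \<longlongrightarrow> \<delta>) at_top"
    and \<zeta>: "cmod \<zeta> = 1" "\<alpha> + \<beta> * \<zeta> + \<delta> * \<zeta>^2 = 0" and \<delta>: "\<delta> \<noteq> 0"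
  shows "\<not> tridiag_range_closed A B D"
proof
  assume closed: "tridiag_range_closed A B D"
  let ?T = "tridiag A B D"
  define good where "good n w \<longleftrightarrow> (case w of (f, s, t) \<Rightarrow> s \<le> t \<and> (\<forall>x. x \<notin> {s..t} \<longrightarrow> f x = 0) \<and>
    (\<Sum>x=s..t. (cmod (f x))^2) = 1 \<and> l2_bound (?T f) ((1/2)^n))"
    for n :: nat and w :: "(int \<Rightarrow> complex) \<times> int \<times> int"
  have hump: "\<exists>f s t. n0 \<le> s \<and> good n (f, s, t)" for n0 n
    using tridiag_hump_exists[OF bd lim \<zeta>, of "(1/2)^n" n0] by (auto simp: good_def)
  have "\<exists>W. \<forall>n. good n (W n) \<and> snd (snd (W n)) < fst (snd (W (Suc n)))"
  proof (rule dependent_nat_choice)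
    show "\<exists>w. good 0 w" using hump by blast
    show "\<exists>y. good (Suc n) y \<and> snd (snd w) < fst (snd y)" if "good n w" for w n
      using hump[of "snd (snd w) + 1" "Suc n"] by (metis fst_conv snd_conv zless_add1_eq add1_zle_eq)
  qed
  then obtain W where W: "\<And>n. good n (W n)" "\<And>n. snd (snd (W n)) < fst (snd (W (Suc n)))" by blast
  define f s t where "f n = fst (W n)" and "s n = fst (snd (W n))" and "t n = snd (snd (W n))" for n
  have st: "s n \<le> t n" and f0: "x \<notin> {s n..t n} \<Longrightarrow> f n x = 0" and f1: "(\<Sum>x=s n..t n. (cmod (f n x))^2) = 1"
    and fT: "l2_bound (?T (f n)) ((1/2)^n)" and ts: "t n < s (Suc n)" for n x
    using W[of n] by (auto simp: good_def f_def s_def t_def split: prod.splits)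
  have ts': "t n < s m" if "n < m" for n m
    using that
  proof (induction m)
    case (Suc m)
    then show ?case using ts[of m] st[of m] by (cases "n = m") auto
  qed simp
  have sn: "s 0 + int n \<le> s n" for n
  proof (induction n)
    case (Suc n)
    then show ?case using ts[of n] st[of n] by auto
  qed simp
  define fi where "fi j n = (\<lambda>x. if n mod 3 = j then f n x else 0)" for j n :: nat
  define F where "F j = (\<lambda>x. \<Sum>n. fi j n x)" for j
  have F: "(\<lambda>n. fi j n x) sums F j x" for j x
  proof -
    have "fi j n x = 0" if "n \<notin> {..nat (x - s 0)}" for n
    proof -
      have "x < s n" using sn[of n] that by simp
      then show ?thesis using f0[of x n] by (simp add: fi_def)
    qed
    then have "summable (\<lambda>n. fi j n x)"
      using sums_finite[of "{..nat (x - s 0)}" "\<lambda>n. fi j n x"] sums_summable by blast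
    then show ?thesis unfolding F_def by (rule summable_sums)
  qed
  have Fx: "F j x = (if n mod 3 = j then f n x else 0)" if "x \<in> {s n..t n}" for j n x
  proof -
    have "fi j m x = 0" if "m \<noteq> n" for m
      using ts'[of m n] ts'[of n m] \<open>x \<in> {s n..t n}\<close> that f0[of x m] by (auto simp: fi_def nat_neq_iff)
    then have "(\<lambda>m. fi j m x) = (\<lambda>m. if m = n then fi j n x else 0)" by auto
    then have "(\<lambda>m. fi j m x) sums fi j n x" using sums_single[of n "\<lambda>_. fi j n x"] by (simp add: eq_commute)
    then have "F j x = fi j n x" using F sums_unique2 by blast
    then show ?thesis by (simp add: fi_def)
  qed
  have fiT: "l2_bound (?T (fi j n)) ((1/2)^n)" for j n
  proof (cases "n mod 3 = j")
    case True
    then show ?thesis using fT[of n] by (simp add: fi_def)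
  next
    case False
    then have "?T (fi j n) = (\<lambda>x. 0)" by (auto simp: fi_def tridiag_def)
    then show ?thesis using l2_bound_mono[OF l2_bound_zero, of "(1/2)^n"] by simp
  qed
  have TF: "(\<lambda>n. ?T (fi j n) x) sums ?T (F j) x" for j x
    unfolding tridiag_def by (intro sums_add sums_mult F)
  \<comment> \<open>The partial sums of the humps are square summable and their images converge
    geometrically to \<open>?T (F j)\<close>, so a closed range must contain this limit.\<close>
  have "\<exists>h c. l2_bound h c \<and> ?T h = ?T (F j)" for j
  proof -
    define u where "u k = (\<lambda>x. \<Sum>n<k. fi j n x)" for k
    have fil2: "\<exists>c. l2_bound (fi j n) c" for n
    proof -
      have "l2_bound (fi j n) (L2_set (\<lambda>x. cmod (fi j n x)) {s n..t n})"
        by (rule l2_bound_finite_support) (simp_all add: fi_def f0 del: atLeastAtMost_iff)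
      then show ?thesis by blast
    qed
    have u: "\<exists>c. l2_bound (u k) c" for k
      unfolding u_def
    proof (induction k)
      case 0
      then show ?case using l2_bound_zero by auto
    next
      case (Suc k)
      then show ?case using fil2[of k] l2_bound_add by fastforce
    qed
    have Tu: "?T (u k) x = (\<Sum>n<k. ?T (fi j n) x)" for k x
      by (simp add: u_def tridiag_def sum.distrib sum_distrib_left)
    have "l2_bound (\<lambda>x. ?T (F j) x - ?T (u k) x) (2 * (1/2)^k)" for k
    proof -
      have s: "(\<lambda>n. (1/2::real)^(n + k)) sums (2 * (1/2)^k)"
        using sums_mult2[OF geometric_sums[of "1/2::real"], of "(1/2)^k"] by (simp add: power_add)
      have "(\<lambda>n. ?T (fi j (n + k)) x) sums (?T (F j) x - ?T (u k) x)" for x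
        unfolding Tu by (rule sums_split_initial_segment[OF TF])
      then have "l2_bound (\<lambda>x. ?T (F j) x - ?T (u k) x) (\<Sum>n. (1/2)^(n + k))"
        by (intro l2_bound_sums[of "\<lambda>n. ?T (fi j (n + k))"] fiT sums_summable[OF s])
      then show ?thesis using sums_unique[OF s] by simp
    qed
    then have "l2_bound (\<lambda>x. ?T (u k) x - ?T (F j) x) (1 * (2 * (1/2)^k))" for k
      by (rule l2_bound_dominated) (auto simp: norm_minus_commute)
    then have a: "\<forall>k. l2_bound (\<lambda>x. ?T (u k) x - ?T (F j) x) (2 * (1/2)^k)" by simp
    moreover have "(\<lambda>k. 2 * (1/2::real)^k) \<longlonglongrightarrow> 0"
      by (intro tendsto_mult_right_zero LIMSEQ_power_zero) simp
    ultimately show ?thesis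
      using u by (intro tridiag_range_closedD[OF closed, of u "?T (F j)" "\<lambda>k. 2 * (1/2)^k"]) auto
  qed
  then obtain h c where h: "\<And>j. l2_bound (h j) (c j)" "\<And>j. ?T (h j) = ?T (F j)" by metis
  have "\<forall>\<^sub>F x in at_top. D x \<noteq> 0" using tendsto_imp_eventually_ne[OF lim(3) \<delta>] .
  then obtain N where N: "\<And>x. N \<le> x \<Longrightarrow> D x \<noteq> 0" by (auto simp: eventually_at_top_linorder)
  define w where "w j = (\<lambda>x. F j x - h j x)" for j
  \<comment> \<open>Two neighbouring zeros propagate to the right, as the upper coefficient
    \<open>D\<close> does not vanish from \<open>N\<close> on; three solutions always admit a
    combination with such zeros.\<close>
  obtain k where k: "\<exists>i<3. k i \<noteq> 0" "(\<Sum>i<3. k i * w i (N - 1)) = 0" "(\<Sum>i<3. k i * w i N) = 0"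
    using two_equations_three_unknowns[of "\<lambda>i. w i (N - 1)" "\<lambda>i. w i N"] by blast
  define z where "z x = (\<Sum>i<3. k i * w i x)" for x
  have Tw: "?T (w j) x = 0" for j x
    using fun_cong[OF h(2)[of j], of x] by (simp add: w_def tridiag_def algebra_simps)
  have Tz: "?T z x = 0" for x
  proof -
    have "?T z x = (\<Sum>i<3. k i * ?T (w i) x)"
      by (simp add: z_def tridiag_def sum.distrib sum_distrib_left algebra_simps)
    then show ?thesis by (simp add: Tw)
  qed
  have z0: "z (N - 1 + int n) = 0 \<and> z (N + int n) = 0" for n
  proof (induction n)
    case 0
    then show ?case using k by (simp add: z_def)
  next
    case (Suc n)
    have "D (N + int n) * z (N + int n + 1) = 0"
      using Tz[of "N + int n"] Suc by (simp add: tridiag_def algebra_simps)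
    then show ?case using N[of "N + int n"] Suc by (simp add: algebra_simps)
  qed
  have z0': "z x = 0" if "N \<le> x" for x
    using z0[of "nat (x - N)"] that by simp
  define H where "H x = (\<Sum>i<3. k i * h i x)" for x
  have "\<exists>C. l2_bound (\<lambda>x. \<Sum>i<m. k i * h i x) C" for m
  proof (induction m)
    case 0
    then show ?case using l2_bound_zero by auto
  next
    case (Suc m)
    have "l2_bound (\<lambda>x. k m * h m x) (cmod (k m) * c m)" by (intro l2_bound_mult h) simp
    then show ?case using Suc l2_bound_add by fastforce
  qed
  then obtain C where C: "l2_bound H C" unfolding H_def by blast
  obtain i where i: "i < 3" "k i \<noteq> 0" using k by blast
  have Hx: "H x = k i * f n x" if "x \<in> {s n..t n}" "n mod 3 = i" "N \<le> x" for n x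
  proof -
    have "H x = (\<Sum>j<3. k j * F j x)"
      using z0'[OF that(3)] unfolding z_def H_def w_def by (simp add: algebra_simps sum_subtractf)
    also have "\<dots> = (\<Sum>j<3. if j = i then k i * f n x else 0)"
      by (rule sum.cong) (use Fx[OF that(1)] that(2) in auto)
    also have "\<dots> = k i * f n x" using i by simp
    finally show ?thesis .
  qed
  \<comment> \<open>Selects the humps of family \<open>i\<close> that lie to the right of
    \<open>N\<close>. There \<open>H\<close> equals \<open>k i\<close> times a normalized hump, so
    infinitely many disjoint intervals carry the same mass.\<close>
  define n0 where "n0 = nat (N - s 0)"
  define idx where "idx l = 3 * (n0 + l) + i" for l
  define J where "J l = {s (idx l)..t (idx l)}" for l
  have Jsum: "(\<Sum>x\<in>J l. (cmod (H x))^2) = (cmod (k i))^2" for l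
  proof -
    have "N \<le> x" if "x \<in> J l" for x
    proof -
      have "N - s 0 \<le> int (idx l)" by (simp add: n0_def idx_def)
      then show ?thesis using that sn[of "idx l"] by (simp add: J_def)
    qed
    moreover have "idx l mod 3 = i" unfolding idx_def using i(1) by presburger
    ultimately have "(\<Sum>x\<in>J l. (cmod (H x))^2) = (\<Sum>x\<in>J l. (cmod (k i))^2 * (cmod (f (idx l) x))^2)"
      by (intro sum.cong) (auto simp: Hx J_def norm_mult power_mult_distrib)
    also have "\<dots> = (cmod (k i))^2"
      using f1[of "idx l"] by (simp add: J_def flip: sum_distrib_left)
    finally show ?thesis .
  qed
  have bound: "real m * (cmod (k i))^2 \<le> C^2" for m
  proof -
    have "J l \<inter> J l' = {}" if "l \<noteq> l'" for l l'
      using ts'[of "idx l" "idx l'"] ts'[of "idx l'" "idx l"] that by (force simp: J_def idx_def nat_neq_iff)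
    then have "(\<Sum>x\<in>(\<Union>l<m. J l). (cmod (H x))^2) = (\<Sum>l<m. \<Sum>x\<in>J l. (cmod (H x))^2)"
      by (intro sum.UNION_disjoint) (auto simp: J_def)
    then have "real m * (cmod (k i))^2 = (\<Sum>x\<in>(\<Union>l<m. J l). (cmod (H x))^2)"
      by (simp add: Jsum)
    also have "\<dots> \<le> infsum (\<lambda>x. (cmod (H x))^2) UNIV"
      by (rule finite_sum_le_infsum[OF l2_bound_imp_summable(1)[OF C]]) (auto simp: J_def)
    also have "\<dots> \<le> C^2" by (rule l2_bound_imp_summable(2)[OF C])
    finally show ?thesis .
  qed
  obtain m :: nat where "C^2 / (cmod (k i))^2 < real m" using reals_Archimedean2 by blast
  then have "C^2 < real m * (cmod (k i))^2" using i by (simp add: field_simps)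
  then show False using bound[of m] by simp
qed

text \<open>Makes the gliding hump argument at the right end applicable to the left end: reversing
  the line exchanges the outer diagonals.\<close>

lemma tridiag_range_closed_reflect:
  assumes "tridiag_range_closed A B D"
  shows "tridiag_range_closed (\<lambda>x. D (- x)) (\<lambda>x. B (- x)) (\<lambda>x. A (- x))"
  unfolding tridiag_range_closed_def
proof (intro allI impI, elim conjE)
  let ?T' = "tridiag (\<lambda>x. D (- x)) (\<lambda>x. B (- x)) (\<lambda>x. A (- x))"
  have inj: "inj (\<lambda>x::int. - x)" by (simp add: inj_def)
  have T: "?T' f x = tridiag A B D (\<lambda>y. f (- y)) (- x)" for f x
    by (simp add: tridiag_def algebra_simps)
  fix u :: "nat \<Rightarrow> int \<Rightarrow> complex" and g and \<epsilon> :: "nat \<Rightarrow> real"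
  assume u: "\<forall>n. \<exists>c. l2_bound (u n) c" and e: "\<forall>n. l2_bound (\<lambda>x. ?T' (u n) x - g x) (\<epsilon> n)" "\<epsilon> \<longlonglongrightarrow> 0"
  have "\<forall>n. \<exists>c. l2_bound (\<lambda>x. u n (- x)) c" using u l2_bound_reindex[OF _ inj] by blast
  moreover have "\<forall>n. l2_bound (\<lambda>x. tridiag A B D (\<lambda>y. u n (- y)) x - g (- x)) (\<epsilon> n)"
  proof
    fix n show "l2_bound (\<lambda>x. tridiag A B D (\<lambda>y. u n (- y)) x - g (- x)) (\<epsilon> n)"
      using l2_bound_reindex[OF _ inj, of "\<lambda>x. ?T' (u n) x - g x" "\<epsilon> n"] e by (simp add: T)
  qed
  ultimately obtain h c where h: "l2_bound h c" "tridiag A B D h = (\<lambda>x. g (- x))"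
    using tridiag_range_closedD[OF assms, of "\<lambda>n x. u n (- x)" "\<lambda>x. g (- x)" \<epsilon>] e(2) by auto
  have "l2_bound (\<lambda>x. h (- x)) c" by (rule l2_bound_reindex[OF h(1) inj])
  moreover have "?T' (\<lambda>x. h (- x)) = g" using h(2) by (simp add: T fun_eq_iff)
  ultimately show "\<exists>h c. l2_bound h c \<and> ?T' h = g" by blast
qed

section \<open>The Fredholm criterion\<close>

lemma filterlim_int_shift:
  "filterlim (\<lambda>x::int. x + k) at_top at_top" "filterlim (\<lambda>x::int. x + k) at_bot at_bot"
  "filterlim (\<lambda>x::int. - x) at_bot at_top"
proof -
  show "filterlim (\<lambda>x::int. x + k) at_top at_top"
    unfolding filterlim_at_top eventually_at_top_linorder by (metis diff_le_eq)
  show "filterlim (\<lambda>x::int. x + k) at_bot at_bot"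
    unfolding filterlim_at_bot eventually_at_bot_linorder by (metis le_diff_eq)
  show "filterlim (\<lambda>x::int. - x) at_bot at_top"
    unfolding filterlim_at_bot eventually_at_top_linorder by (metis minus_le_iff)
qed

section \<open>Limit coins, contractive modifications and the symbol\<close>

context walk
begin

lemma p_complex_ne: "1 - complex_of_real p \<noteq> 0" "1 + complex_of_real p \<noteq> 0"
  using p_bounds by (auto simp: complex_eq_iff)

text \<open>The last claim is an exact identity near the end, not only one in the limit. Either
  \<open>b\<close> is eventually nonzero and the coin condition forces it, or
  \<open>a1 x * a2 x\<close> is close to -1 while the squares of \<open>a1 x\<close> and
  \<open>a2 x\<close> always agree.\<close>

lemma limit_coin:
  assumes lim: "(a1 \<longlongrightarrow> \<alpha>) F" "(a2 \<longlongrightarrow> \<alpha>2) F" "(b \<longlongrightarrow> \<beta>) F" "F \<noteq> bot"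
    and nt: "\<not> trivial_coin \<alpha> \<alpha>2 \<beta>"
  shows "\<alpha>^2 + (cmod \<beta>)^2 = 1" "\<alpha>2 = - \<alpha>" "\<forall>\<^sub>F x in F. a2 x = - a1 x"
proof -
  have "((\<lambda>x. (a1 x)^2 + (cmod (b x))^2) \<longlongrightarrow> \<alpha>^2 + (cmod \<beta>)^2) F"
    "((\<lambda>x. (a2 x)^2 + (cmod (b x))^2) \<longlongrightarrow> \<alpha>2^2 + (cmod \<beta>)^2) F"
    "((\<lambda>x. b x * complex_of_real (a1 x + a2 x)) \<longlongrightarrow> \<beta> * complex_of_real (\<alpha> + \<alpha>2)) F"
    by (intro tendsto_intros lim)+
  then have l: "\<alpha>^2 + (cmod \<beta>)^2 = 1" "\<alpha>2^2 + (cmod \<beta>)^2 = 1" "\<beta> * complex_of_real (\<alpha> + \<alpha>2) = 0"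
    unfolding coin1 coin2 coin3 using lim(4) by (auto simp: tendsto_const_iff)
  show "\<alpha>^2 + (cmod \<beta>)^2 = 1" by (rule l)
  have "\<alpha>2 = - \<alpha> \<and> (\<forall>\<^sub>F x in F. a2 x = - a1 x)"
  proof (cases "\<beta> = 0")
    case False
    then have "complex_of_real (\<alpha> + \<alpha>2) = 0" using l(3) by simp
    then have "\<alpha>2 = - \<alpha>" unfolding of_real_eq_0_iff by linarith
    moreover have "\<forall>\<^sub>F x in F. b x \<noteq> 0" using tendsto_imp_eventually_ne[OF lim(3) False] .
    then have "\<forall>\<^sub>F x in F. a2 x = - a1 x"
    proof (rule eventually_mono)
      fix x assume "b x \<noteq> 0"
      then have "complex_of_real (a1 x + a2 x) = 0" using coin3[of x] by simp
      then show "a2 x = - a1 x" unfolding of_real_eq_0_iff by linarith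
    qed
    ultimately show ?thesis by blast
  next
    case True
    then have "\<alpha>^2 = 1" "\<alpha>2^2 = 1" using l by auto
    then have *: "\<alpha>2 = - \<alpha>" using nt True by (auto simp: trivial_coin_def power2_eq_1_iff)
    have "((\<lambda>x. a1 x * a2 x) \<longlongrightarrow> \<alpha> * \<alpha>2) F" by (intro tendsto_intros lim)
    moreover have "\<alpha> * \<alpha>2 < 0" using * \<open>\<alpha>^2 = 1\<close> by (simp add: power2_eq_square)
    ultimately have "\<forall>\<^sub>F x in F. a1 x * a2 x < 0" by (rule order_tendstoD(2))
    then have "\<forall>\<^sub>F x in F. a2 x = - a1 x"
    proof (rule eventually_mono)
      fix x assume neg: "a1 x * a2 x < 0"
      have "(a2 x)^2 = (a1 x)^2" using coin1[of x] coin2[of x] by linarith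
      then have "a2 x = a1 x \<or> a2 x = - a1 x" by (simp add: power2_eq_iff)
      moreover have "a2 x \<noteq> a1 x" using neg by (auto simp: mult_less_0_iff)
      ultimately show "a2 x = - a1 x" by blast
    qed
    then show ?thesis using * by blast
  qed
  then show "\<alpha>2 = - \<alpha>" "\<forall>\<^sub>F x in F. a2 x = - a1 x" by auto
qed

text \<open>Off \<open>X\<close> the coin is replaced by its limit, so the new coin is nearly
  constant on the whole line and \<open>M\<close> is a contraction. The set \<open>X\<close> is
  quantified after \<eta>, because the half-line on which the coin is \<eta>-close to its limit can
  only be chosen once \<eta> is known.\<close>

lemma contractive_modification:
  assumes \<alpha>\<beta>: "\<alpha>^2 + (cmod \<beta>)^2 = 1" and ne: "\<bar>p\<bar> \<noteq> \<bar>\<alpha>\<bar>"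
  obtains \<eta> \<rho> where "0 < \<eta>"
    "\<And>X. (\<And>x. x \<in> X \<Longrightarrow> \<bar>a1 x - \<alpha>\<bar> \<le> \<eta> \<and> cmod (b x - \<beta>) \<le> \<eta> \<and> a2 x = - a1 x) \<Longrightarrow>
      contractive_walk p q (\<lambda>x. if x \<in> X then a1 x else \<alpha>) (\<lambda>x. if x \<in> X then a2 x else - \<alpha>)
        (\<lambda>x. if x \<in> X then b x else \<beta>) \<rho>"
proof -
  define \<rho>0 where "\<rho>0 = \<bar>p\<bar> * \<bar>\<alpha>\<bar> + cmod q * cmod \<beta>"
  have "0 < (\<bar>p\<bar> - \<bar>\<alpha>\<bar>)^2" "0 \<le> (cmod q - cmod \<beta>)^2" using ne by auto
  then have "2 * \<rho>0 < (p^2 + (cmod q)^2) + (\<alpha>^2 + (cmod \<beta>)^2)"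
    unfolding \<rho>0_def power2_diff power2_abs by simp
  then have \<rho>0: "\<rho>0 < 1" using pq \<alpha>\<beta> by simp
  have \<rho>0_nn: "0 \<le> \<rho>0" by (simp add: \<rho>0_def)
  \<comment> \<open>The perturbation costs at most 4\<eta>: one \<eta> each from the p- and the
    q-term and two from the mixing entries.\<close>
  define \<eta> where "\<eta> = (1 - \<rho>0) / 5"
  have \<eta>: "0 < \<eta>" using \<rho>0 by (simp add: \<eta>_def)
  define \<rho> where "\<rho> = \<bar>p\<bar> * (\<bar>\<alpha>\<bar> + \<eta>) + cmod q * (cmod \<beta> + \<eta>) + 2 * \<eta>"
  have "\<bar>p\<bar> * \<eta> \<le> 1 * \<eta>" "cmod q * \<eta> \<le> 1 * \<eta>"
    using \<eta> p_bounds(1) entry_bounds(4) by (intro mult_right_mono; simp)+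
  then have "\<rho> \<le> \<rho>0 + 4 * \<eta>" by (simp add: \<rho>_def \<rho>0_def algebra_simps)
  also have "\<dots> < 1" unfolding \<eta>_def using \<rho>0 by (simp add: field_simps)
  finally have \<rho>1: "\<rho> < 1" .
  have \<rho>nn: "0 \<le> \<rho>" using \<eta> by (simp add: \<rho>_def)
  show thesis
  proof (rule that[OF \<eta>, of \<rho>])
    fix X assume X: "\<And>x. x \<in> X \<Longrightarrow> \<bar>a1 x - \<alpha>\<bar> \<le> \<eta> \<and> cmod (b x - \<beta>) \<le> \<eta> \<and> a2 x = - a1 x"
    define r1 r2 rb where "r1 = (\<lambda>x. if x \<in> X then a1 x else \<alpha>)"
      and "r2 = (\<lambda>x. if x \<in> X then a2 x else - \<alpha>)" and "rb = (\<lambda>x. if x \<in> X then b x else \<beta>)"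
    interpret W: walk p q r1 r2 rb
    proof
      fix x
      show "(r1 x)^2 + (cmod (rb x))^2 = 1" "(r2 x)^2 + (cmod (rb x))^2 = 1"
        "rb x * complex_of_real (r1 x + r2 x) = 0"
        using coin1[of x] coin2[of x] coin3[of x] \<alpha>\<beta> by (simp_all add: r1_def r2_def rb_def)
    qed (use pq q0 in auto)
    have r: "\<bar>r1 x - \<alpha>\<bar> \<le> \<eta>" "cmod (rb x - \<beta>) \<le> \<eta>" "r2 x = - r1 x" for x
      using X[of x] \<eta> by (auto simp: r1_def r2_def rb_def)
    have 1: "\<bar>r1 x\<bar> \<le> \<bar>\<alpha>\<bar> + \<eta>" "\<bar>r2 x\<bar> \<le> \<bar>\<alpha>\<bar> + \<eta>" for x using r(1,3)[of x] by auto
    have 2: "cmod (rb x) \<le> cmod \<beta> + \<eta>" for x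
      using norm_triangle_ineq[of "rb x - \<beta>" \<beta>] r(2)[of x] by simp
    have 3: "\<bar>r1 x + r2 (x + 1)\<bar> \<le> 2 * \<eta>" for x using r(1)[of x] r(1)[of "x + 1"] r(3)[of "x + 1"] by linarith
    have "contractive_walk p q r1 r2 rb \<rho>"
    proof
      show "state_bound (W.M \<psi>) (\<rho> * c)" if "state_bound \<psi> c" for \<psi> c
        using W.state_bound_anticomm[OF that 1 2 3] by (simp add: \<rho>_def)
    qed (use \<rho>1 \<rho>nn in auto)
    then show "contractive_walk p q (\<lambda>x. if x \<in> X then a1 x else \<alpha>) (\<lambda>x. if x \<in> X then a2 x else - \<alpha>)
        (\<lambda>x. if x \<in> X then b x else \<beta>) \<rho>" by (simp add: r1_def r2_def rb_def)
  qed
qed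

text \<open>The two rows of the eigenvalue equation are equivalent because
  \<open>|q|\<^sup>2 = (1 - p) (1 + p)\<close>. Hence \<open>snd\<close> is a free coordinate on the
  eigenspace.\<close>

lemma Gam_eigen_plus_iff: "\<Gamma> \<psi> = \<psi> \<longleftrightarrow> (\<forall>x. fst \<psi> x = q / (1 - p) * snd \<psi> (x + 1))"
proof -
  let ?p = "complex_of_real p"
  note nz = p_complex_ne
  have qq: "cnj q * q = (1 - ?p) * (1 + ?p)"
    using pq_complex by (simp add: algebra_simps)
  show "\<Gamma> \<psi> = \<psi> \<longleftrightarrow> (\<forall>x. fst \<psi> x = q / (1 - p) * snd \<psi> (x + 1))"
  proof
    assume E: "\<Gamma> \<psi> = \<psi>"
    show "\<forall>x. fst \<psi> x = q / (1 - p) * snd \<psi> (x + 1)"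
    proof
      fix x
      have "?p * fst \<psi> x + q * snd \<psi> (x + 1) = fst \<psi> x"
        using arg_cong[OF E, of "\<lambda>\<psi>. fst \<psi> x"] by (simp add: Gam_def Lshift_def)
      then have "(1 - ?p) * fst \<psi> x = q * snd \<psi> (x + 1)" by (simp add: algebra_simps)
      then show "fst \<psi> x = q / (1 - p) * snd \<psi> (x + 1)" using nz by (simp add: field_simps)
    qed
  next
    assume R: "\<forall>x. fst \<psi> x = q / (1 - p) * snd \<psi> (x + 1)"
    show "\<Gamma> \<psi> = \<psi>"
    proof (rule state_eqI)
      fix x
      have "(1 - ?p) * fst \<psi> x = q * snd \<psi> (x + 1)" using R nz by simp
      then show "fst (\<Gamma> \<psi>) x = fst \<psi> x" by (simp add: Gam_def Lshift_def algebra_simps)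
      have "(1 - ?p) * (cnj q * fst \<psi> (x - 1)) = cnj q * q * snd \<psi> x"
        using R nz by simp
      then have "cnj q * fst \<psi> (x - 1) = (1 + ?p) * snd \<psi> x"
        unfolding qq using nz by (simp add: mult.assoc)
      then show "snd (\<Gamma> \<psi>) x = snd \<psi> x" by (simp add: Gam_def Lshift_adj_def algebra_simps)
    qed
  qed
qed

lemma Gam_eigen_minus_iff: "\<Gamma> \<psi> = - \<psi> \<longleftrightarrow> (\<forall>x. fst \<psi> x = - q / (1 + p) * snd \<psi> (x + 1))"
proof -
  interpret neg: walk "- p" "- q" a1 a2 b
    by unfold_locales (use pq q0 coin1 coin2 coin3 in auto)
  have "\<Gamma> \<psi> = - \<psi> \<longleftrightarrow> Gam (- p) (- q) \<psi> = \<psi>" unfolding Gam_neg by (metis minus_minus)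
  then show ?thesis unfolding neg.Gam_eigen_plus_iff by simp
qed

definition "lowc x = cnj q * cnj (b (x - 1)) / (1 + p)"
definition "midc x = complex_of_real (a1 (x - 1) - a2 x)"
definition "uppc x = - q * b x / (1 - p)"

text \<open>In the coordinate \<open>snd \<psi>\<close> on the eigenspaces of \<open>\<Gamma>\<close>, the operator \<open>Q\<^sub>+\<close> is tridiagonal.\<close>

lemma snd_Q_plus:
  assumes "\<Gamma> \<psi> = \<psi>"
  shows "snd (Q \<psi>) x = (1 + p) / (2 * \<i>) * tridiag lowc midc uppc (snd \<psi>) x"
proof -
  let ?p = "complex_of_real p"
  note nz = p_complex_ne
  have qq: "cnj q * (q * z) = (1 - ?p) * (1 + ?p) * z" for z
  proof -
    have "cnj q * q = (1 - ?p) * (1 + ?p)"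
      using pq_complex by (simp add: algebra_simps)
    then show ?thesis by (simp flip: mult.assoc)
  qed
  have f: "fst \<psi> x = q / (1 - p) * snd \<psi> (x + 1)" for x
    using assms Gam_eigen_plus_iff by blast
  have "2 * \<i> * snd (Q \<psi>) x = snd (\<Gamma> (C \<psi>)) x - snd (C \<psi>) x"
    unfolding Qop_def assms by simp
  also have "\<dots> = cnj q * fst (C \<psi>) (x - 1) - (1 + ?p) * snd (C \<psi>) x"
    by (simp add: Gam_def Lshift_adj_def algebra_simps)
  also have "cnj q * fst (C \<psi>) (x - 1) =
      (1 + ?p) * a1 (x - 1) * snd \<psi> x + cnj q * cnj (b (x - 1)) * snd \<psi> (x - 1)"
  proof -
    have "cnj q * fst (C \<psi>) (x - 1) = a1 (x - 1) * (cnj q * (q * snd \<psi> x)) / (1 - p)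
       + cnj q * cnj (b (x - 1)) * snd \<psi> (x - 1)"
      by (simp add: Coin_def f algebra_simps)
    then show ?thesis unfolding qq using nz by simp
  qed
  also have "snd (C \<psi>) x = q * b x / (1 - p) * snd \<psi> (x + 1) + a2 x * snd \<psi> x"
    by (simp add: Coin_def f)
  also have "(1 + ?p) * a1 (x - 1) * snd \<psi> x + cnj q * cnj (b (x - 1)) * snd \<psi> (x - 1) -
      (1 + ?p) * (q * b x / (1 - p) * snd \<psi> (x + 1) + a2 x * snd \<psi> x)
      = (1 + p) * tridiag lowc midc uppc (snd \<psi>) x"
  proof -
    have low: "(1 + ?p) * lowc x = cnj q * cnj (b (x - 1))"
      using nz by (simp add: lowc_def)
    have "(1 + p) * tridiag lowc midc uppc (snd \<psi>) x = ((1 + ?p) * lowc x) * snd \<psi> (x - 1)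
        + (1 + ?p) * midc x * snd \<psi> x + (1 + ?p) * uppc x * snd \<psi> (x + 1)"
      by (simp add: tridiag_def algebra_simps)
    then show ?thesis unfolding low by (simp add: midc_def uppc_def algebra_simps)
  qed
  finally have "2 * \<i> * snd (Q \<psi>) x = (1 + p) * tridiag lowc midc uppc (snd \<psi>) x" .
  then show ?thesis by (simp add: field_simps)
qed

text \<open>The coordinate \<open>snd\<close> identifies both eigenspaces of \<Gamma> with the
  scalar sequence space, up to equivalent norms, so that closedness of the range passes to the
  tridiagonal operator.\<close>

lemma closed_range_imp_tridiag:
  assumes closed: "H_closed (Q ` Hplus p q)"
  shows "tridiag_range_closed lowc midc uppc"
  unfolding tridiag_range_closed_def
proof (intro allI impI, elim conjE)
  let ?T = "tridiag lowc midc uppc"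
  \<comment> \<open>\<open>ip\<close> and \<open>im\<close> invert the coordinate \<open>snd\<close>
    on the eigenspaces for +1 and -1.\<close>
  define ip where "ip f = (\<lambda>x. q / (1 - p) * f (x + 1), f)" for f :: "int \<Rightarrow> complex"
  define im where "im f = (\<lambda>x. - q / (1 + p) * f (x + 1), f)" for f :: "int \<Rightarrow> complex"
  define \<kappa> where "\<kappa> = (1 + p) / (2 * \<i>)"
  have \<kappa>: "\<kappa> \<noteq> 0" using p_bounds by (auto simp: \<kappa>_def complex_eq_iff)
  have inj: "inj (\<lambda>x::int. x + 1)" by (simp add: inj_def)
  have ip: "ip f \<in> Hplus p q" if "l2_bound f c" for f c
  proof -
    have "l2_bound (\<lambda>x. q / (1 - p) * f (x + 1)) (cmod (q / (1 - p)) * c)"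
      by (intro l2_bound_mult l2_bound_reindex[OF that inj]) simp
    then have "ip f \<in> Hspace" using that unfolding Hspace_def ip_def summable_sq_iff_l2_bound by auto
    then show ?thesis by (simp add: Hplus_def Gam_eigen_plus_iff ip_def)
  qed
  define k where "k = max 1 (cmod (q / (1 + p)))"
  have im: "state_bound (im f) (k * c)" if "l2_bound f c" for f c
  proof -
    have "l2_bound (\<lambda>x. - q / (1 + p) * f (x + 1)) (k * c)"
      by (intro l2_bound_mult l2_bound_reindex[OF that inj]) (simp add: k_def norm_divide)
    moreover have "l2_bound f (k * c)"
    proof -
      have "1 * c \<le> k * c" by (intro mult_right_mono l2_bound_nonneg[OF that]) (simp add: k_def)
      then show ?thesis using l2_bound_mono[OF that] by simp
    qed
    ultimately show ?thesis by (simp add: state_bound_def im_def)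
  qed
  have Qip: "Q (ip f) = im (\<lambda>x. \<kappa> * ?T f x)" for f
  proof -
    have g: "\<Gamma> (ip f) = ip f" by (simp add: Gam_eigen_plus_iff ip_def)
    then have s: "snd (Q (ip f)) = (\<lambda>x. \<kappa> * ?T f x)"
      using snd_Q_plus[OF g] by (auto simp: \<kappa>_def ip_def)
    have "\<Gamma> (Q (ip f)) = - Q (ip f)" using Gam_Q g by simp
    then have "fst (Q (ip f)) x = - q / (1 + p) * snd (Q (ip f)) (x + 1)" for x
      unfolding Gam_eigen_minus_iff by blast
    then show ?thesis using s by (intro state_eqI) (auto simp: im_def)
  qed
  fix u :: "nat \<Rightarrow> int \<Rightarrow> complex" and g and \<epsilon> :: "nat \<Rightarrow> real"
  assume u: "\<forall>n. \<exists>c. l2_bound (u n) c" and e: "\<forall>n. l2_bound (\<lambda>x. ?T (u n) x - g x) (\<epsilon> n)" "\<epsilon> \<longlonglongrightarrow> 0"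
  define \<phi> where "\<phi> = im (\<lambda>x. \<kappa> * g x)"
  have uQ: "Q (ip (u n)) \<in> Q ` Hplus p q" for n using u ip by blast
  have diff: "state_bound (Q (ip (u n)) - \<phi>) (k * (cmod \<kappa> * \<epsilon> n))" for n
  proof -
    have "Q (ip (u n)) - \<phi> = im (\<lambda>x. \<kappa> * (?T (u n) x - g x))"
      unfolding Qip \<phi>_def by (rule state_eqI) (simp_all add: im_def algebra_simps)
    moreover have "l2_bound (\<lambda>x. \<kappa> * (?T (u n) x - g x)) (cmod \<kappa> * \<epsilon> n)"
      using e(1) by (intro l2_bound_mult) auto
    ultimately show ?thesis using im by simp
  qed
  \<comment> \<open>Nothing is assumed about the summability of \<open>g\<close>; \<phi> inherits it
    as the difference of an image and a bounded error.\<close>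
  have "Q (ip (u 0)) \<in> Hspace" using uQ[of 0] Hspace_Q by (auto simp: Hplus_def)
  moreover have "Q (ip (u 0)) - \<phi> \<in> Hspace" using diff[of 0] Hspace_iff_state_bound by blast
  ultimately have "Q (ip (u 0)) - (Q (ip (u 0)) - \<phi>) \<in> Hspace" by (rule Hspace_diff)
  then have \<phi>H: "\<phi> \<in> Hspace" by simp
  have "(\<lambda>n. 2 * (k * (cmod \<kappa> * \<epsilon> n))) \<longlonglongrightarrow> 2 * (k * (cmod \<kappa> * 0))" by (intro tendsto_intros e(2))
  then have lim: "(\<lambda>n. 2 * (k * (cmod \<kappa> * \<epsilon> n))) \<longlonglongrightarrow> 0" by simp
  have "(\<lambda>n. hnorm (Q (ip (u n)) - \<phi>)) \<longlonglongrightarrow> 0"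
  proof (rule Lim_null_comparison[OF _ lim], rule always_eventually, rule allI)
    fix n
    have "0 \<le> hnorm (Q (ip (u n)) - \<phi>)" by (simp add: hnorm_def infsum_nonneg)
    then show "norm (hnorm (Q (ip (u n)) - \<phi>)) \<le> 2 * (k * (cmod \<kappa> * \<epsilon> n))"
      using hnorm_le[OF diff[of n]] by simp
  qed
  then have "\<phi> \<in> Q ` Hplus p q"
    using closed[unfolded H_closed_def, THEN spec[of _ "\<lambda>n. Q (ip (u n))"], THEN spec[of _ \<phi>]] uQ \<phi>H by simp
  then obtain \<psi> where \<psi>: "\<psi> \<in> Hplus p q" "\<phi> = Q \<psi>" by blast
  then obtain c where "l2_bound (snd \<psi>) c"
    unfolding Hplus_def Hspace_def summable_sq_iff_l2_bound by blast
  moreover have "?T (snd \<psi>) = g"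
  proof
    fix x
    have "\<kappa> * g x = snd (Q \<psi>) x" using \<psi>(2) by (simp add: \<phi>_def im_def flip: \<psi>(2))
    also have "\<dots> = \<kappa> * ?T (snd \<psi>) x" using snd_Q_plus[of \<psi>] \<psi>(1) by (simp add: \<kappa>_def Hplus_def)
    finally show "?T (snd \<psi>) x = g x" using \<kappa> by simp
  qed
  ultimately show "\<exists>h c. l2_bound h c \<and> ?T h = g" by blast
qed

text \<open>Multiplied by \<beta>q, the symbol becomes a quadratic in y = \<zeta>\<beta>q with roots
  (\<alpha> + 1)(1 - p) and (\<alpha> - 1)(1 - p). If |p| = |\<alpha>|, then also |\<beta>| = |q|,
  and the root with the sign \<epsilon> such that \<epsilon>\<alpha> = p has |\<zeta>| = (1 + p)(1 -
  p) / |q|^2 = 1.\<close>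

lemma symbol_zero:
  assumes "\<alpha>^2 + (cmod \<beta>)^2 = 1" "\<bar>p\<bar> = \<bar>\<alpha>\<bar>"
  obtains \<zeta> where "cmod \<zeta> = 1"
    "cnj q * cnj \<beta> / (1 + p) + complex_of_real (2 * \<alpha>) * \<zeta> + (- q * \<beta> / (1 - p)) * \<zeta>^2 = 0" "\<beta> \<noteq> 0"
proof -
  let ?p = "complex_of_real p"
  note nz = p_complex_ne
  have p2: "\<alpha>^2 = p^2" using assms(2) by (metis power2_abs)
  then have "(cmod \<beta>)^2 = (cmod q)^2" using assms(1) pq by linarith
  then have \<beta>q: "cmod \<beta> = cmod q" by (rule power2_eq_imp_eq) auto
  then have \<beta>0: "\<beta> \<noteq> 0" using q0 by auto
  define \<epsilon> :: real where "\<epsilon> = (if \<alpha> = p then 1 else -1)"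
  have \<epsilon>: "\<epsilon> * \<epsilon> = 1" "\<epsilon> * \<alpha> = p" "\<bar>\<epsilon>\<bar> = 1" using assms(2) by (auto simp: \<epsilon>_def abs_eq_iff)
  define \<zeta> where "\<zeta> = complex_of_real ((\<epsilon> + \<alpha>) * (1 - p)) / (\<beta> * q)"
  have "\<bar>\<epsilon> + \<alpha>\<bar> = \<bar>\<epsilon> * (\<epsilon> + \<alpha>)\<bar>" using \<epsilon>(3) by (simp add: abs_mult)
  also have "\<dots> = 1 + p" using \<epsilon> p_bounds by (simp add: distrib_left)
  finally have "cmod \<zeta> = (1 + p) * (1 - p) / (cmod q)^2"
    using p_bounds by (simp add: \<zeta>_def norm_divide norm_mult \<beta>q abs_mult power2_eq_square del: of_real_mult of_real_add of_real_diff)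
  also have "\<dots> = 1"
  proof -
    have "(cmod q)^2 = (1 + p) * (1 - p)" using pq by (simp add: algebra_simps power2_eq_square)
    then show ?thesis using p_bounds by simp
  qed
  finally have 1: "cmod \<zeta> = 1" .
  have qq: "cnj q * q = (1 - ?p) * (1 + ?p)"
    using pq_complex by (simp add: algebra_simps)
  have "\<beta> * cnj \<beta> = complex_of_real ((cmod \<beta>)^2)" by (rule complex_norm_square[symmetric])
  also have "\<dots> = complex_of_real (1 - \<alpha>^2)" using assms(1) by (metis add_diff_cancel_left')
  finally have bb: "cnj \<beta> * \<beta> = 1 - complex_of_real \<alpha> * complex_of_real \<alpha>" by (simp add: mult.commute power2_eq_square)
  have ee: "complex_of_real \<epsilon> * complex_of_real \<epsilon> = 1" using \<epsilon>(1) by (metis of_real_1 of_real_mult)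
  let ?S = "cnj q * cnj \<beta> / (1 + p) + complex_of_real (2 * \<alpha>) * \<zeta> + (- q * \<beta> / (1 - p)) * \<zeta>^2"
  let ?e = "complex_of_real \<epsilon>" and ?a = "complex_of_real \<alpha>"
  have z: "\<zeta> * (\<beta> * q) = (?e + ?a) * (1 - ?p)" using \<beta>0 q0 by (simp add: \<zeta>_def)
  have "?S * (\<beta> * q) = (cnj q * q) * (cnj \<beta> * \<beta>) / (1 + p) + 2 * ?a * (\<zeta> * (\<beta> * q))
      - (\<zeta> * (\<beta> * q)) * (\<zeta> * (\<beta> * q)) / (1 - p)"
    by (simp add: algebra_simps power2_eq_square)
  also have "(cnj q * q) * (cnj \<beta> * \<beta>) / (1 + p) = (1 - ?p) * (1 - ?a * ?a)"
    unfolding qq bb using nz by (simp add: field_simps)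
  also have "(\<zeta> * (\<beta> * q)) * (\<zeta> * (\<beta> * q)) / (1 - p) = (?e + ?a) * (?e + ?a) * (1 - ?p)"
    unfolding z using nz by (simp add: field_simps)
  also have "(1 - ?p) * (1 - ?a * ?a) + 2 * ?a * (\<zeta> * (\<beta> * q))
      - (?e + ?a) * (?e + ?a) * (1 - ?p) = (1 - ?p) * (1 - ?e * ?e)"
    unfolding z by (simp add: algebra_simps)
  finally have "?S * (\<beta> * q) = 0" by (simp add: ee)
  then have "?S = 0" using \<beta>0 q0 by simp
  then show thesis using that 1 \<beta>0 by blast
qed

lemma coefficient_bounds:
  "cmod (lowc x) \<le> 1 / (1 + p) + 2 + 1 / (1 - p)"
  "cmod (midc x) \<le> 1 / (1 + p) + 2 + 1 / (1 - p)"
  "cmod (uppc x) \<le> 1 / (1 + p) + 2 + 1 / (1 - p)"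
proof -
  have n: "cmod (1 + complex_of_real p) = 1 + p" "cmod (1 - complex_of_real p) = 1 - p"
    using p_bounds norm_of_real[of "1 + p", where 'a = complex] norm_of_real[of "1 - p", where 'a = complex]
    by simp_all
  have "cmod q * cmod (b y) \<le> 1 * 1" for y using entry_bounds by (intro mult_mono) auto
  then have "cmod (lowc x) \<le> 1 / (1 + p)" "cmod (uppc x) \<le> 1 / (1 - p)"
    using p_bounds n by (auto simp: lowc_def uppc_def norm_divide norm_mult intro!: divide_right_mono)
  moreover have "cmod (midc x) \<le> 2"
    using entry_bounds(1)[of "x - 1"] entry_bounds(2)[of x] unfolding midc_def norm_of_real by linarith
  moreover have "0 \<le> 1 / (1 + p)" "0 \<le> 1 / (1 - p)" using p_bounds by auto
  ultimately show "cmod (lowc x) \<le> 1 / (1 + p) + 2 + 1 / (1 - p)"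
    "cmod (midc x) \<le> 1 / (1 + p) + 2 + 1 / (1 - p)" "cmod (uppc x) \<le> 1 / (1 + p) + 2 + 1 / (1 - p)"
    by linarith+
qed

lemma coefficient_limits:
  assumes lim: "(a1 \<longlongrightarrow> \<alpha>) F" "(a2 \<longlongrightarrow> - \<alpha>) F" "(b \<longlongrightarrow> \<beta>) F"
    and shift: "filterlim (\<lambda>x. x - 1) F F"
  shows "(lowc \<longlongrightarrow> cnj q * cnj \<beta> / (1 + p)) F" "(midc \<longlongrightarrow> complex_of_real (2 * \<alpha>)) F"
    "(uppc \<longlongrightarrow> - q * \<beta> / (1 - p)) F"
proof -
  note nz = p_complex_ne
  have s: "((\<lambda>x. a1 (x - 1)) \<longlongrightarrow> \<alpha>) F" "((\<lambda>x. b (x - 1)) \<longlongrightarrow> \<beta>) F"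
    using filterlim_compose[OF lim(1) shift] filterlim_compose[OF lim(3) shift] .
  show "(lowc \<longlongrightarrow> cnj q * cnj \<beta> / (1 + p)) F"
    unfolding lowc_def using nz by (intro tendsto_intros s) auto
  have "(midc \<longlongrightarrow> complex_of_real (\<alpha> - - \<alpha>)) F"
    unfolding midc_def by (intro tendsto_intros s lim)
  then show "(midc \<longlongrightarrow> complex_of_real (2 * \<alpha>)) F" by simp
  show "(uppc \<longlongrightarrow> - q * \<beta> / (1 - p)) F"
    unfolding uppc_def using nz by (intro tendsto_intros lim) auto
qed

end

section \<open>Walks with two nontrivial limit coins\<close>

locale anisotropic_walk = walk +
  fixes a1L a2L a1R a2R :: real and bL bR :: complex
  assumes limL1: "(a1 \<longlongrightarrow> a1L) at_bot" and limL2: "(a2 \<longlongrightarrow> a2L) at_bot"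
    and limLb: "(b \<longlongrightarrow> bL) at_bot"
    and limR1: "(a1 \<longlongrightarrow> a1R) at_top" and limR2: "(a2 \<longlongrightarrow> a2R) at_top"
    and limRb: "(b \<longlongrightarrow> bR) at_top"
    and ntL: "\<not> trivial_coin a1L a2L bL"
    and ntR: "\<not> trivial_coin a1R a2R bR"
begin

lemmas coin_R = limit_coin[OF limR1 limR2 limRb _ ntR, simplified]
lemmas coin_L = limit_coin[OF limL1 limL2 limLb _ ntL, simplified]

lemma closed_imp_R:
  assumes "H_closed (Q ` Hplus p q)"
  shows "\<bar>p\<bar> \<noteq> \<bar>a1R\<bar>"
proof
  assume eq: "\<bar>p\<bar> = \<bar>a1R\<bar>"
  obtain \<zeta> where \<zeta>: "cmod \<zeta> = 1"
    "cnj q * cnj bR / (1 + p) + complex_of_real (2 * a1R) * \<zeta> + (- q * bR / (1 - p)) * \<zeta>^2 = 0" "bR \<noteq> 0"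
    using symbol_zero[OF coin_R(1) eq] by blast
  have "filterlim (\<lambda>x::int. x - 1) at_top at_top" using filterlim_int_shift(1)[of "-1"] by simp
  note lims = coefficient_limits[OF limR1 limR2[unfolded coin_R(2)] limRb this]
  have "- q * bR / (1 - p) \<noteq> 0" using q0 \<zeta>(3) p_complex_ne by simp
  then have "\<not> tridiag_range_closed lowc midc uppc"
    by (rule tridiag_range_not_closed[OF coefficient_bounds lims \<zeta>(1,2)])
  then show False using closed_range_imp_tridiag[OF assms] by blast
qed

lemma closed_imp_L:
  assumes "H_closed (Q ` Hplus p q)"
  shows "\<bar>p\<bar> \<noteq> \<bar>a1L\<bar>"
proof
  assume eq: "\<bar>p\<bar> = \<bar>a1L\<bar>"
  obtain \<zeta> where \<zeta>: "cmod \<zeta> = 1"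
    "cnj q * cnj bL / (1 + p) + complex_of_real (2 * a1L) * \<zeta> + (- q * bL / (1 - p)) * \<zeta>^2 = 0" "bL \<noteq> 0"
    using symbol_zero[OF coin_L(1) eq] by blast
  have "filterlim (\<lambda>x::int. x - 1) at_bot at_bot" using filterlim_int_shift(2)[of "-1"] by simp
  note lims = coefficient_limits[OF limL1 limL2[unfolded coin_L(2)] limLb this]
  note lims' = lims[THEN filterlim_compose, OF filterlim_int_shift(3)]
  have \<zeta>0: "\<zeta> \<noteq> 0" using \<zeta>(1) by auto
  \<comment> \<open>Reflection reverses the coefficients of the symbol, so its unimodular zero
    becomes the inverse of \<zeta>.\<close>
  have root: "- q * bL / (1 - p) + complex_of_real (2 * a1L) * inverse \<zeta> + cnj q * cnj bL / (1 + p) * (inverse \<zeta>)^2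
      = (cnj q * cnj bL / (1 + p) + complex_of_real (2 * a1L) * \<zeta> + (- q * bL / (1 - p)) * \<zeta>^2) * (inverse \<zeta>)^2"
  proof -
    have "u + v * inverse \<zeta> + w * (inverse \<zeta>)^2 = (w + v * \<zeta> + u * \<zeta>^2) * (inverse \<zeta>)^2" for u v w
      using \<zeta>0 by (simp add: field_simps power2_eq_square)
    then show ?thesis .
  qed
  have z: "cmod (inverse \<zeta>) = 1" "- q * bL / (1 - p) + complex_of_real (2 * a1L) * inverse \<zeta>
      + cnj q * cnj bL / (1 + p) * (inverse \<zeta>)^2 = 0"
    unfolding root \<zeta>(2) by (simp_all add: norm_inverse \<zeta>(1))
  have "cnj q * cnj bL / (1 + p) \<noteq> 0" using q0 \<zeta>(3) p_complex_ne by simp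
  then have "\<not> tridiag_range_closed (\<lambda>x. uppc (- x)) (\<lambda>x. midc (- x)) (\<lambda>x. lowc (- x))"
    by (rule tridiag_range_not_closed[OF coefficient_bounds(3,2,1) lims'(3,2,1) z])
  then show False using tridiag_range_closed_reflect[OF closed_range_imp_tridiag[OF assms]] by blast
qed

text \<open>The kernel statement is kept separately, since the index count needs finite
  dimension.\<close>

lemma fredholm_and_finite_kernel:
  assumes ne: "\<bar>p\<bar> \<noteq> \<bar>a1L\<bar>" "\<bar>p\<bar> \<noteq> \<bar>a1R\<bar>"
  shows "is_fredholm p q a1 a2 b" "\<exists>F. finite F \<and> {\<psi> \<in> Hspace. Q \<psi> = 0} \<subseteq> hs.span F"
proof -
  obtain \<eta>R \<rho>R where \<eta>R: "0 < \<eta>R" and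
    R: "\<And>X. (\<And>x. x \<in> X \<Longrightarrow> \<bar>a1 x - a1R\<bar> \<le> \<eta>R \<and> cmod (b x - bR) \<le> \<eta>R \<and> a2 x = - a1 x) \<Longrightarrow>
      contractive_walk p q (\<lambda>x. if x \<in> X then a1 x else a1R) (\<lambda>x. if x \<in> X then a2 x else - a1R)
        (\<lambda>x. if x \<in> X then b x else bR) \<rho>R"
    using contractive_modification[OF coin_R(1) ne(2)] by blast
  obtain \<eta>L \<rho>L where \<eta>L: "0 < \<eta>L" and
    L: "\<And>X. (\<And>x. x \<in> X \<Longrightarrow> \<bar>a1 x - a1L\<bar> \<le> \<eta>L \<and> cmod (b x - bL) \<le> \<eta>L \<and> a2 x = - a1 x) \<Longrightarrow>
      contractive_walk p q (\<lambda>x. if x \<in> X then a1 x else a1L) (\<lambda>x. if x \<in> X then a2 x else - a1L)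
        (\<lambda>x. if x \<in> X then b x else bL) \<rho>L"
    using contractive_modification[OF coin_L(1) ne(1)] by blast
  have "\<forall>\<^sub>F x in at_top. \<bar>a1 x - a1R\<bar> < \<eta>R \<and> cmod (b x - bR) < \<eta>R \<and> a2 x = - a1 x"
    using tendstoD[OF limR1 \<eta>R] tendstoD[OF limRb \<eta>R] coin_R(3)
    by eventually_elim (auto simp: dist_norm)
  then obtain N1 where N1: "\<And>x. N1 \<le> x \<Longrightarrow> \<bar>a1 x - a1R\<bar> < \<eta>R \<and> cmod (b x - bR) < \<eta>R \<and> a2 x = - a1 x"
    by (auto simp: eventually_at_top_linorder)
  have "\<forall>\<^sub>F x in at_bot. \<bar>a1 x - a1L\<bar> < \<eta>L \<and> cmod (b x - bL) < \<eta>L \<and> a2 x = - a1 x"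
    using tendstoD[OF limL1 \<eta>L] tendstoD[OF limLb \<eta>L] coin_L(3)
    by eventually_elim (auto simp: dist_norm)
  then obtain N2 where N2: "\<And>x. x \<le> N2 \<Longrightarrow> \<bar>a1 x - a1L\<bar> < \<eta>L \<and> cmod (b x - bL) < \<eta>L \<and> a2 x = - a1 x"
    by (auto simp: eventually_at_bot_linorder)
  define N where "N = max 0 (max N1 (- N2))"
  have N: "0 \<le> N" "N1 \<le> N" "- N \<le> N2" by (auto simp: N_def)
  interpret R: contractive_walk p q "\<lambda>x. if x \<in> {N..} then a1 x else a1R" "\<lambda>x. if x \<in> {N..} then a2 x else - a1R"
    "\<lambda>x. if x \<in> {N..} then b x else bR" \<rho>R
    by (rule R) (use N1 N in \<open>force intro: less_imp_le\<close>)
  interpret L: contractive_walk p q "\<lambda>x. if x \<in> {..- N} then a1 x else a1L" "\<lambda>x. if x \<in> {..- N} then a2 x else - a1L"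
    "\<lambda>x. if x \<in> {..- N} then b x else bL" \<rho>L
    by (rule L) (use N2 N in \<open>force intro: less_imp_le\<close>)
  interpret glued_walk p q a1 a2 b "\<lambda>x. if x \<in> {N..} then a1 x else a1R" "\<lambda>x. if x \<in> {N..} then a2 x else - a1R"
    "\<lambda>x. if x \<in> {N..} then b x else bR" \<rho>R
    "\<lambda>x. if x \<in> {..- N} then a1 x else a1L" "\<lambda>x. if x \<in> {..- N} then a2 x else - a1L"
    "\<lambda>x. if x \<in> {..- N} then b x else bL" \<rho>L N
    by unfold_locales (use N in auto)
  show "is_fredholm p q a1 a2 b" by (rule fredholm)
  show "\<exists>F. finite F \<and> {\<psi> \<in> Hspace. Q \<psi> = 0} \<subseteq> hs.span F" by (rule kernel_finite_dim)
qed

lemma fredholm_iff: "is_fredholm p q a1 a2 b \<longleftrightarrow> \<bar>p\<bar> \<noteq> \<bar>a1L\<bar> \<and> \<bar>p\<bar> \<noteq> \<bar>a1R\<bar>"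
  using closed_imp_L closed_imp_R fredholm_and_finite_kernel(1) unfolding is_fredholm_def by blast

end

section \<open>Kernels of the supercharge\<close>

lemma dim_image_inj_on:
  assumes V: "hs.subspace V"
    and add: "\<And>\<psi> \<phi>. T (\<psi> + \<phi>) = T \<psi> + T \<phi>" and scale: "\<And>k \<psi>. T (hscale k \<psi>) = hscale k (T \<psi>)"
    and inj: "inj_on T V"
  shows "hs.dim (T ` V) = hs.dim V"
proof -
  interpret lin: Vector_Spaces.linear hscale hscale T
    by unfold_locales (use add scale in auto)
  obtain B where B: "B \<subseteq> V" "hs.independent B" "V \<subseteq> hs.span B" "card B = hs.dim V"
    using hs.basis_exists by blast
  have sB: "hs.span B = V" using B V hs.span_subspace by blast
  have "hs.independent (T ` B)"
    by (rule lin.independent_injective_image) (use B inj sB in auto)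
  moreover have "T ` V \<subseteq> hs.span (T ` B)" using lin.span_image[of B] sB by simp
  moreover have "T ` B \<subseteq> T ` V" using B by blast
  moreover have "card (T ` B) = hs.dim V"
    using card_image[OF inj_on_subset[OF inj B(1)]] B(4) by simp
  ultimately show ?thesis by (intro hs.dim_unique) auto
qed

text \<open>Rank-nullity for one nonzero functional. Dimension is the \<open>card\<close> of a
  basis, so finite dimension is what makes adjoining \<open>v0\<close> raise it by one.\<close>

lemma dim_functional_kernel:
  assumes V: "hs.subspace V" and fin: "finite F" "V \<subseteq> hs.span F"
    and add: "\<And>\<psi> \<phi>. l (\<psi> + \<phi>) = l \<psi> + (l \<phi> :: complex)" and scale: "\<And>k \<psi>. l (hscale k \<psi>) = k * l \<psi>"
    and v0: "v0 \<in> V" "l v0 \<noteq> 0"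
  shows "hs.dim V = hs.dim {\<psi> \<in> V. l \<psi> = 0} + 1"
proof -
  let ?W = "{\<psi> \<in> V. l \<psi> = 0}"
  have "l 0 = 0" using scale[of 0 0] by simp
  then have W: "hs.subspace ?W" using V add scale by (auto simp: hs.subspace_def)
  obtain B where B: "B \<subseteq> ?W" "hs.independent B" "?W \<subseteq> hs.span B" "card B = hs.dim ?W"
    using hs.basis_exists by blast
  have sB: "hs.span B = ?W" using B W hs.span_subspace by blast
  have "B \<subseteq> hs.span F" using B(1) fin(2) by blast
  then have fB: "finite B" using hs.independent_span_bound[OF fin(1) B(2)] by blast
  let ?U = "hs.span (insert v0 B)"
  have nB: "v0 \<notin> hs.span B" using sB v0 by simp
  have "hs.independent (insert v0 B)" using nB B(2) by (rule hs.independent_insertI)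
  moreover have "insert v0 B \<subseteq> V" using B(1) v0 by blast
  moreover have "V \<subseteq> ?U"
  proof
    fix v assume v: "v \<in> V"
    define w where "w = v + hscale (- (l v / l v0)) v0"
    have "w \<in> V" unfolding w_def by (intro hs.subspace_add hs.subspace_scale V v v0(1))
    moreover have "l w = 0" unfolding w_def add scale using v0(2) by simp
    ultimately have "w \<in> ?U"
      using sB hs.span_mono[of B "insert v0 B"] by auto
    moreover have "hscale (l v / l v0) v0 \<in> ?U"
      by (intro hs.span_scale hs.span_base) simp
    ultimately have "w + hscale (l v / l v0) v0 \<in> ?U" by (rule hs.span_add)
    then show "v \<in> ?U" by (simp add: w_def hs.scale_minus_left)
  qed
  moreover have "v0 \<notin> B" using nB hs.span_base by blast
  then have "card (insert v0 B) = hs.dim ?W + 1" using fB B(4) by simp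
  ultimately show ?thesis by (intro hs.dim_unique) auto
qed

definition total_mass :: "state \<Rightarrow> real" where
  "total_mass \<psi> = infsum (\<lambda>x. (cmod (fst \<psi> x))^2) UNIV + infsum (\<lambda>x. (cmod (snd \<psi> x))^2) UNIV"

lemma state_bound_total_mass:
  assumes "\<psi> \<in> Hspace"
  shows "state_bound \<psi> (sqrt (total_mass \<psi>))"
  using state_bound_hnorm[OF assms] unfolding hnorm_def hnorm_sq_split[OF assms] total_mass_def .

section \<open>The kernel of H, and the gauge between the eigenspaces\<close>

context walk
begin

lemma total_mass_Coin:
  assumes "\<psi> \<in> Hspace"
  shows "total_mass (C \<psi>) = total_mass \<psi>"
proof -
  have pt: "(cmod (fst (C \<psi>) x))^2 + (cmod (snd (C \<psi>) x))^2 = (cmod (fst \<psi> x))^2 + (cmod (snd \<psi> x))^2" for x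
  proof -
    let ?u = "fst \<psi> x" and ?v = "snd \<psi> x" and ?a = "complex_of_real (a1 x)" and ?a2 = "complex_of_real (a2 x)"
    have z: "b x * (?a + ?a2) = 0" using coin3[of x] by simp
    then have z': "cnj (b x) * (?a + ?a2) = 0" by auto
    have "complex_of_real ((cmod (fst (C \<psi>) x))^2 + (cmod (snd (C \<psi>) x))^2)
        = (?a * ?a + b x * cnj (b x)) * (?u * cnj ?u) + (?a2 * ?a2 + b x * cnj (b x)) * (?v * cnj ?v)
          + b x * (?a + ?a2) * (?u * cnj ?v) + cnj (b x) * (?a + ?a2) * (?v * cnj ?u)"
      unfolding of_real_add complex_norm_square by (simp add: Coin_def algebra_simps)
    also have "\<dots> = complex_of_real ((cmod ?u)^2 + (cmod ?v)^2)"
      unfolding z z' coin_complex of_real_add complex_norm_square by simp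
    finally show ?thesis unfolding of_real_eq_iff .
  qed
  show ?thesis
    using hnorm_sq_split[OF assms] hnorm_sq_split[OF Hspace_Coin[OF assms]]
    unfolding total_mass_def pt by simp
qed

text \<open>\<Gamma> acts by a unitary two-by-two block on the pair formed by the first component at
  x and the second at x + 1, so mass is conserved along this shifted pairing.\<close>

lemma total_mass_Gam:
  assumes "\<psi> \<in> Hspace"
  shows "total_mass (\<Gamma> \<psi>) = total_mass \<psi>"
proof -
  have pt: "(cmod (fst (\<Gamma> \<psi>) x))^2 + (cmod (snd (\<Gamma> \<psi>) (x + 1)))^2 = (cmod (fst \<psi> x))^2 + (cmod (snd \<psi> (x + 1)))^2" for x
  proof -
    let ?u = "fst \<psi> x" and ?v = "snd \<psi> (x + 1)" and ?p = "complex_of_real p"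
    have "complex_of_real ((cmod (fst (\<Gamma> \<psi>) x))^2 + (cmod (snd (\<Gamma> \<psi>) (x + 1)))^2)
        = (?p * ?p + q * cnj q) * (?u * cnj ?u) + (?p * ?p + q * cnj q) * (?v * cnj ?v)"
      unfolding of_real_add complex_norm_square by (simp add: Gam_def Lshift_def Lshift_adj_def algebra_simps)
    also have "\<dots> = complex_of_real ((cmod ?u)^2 + (cmod ?v)^2)"
      unfolding pq_complex of_real_add complex_norm_square by simp
    finally show ?thesis unfolding of_real_eq_iff .
  qed
  have bij: "bij_betw (\<lambda>x::int. x + 1) UNIV UNIV"
    by (rule bij_betw_byWitness[where f' = "\<lambda>x. x - 1"]) auto
  have shift: "infsum (\<lambda>x. (cmod (fst \<phi> x))^2 + (cmod (snd \<phi> (x + 1)))^2) UNIV = total_mass \<phi>"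
    if "\<phi> \<in> Hspace" for \<phi>
  proof -
    have "(\<lambda>x. (cmod (snd \<phi> (x + 1)))^2) summable_on UNIV"
      using that summable_on_reindex_bij_betw[OF bij, of "\<lambda>x. (cmod (snd \<phi> x))^2"] by (simp add: Hspace_def)
    then have "infsum (\<lambda>x. (cmod (fst \<phi> x))^2 + (cmod (snd \<phi> (x + 1)))^2) UNIV
        = infsum (\<lambda>x. (cmod (fst \<phi> x))^2) UNIV + infsum (\<lambda>x. (cmod (snd \<phi> (x + 1)))^2) UNIV"
      using that by (intro infsum_add) (auto simp: Hspace_def)
    then show ?thesis
      using infsum_reindex_bij_betw[OF bij, of "\<lambda>x. (cmod (snd \<phi> x))^2"] by (simp add: total_mass_def)
  qed
  show ?thesis using shift[OF assms] shift[OF Hspace_Gam[OF assms]] unfolding pt by simp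
qed

lemma Q_zero_iff: "Q \<psi> = 0 \<longleftrightarrow> \<Gamma> (C \<psi>) = C (\<Gamma> \<psi>)"
  unfolding Qop_def by simp

text \<open>The isometry \<open>W = (\<Gamma>C)\<^sup>2\<close> satisfies \<open>(W - 1)\<^sup>2 \<psi> = 0\<close> if \<open>Q\<^sup>2 \<psi> = 0\<close>, so
  \<open>W\<^sup>n \<psi> = \<psi> + n (W - 1) \<psi>\<close> can only stay bounded if \<open>W \<psi> = \<psi>\<close>.\<close>

lemma kernel_Q_squared:
  assumes \<psi>: "\<psi> \<in> Hspace" and zero: "Q (Q \<psi>) = 0"
  shows "Q \<psi> = 0"
proof -
  define W where "W \<phi> = \<Gamma> (C (\<Gamma> (C \<phi>)))" for \<phi>
  have W_add: "W (\<phi> + \<phi>') = W \<phi> + W \<phi>'" and W_diff: "W (\<phi> - \<phi>') = W \<phi> - W \<phi>'"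
    and W_hscale: "W (hscale k \<phi>) = hscale k (W \<phi>)" for \<phi> \<phi>' k
    by (simp_all add: W_def Gam_add Coin_add Gam_diff Coin_diff Gam_hscale Coin_hscale)
  define \<delta> where "\<delta> = W \<psi> - \<psi>"
  have "M (M \<psi>) = \<psi>" using Q_squared[of \<psi>] zero by simp
  then have *: "hscale (1/4) (W \<psi> + hscale 2 \<psi> + C (\<Gamma> (C (\<Gamma> \<psi>)))) = \<psi>"
    unfolding anticomm_def W_def
    by (simp add: Gam_hscale Coin_hscale Gam_add Coin_add Gam_Gam Coin_Coin prod_eq_iff fun_eq_iff field_simps)
  \<comment> \<open>\<open>C\<Gamma>C\<Gamma>\<close> inverts \<open>W\<close>, so the previous
    identity reads (W + 2 + 1/W) \<psi> = 4 \<psi>; applying \<open>W\<close> turns it into (W -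
    1)^2 \<psi> = 0.\<close>
  have "W (C (\<Gamma> (C (\<Gamma> \<psi>)))) = \<psi>" by (simp add: W_def Gam_Gam Coin_Coin)
  then have "hscale (1/4) (W (W \<psi>) + hscale 2 (W \<psi>) + \<psi>) = W \<psi>"
    using arg_cong[OF *, of W] by (simp add: W_hscale W_add)
  then have **: "W (W \<psi>) + \<psi> = hscale 2 (W \<psi>)"
    by (simp add: prod_eq_iff fun_eq_iff field_simps)
  have W\<delta>: "W \<delta> = \<delta>"
  proof -
    have "W \<delta> = (W (W \<psi>) + \<psi>) - \<psi> - W \<psi>" by (simp add: \<delta>_def W_diff)
    also have "\<dots> = \<delta>" unfolding ** \<delta>_def by (rule state_eqI) simp_all
    finally show ?thesis .
  qed
  have Wn: "(W ^^ n) \<psi> = \<psi> + hscale (of_nat n) \<delta>" for n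
  proof (induction n)
    case 0
    then show ?case by (simp add: prod_eq_iff fun_eq_iff)
  next
    case (Suc n)
    have "(W ^^ Suc n) \<psi> = W \<psi> + hscale (of_nat n) \<delta>" using Suc by (simp add: W_add W_hscale W\<delta>)
    also have "W \<psi> = \<psi> + \<delta>" by (simp add: \<delta>_def)
    finally show ?case by (simp add: prod_eq_iff fun_eq_iff algebra_simps)
  qed
  have mass: "(W ^^ n) \<psi> \<in> Hspace \<and> total_mass ((W ^^ n) \<psi>) = total_mass \<psi>" for n
    by (induction n) (auto simp: W_def \<psi> Hspace_Gam Hspace_Coin total_mass_Gam total_mass_Coin)
  let ?c = "sqrt (total_mass \<psi>)"
  have b: "state_bound ((W ^^ n) \<psi>) ?c" for n using state_bound_total_mass mass by metis
  have "state_bound \<delta> (2 * ?c / real (Suc n))" for n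
  proof -
    have "\<delta> = hscale (1 / of_nat (Suc n)) ((W ^^ Suc n) \<psi> - (W ^^ 0) \<psi>)"
      unfolding Wn by (rule state_eqI) (simp_all add: field_simps del: of_nat_Suc)
    moreover have "state_bound (hscale (1 / of_nat (Suc n)) ((W ^^ Suc n) \<psi> - (W ^^ 0) \<psi>))
        (cmod (1 / of_nat (Suc n)) * (?c + ?c))"
      by (intro state_bound_hscale state_bound_diff b)
    moreover have "cmod (1 / of_nat (Suc n)) * (?c + ?c) = 2 * ?c / real (Suc n)"
      by (simp add: norm_divide del: of_nat_Suc)
    ultimately show ?thesis by metis
  qed
  moreover have "(\<lambda>n. 2 * ?c / real (Suc n)) \<longlonglongrightarrow> 0"
    using tendsto_mult[OF tendsto_const[of "2 * ?c"] LIMSEQ_inverse_real_of_nat]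
    by (simp add: divide_inverse)
  ultimately have "\<delta> = 0" by (rule state_zero_if_bounds_vanish)
  then have "\<Gamma> (C (\<Gamma> (C \<psi>))) = \<psi>" by (simp add: \<delta>_def W_def)
  then have "C (\<Gamma> (\<Gamma> (C (\<Gamma> (C \<psi>))))) = C (\<Gamma> \<psi>)" by simp
  then have "\<Gamma> (C \<psi>) = C (\<Gamma> \<psi>)" by (simp add: Gam_Gam Coin_Coin)
  then show ?thesis by (simp add: Q_zero_iff)
qed

definition "Kplus = {\<psi> \<in> Hspace. \<Gamma> \<psi> = \<psi> \<and> Q \<psi> = 0}"
definition "Kminus = {\<psi> \<in> Hspace. \<Gamma> \<psi> = - \<psi> \<and> Q \<psi> = 0}"

lemma witten_index_eq:
  "witten_index p q a1 a2 b = int (hs.dim Kplus) - int (hs.dim Kminus)"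
proof -
  have "{\<psi> \<in> Hplus p q. Hop p q a1 a2 b \<psi> = 0} = Kplus" "{\<psi> \<in> Hminus p q. Hop p q a1 a2 b \<psi> = 0} = Kminus"
    using kernel_Q_squared by (auto simp: Hplus_def Hminus_def Hop_def Kplus_def Kminus_def Qop_zero)
  then show ?thesis by (simp add: witten_index_def cdim_def)
qed

text \<open>Chosen such that multiplication by \<open>gauge_base\<^sup>x\<close> turns \<open>\<Gamma> \<psi> = \<psi>\<close> into \<open>\<Gamma> \<psi> = - \<psi>\<close>.\<close>

definition "gauge_base = - complex_of_real ((1 + p) / (1 - p))"

definition gauge :: "state \<Rightarrow> state" where
  "gauge \<psi> = (\<lambda>x. gauge_base powi x * fst \<psi> x, \<lambda>x. gauge_base powi x * snd \<psi> x)"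

text \<open>\<open>gauge\<close> embeds this space into \<open>Kminus\<close>, so the index is the
  difference of its codimensions in the two kernels.\<close>

definition "Kboth = {\<psi> \<in> Kplus. gauge \<psi> \<in> Hspace}"

lemma gauge_base_nonzero: "gauge_base \<noteq> 0"
  unfolding gauge_base_def neg_equal_0_iff_equal of_real_eq_0_iff using p_bounds by simp

lemma gauge_add: "gauge (\<psi> + \<phi>) = gauge \<psi> + gauge \<phi>"
  and gauge_hscale: "gauge (hscale k \<psi>) = hscale k (gauge \<psi>)"
  by (auto intro!: state_eqI simp: gauge_def algebra_simps)

lemma gauge_inj: "gauge \<psi> = gauge \<phi> \<Longrightarrow> \<psi> = \<phi>"
  using gauge_base_nonzero by (auto simp: gauge_def prod_eq_iff fun_eq_iff)

lemma Gam_gauge: "\<Gamma> (gauge \<psi>) = - gauge \<psi> \<longleftrightarrow> \<Gamma> \<psi> = \<psi>"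
proof -
  have *: "gauge_base * (- q / (1 + p)) = q / (1 - p)"
    using p_complex_ne by (simp add: gauge_base_def)
  have "gauge_base powi (x + 1) * (- q / (1 + p)) = gauge_base powi x * (q / (1 - p))" for x
    unfolding *[symmetric] using gauge_base_nonzero by (simp add: power_int_add)
  then have "- q / (1 + p) * (gauge_base powi (x + 1) * z) = gauge_base powi x * (q / (1 - p) * z)" for x z
    by (metis mult.assoc mult.commute)
  then show ?thesis
    unfolding Gam_eigen_plus_iff Gam_eigen_minus_iff using gauge_base_nonzero
    by (simp add: gauge_def del: times_divide_eq_left times_divide_eq_right)
qed

lemma Coin_gauge: "C (gauge \<psi>) = gauge (C \<psi>)"
  by (rule state_eqI) (simp_all add: Coin_def gauge_def algebra_simps)

text \<open>For \<Gamma>\<psi> = \<psi> the equation Q\<psi> = 0 says that C\<psi> is fixed by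
  \<Gamma> too. The gauge commutes with C, which acts sitewise, and so carries this to the other
  eigenspace.\<close>

lemma Q_gauge_zero_iff:
  assumes "\<Gamma> \<psi> = \<psi>"
  shows "Q (gauge \<psi>) = 0 \<longleftrightarrow> Q \<psi> = 0"
proof -
  have "\<Gamma> (gauge \<psi>) = - gauge \<psi>" using assms Gam_gauge by blast
  then have "Q (gauge \<psi>) = 0 \<longleftrightarrow> \<Gamma> (gauge (C \<psi>)) = - gauge (C \<psi>)"
    by (simp add: Q_zero_iff Coin_gauge Coin_minus)
  also have "\<dots> \<longleftrightarrow> \<Gamma> (C \<psi>) = C \<psi>" by (rule Gam_gauge)
  finally show ?thesis using assms by (simp add: Q_zero_iff)
qed

lemma subspace_Kplus: "hs.subspace Kplus"
  unfolding hs.subspace_def Kplus_def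
  by (auto simp: Hspace_zero Hspace_add Hspace_hscale Gam_add Gam_hscale Qop_add Qop_hscale Qop_zero
      hs.scale_zero_right) (simp add: Gam_def Lshift_def Lshift_adj_def zero_prod_def fun_eq_iff)

lemma subspace_Kminus: "hs.subspace Kminus"
  unfolding hs.subspace_def Kminus_def
  by (auto simp: Hspace_zero Hspace_add Hspace_hscale Gam_add Gam_hscale Qop_add Qop_hscale Qop_zero
      hs.scale_zero_right hs.scale_minus_right) (simp add: Gam_def Lshift_def Lshift_adj_def zero_prod_def fun_eq_iff)

lemma subspace_Kboth: "hs.subspace Kboth"
proof -
  have "gauge 0 = 0" by (rule state_eqI) (simp_all add: gauge_def)
  then show ?thesis
    using subspace_Kplus unfolding hs.subspace_def Kboth_def
    by (auto simp: gauge_add gauge_hscale Hspace_zero Hspace_add Hspace_hscale)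
qed

end

section \<open>Reflection, which exchanges the two kernels\<close>

definition reflect :: "state \<Rightarrow> state" where
  "reflect \<psi> = (\<lambda>x. snd \<psi> (- x), \<lambda>x. fst \<psi> (- x))"

lemma reflect_reflect: "reflect (reflect \<psi>) = \<psi>"
  by (simp add: reflect_def)

lemma reflect_add: "reflect (\<psi> + \<phi>) = reflect \<psi> + reflect \<phi>"
  and reflect_hscale: "reflect (hscale k \<psi>) = hscale k (reflect \<psi>)"
  and reflect_minus: "reflect (- \<psi>) = - reflect \<psi>"
  by (auto intro!: state_eqI simp: reflect_def)

lemma Hspace_reflect: "reflect \<psi> \<in> Hspace \<longleftrightarrow> \<psi> \<in> Hspace"
proof -
  have inj: "inj (\<lambda>x::int. - x)" by (simp add: inj_def)
  have "reflect \<psi> \<in> Hspace" if "\<psi> \<in> Hspace" for \<psi>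
    using that l2_bound_reindex[OF _ inj]
    unfolding Hspace_iff_state_bound state_bound_def reflect_def by auto
  then show ?thesis using reflect_reflect by metis
qed

text \<open>Swapping the components along with reversing the line restores the split-step form. The
  swap also reverses the diagonal of \<Gamma>, whence the global sign that exchanges the
  eigenvalues.\<close>

lemma Gam_reflect: "Gam p (- cnj q) (reflect \<psi>) = - reflect (Gam p q \<psi>)"
  by (rule state_eqI) (simp_all add: Gam_def Lshift_def Lshift_adj_def reflect_def algebra_simps)

lemma Coin_reflect:
  "Coin (\<lambda>x. a2 (- x)) (\<lambda>x. a1 (- x)) (\<lambda>x. cnj (b (- x))) (reflect \<psi>) = reflect (Coin a1 a2 b \<psi>)"
  by (rule state_eqI) (simp_all add: Coin_def reflect_def algebra_simps)

context walk
begin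

interpretation refl: walk p "- cnj q" "\<lambda>x. a2 (- x)" "\<lambda>x. a1 (- x)" "\<lambda>x. cnj (b (- x))"
proof
  fix x
  show "cnj (b (- x)) * complex_of_real (a2 (- x) + a1 (- x)) = 0"
    using coin3[of "- x"] by (auto simp: add.commute)
qed (use pq q0 coin1 coin2 in auto)

lemma Q_reflect_zero_iff: "refl.Q (reflect \<psi>) = 0 \<longleftrightarrow> Q \<psi> = 0"
proof -
  have "refl.Q (reflect \<psi>) = 0 \<longleftrightarrow> - reflect (\<Gamma> (C \<psi>)) = - reflect (C (\<Gamma> \<psi>))"
    unfolding refl.Q_zero_iff Coin_reflect Gam_reflect Coin_minus ..
  also have "\<dots> \<longleftrightarrow> Q \<psi> = 0"
    unfolding Q_zero_iff by (metis neg_equal_iff_equal reflect_reflect)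
  finally show ?thesis .
qed

lemma refl_Kplus: "refl.Kplus = reflect ` Kminus"
proof -
  have "reflect \<psi> \<in> refl.Kplus \<longleftrightarrow> \<psi> \<in> Kminus" for \<psi>
    unfolding refl.Kplus_def Kminus_def
    by (simp add: Hspace_reflect Q_reflect_zero_iff Gam_reflect)
      (metis add.inverse_inverse reflect_minus reflect_reflect)
  note iff = this
  show ?thesis
  proof (intro equalityI subsetI)
    fix \<phi> assume "\<phi> \<in> refl.Kplus"
    then have "reflect \<phi> \<in> Kminus" using iff[of "reflect \<phi>"] by (simp add: reflect_reflect)
    then show "\<phi> \<in> reflect ` Kminus"
      using image_eqI[of \<phi> reflect "reflect \<phi>" Kminus] by (simp add: reflect_reflect)
  qed (use iff in blast)
qed

text \<open>The gauge factors at x and -x are inverse to each other, so reflection conjugates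
  \<open>gauge\<close> into its inverse.\<close>

lemma gauge_reflect_gauge: "gauge (reflect (gauge \<psi>)) = reflect \<psi>"
  using gauge_base_nonzero
  by (intro state_eqI) (simp_all add: gauge_def reflect_def power_int_minus)

text \<open>\<open>reflect\<close> carries \<open>Kminus\<close>, not \<open>Kplus\<close>, to the
  reflected \<open>Kplus\<close>; a state of \<open>Kboth\<close> therefore has to be gauged first.
  The gauge depends on \<open>p\<close> only and is thus the same for both walks.\<close>

lemma refl_Kboth: "refl.Kboth = (\<lambda>\<psi>. reflect (gauge \<psi>)) ` Kboth"
proof
  show "(\<lambda>\<psi>. reflect (gauge \<psi>)) ` Kboth \<subseteq> refl.Kboth"
  proof
    fix \<phi> assume "\<phi> \<in> (\<lambda>\<psi>. reflect (gauge \<psi>)) ` Kboth"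
    then obtain \<psi> where \<psi>: "\<psi> \<in> Kboth" "\<phi> = reflect (gauge \<psi>)" by blast
    then have g: "\<psi> \<in> Hspace" "\<Gamma> \<psi> = \<psi>" "Q \<psi> = 0" "gauge \<psi> \<in> Hspace"
      by (auto simp: Kboth_def Kplus_def)
    then have "gauge \<psi> \<in> Kminus" by (simp add: Kminus_def Gam_gauge Q_gauge_zero_iff)
    then have "\<phi> \<in> refl.Kplus" using \<psi>(2) refl_Kplus by blast
    moreover have "gauge \<phi> \<in> Hspace"
      using g \<psi>(2) by (simp add: gauge_reflect_gauge Hspace_reflect)
    ultimately show "\<phi> \<in> refl.Kboth" by (simp add: refl.Kboth_def)
  qed
  show "refl.Kboth \<subseteq> (\<lambda>\<psi>. reflect (gauge \<psi>)) ` Kboth"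
  proof
    fix \<phi> assume "\<phi> \<in> refl.Kboth"
    then have "\<phi> \<in> reflect ` Kminus" and g\<phi>: "gauge \<phi> \<in> Hspace"
      using refl_Kplus by (auto simp: refl.Kboth_def)
    then obtain \<xi> where \<xi>: "\<xi> \<in> Kminus" "\<phi> = reflect \<xi>" by blast
    define \<psi> where "\<psi> = reflect (gauge \<phi>)"
    have g\<psi>: "gauge \<psi> = \<xi>" using gauge_reflect_gauge \<xi>(2) by (simp add: \<psi>_def reflect_reflect)
    have "\<Gamma> \<psi> = \<psi>" using Gam_gauge[of \<psi>] \<xi>(1) g\<psi> by (simp add: Kminus_def)
    moreover have "Q \<psi> = 0" using Q_gauge_zero_iff[OF \<open>\<Gamma> \<psi> = \<psi>\<close>] \<xi>(1) g\<psi> by (simp add: Kminus_def)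
    moreover have "\<psi> \<in> Hspace" "gauge \<psi> \<in> Hspace"
      using g\<phi> \<xi>(1) g\<psi> by (auto simp: \<psi>_def Hspace_reflect Kminus_def)
    ultimately have "\<psi> \<in> Kboth" by (simp add: Kboth_def Kplus_def)
    moreover have "\<phi> = reflect (gauge \<psi>)" using g\<psi> \<xi>(2) by simp
    ultimately show "\<phi> \<in> (\<lambda>\<psi>. reflect (gauge \<psi>)) ` Kboth" by blast
  qed
qed

lemma dim_refl_Kplus: "hs.dim refl.Kplus = hs.dim Kminus"
  unfolding refl_Kplus
  by (rule dim_image_inj_on[OF subspace_Kminus])
    (auto simp: reflect_add reflect_hscale intro: inj_on_inverseI[of _ reflect] reflect_reflect)

lemma dim_refl_Kboth: "hs.dim refl.Kboth = hs.dim Kboth"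
  unfolding refl_Kboth
proof (rule dim_image_inj_on[OF subspace_Kboth])
  show "inj_on (\<lambda>\<psi>. reflect (gauge \<psi>)) Kboth"
    by (rule inj_onI) (metis gauge_inj reflect_reflect)
qed (auto simp: reflect_add reflect_hscale gauge_add gauge_hscale)

end

section \<open>Decay of eigenstates\<close>

lemma summable_on_int_halves:
  fixes f :: "int \<Rightarrow> real"
  shows "f summable_on UNIV \<longleftrightarrow> f summable_on {..N} \<and> f summable_on {N..}"
proof
  assume "f summable_on UNIV"
  from summable_on_subset_banach[OF this] show "f summable_on {..N} \<and> f summable_on {N..}"
    by simp
next
  assume f: "f summable_on {..N} \<and> f summable_on {N..}"
  have "f summable_on {..N - 1}" by (rule summable_on_subset_banach[of f "{..N}"]) (use f in auto)
  then have "f summable_on ({..N - 1} \<union> {N..})"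
    using f by (intro summable_on_Un_disjoint) auto
  moreover have "{..N - 1} \<union> {N..} = UNIV" by auto
  ultimately show "f summable_on UNIV" by simp
qed

lemma summable_on_int_above:
  fixes f :: "int \<Rightarrow> real"
  assumes "f summable_on {N..}"
  shows "f summable_on {M..}"
proof (cases "N \<le> M")
  case True
  then show ?thesis by (intro summable_on_subset_banach[OF assms, of "{M..}"]) auto
next
  case False
  then have "f summable_on ({M..N - 1} \<union> {N..})"
    using assms by (intro summable_on_Un_disjoint) auto
  moreover have "{M..N - 1} \<union> {N..} = {M..}" using False by auto
  ultimately show ?thesis by simp
qed

lemma summable_on_int_uminus:
  fixes f :: "int \<Rightarrow> real"
  shows "(\<lambda>x. f (- x)) summable_on {- N..} \<longleftrightarrow> f summable_on {..N}"
  by (rule summable_on_reindex_bij_betw, rule bij_betw_byWitness[where f' = uminus]) auto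

lemma geometric_decay_summable:
  fixes F :: "int \<Rightarrow> real"
  assumes F: "\<And>x. 0 \<le> F x" and \<rho>: "0 \<le> \<rho>" "\<rho> < 1" and dec: "\<And>x. N \<le> x \<Longrightarrow> F (x + 1) \<le> \<rho> * F x"
  shows "F summable_on {N..}"
proof (rule nonneg_bdd_above_summable_on)
  have g: "F (N + int k) \<le> F N * \<rho>^k" for k
  proof (induction k)
    case (Suc k)
    have "F (N + int (Suc k)) \<le> \<rho> * F (N + int k)" using dec[of "N + int k"] by (simp add: algebra_simps)
    also have "\<dots> \<le> \<rho> * (F N * \<rho>^k)" using Suc \<rho> by (intro mult_left_mono) auto
    finally show ?case by (simp add: algebra_simps)
  qed simp
  have "sum F A \<le> F N * (1 / (1 - \<rho>))" if A: "A \<subseteq> {N..}" "finite A" for A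
  proof -
    obtain m where m: "A \<subseteq> (\<lambda>k. N + int k) ` {..<m}"
    proof
      show "A \<subseteq> (\<lambda>k. N + int k) ` {..<nat (Max (insert N A) - N) + 1}"
      proof
        fix x assume x: "x \<in> A"
        then have "N \<le> x" "x \<le> Max (insert N A)" using A by auto
        then show "x \<in> (\<lambda>k. N + int k) ` {..<nat (Max (insert N A) - N) + 1}"
          by (intro image_eqI[of _ _ "nat (x - N)"]) auto
      qed
    qed
    have "sum F A \<le> sum F ((\<lambda>k. N + int k) ` {..<m})" by (rule sum_mono2) (use m F in auto)
    also have "\<dots> = (\<Sum>k<m. F (N + int k))" by (subst sum.reindex) (auto simp: inj_on_def)
    also have "\<dots> \<le> (\<Sum>k<m. F N * \<rho>^k)" by (rule sum_mono) (rule g)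
    also have "\<dots> \<le> (\<Sum>k. F N * \<rho>^k)"
      by (rule sum_le_suminf) (use F \<rho> in \<open>auto intro!: summable_mult summable_geometric\<close>)
    also have "\<dots> = F N * (1 / (1 - \<rho>))"
      using sums_unique[OF sums_mult[OF geometric_sums[of \<rho>], of "F N"]] \<rho> by simp
    finally show ?thesis .
  qed
  then show "bdd_above (sum F ` {A. A \<subseteq> {N..} \<and> finite A})" by (auto intro!: bdd_aboveI)
qed (rule F)

lemma geometric_growth_zero:
  fixes F :: "int \<Rightarrow> real"
  assumes F: "\<And>x. 0 \<le> F x" and \<rho>: "0 \<le> \<rho>" "\<rho> < 1" and inc: "\<And>x. N \<le> x \<Longrightarrow> F x \<le> \<rho> * F (x + 1)"
    and s: "F summable_on {N..}" and x: "N \<le> x"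
  shows "F x = 0"
proof -
  define B where "B = infsum F {N..}"
  have B: "F y \<le> B" if "N \<le> y" for y
    using finite_sum_le_infsum[OF s, of "{y}"] F that by (simp add: B_def)
  have "F x \<le> \<rho>^k * F (x + int k)" for k
  proof (induction k)
    case (Suc k)
    have "F (x + int k) \<le> \<rho> * F (x + int (Suc k))" using inc[of "x + int k"] x by (simp add: algebra_simps)
    then have "\<rho>^k * F (x + int k) \<le> \<rho>^k * (\<rho> * F (x + int (Suc k)))" using \<rho> by (intro mult_left_mono) auto
    then show ?case using Suc by (simp add: algebra_simps)
  qed simp
  moreover have "\<rho>^k * F (x + int k) \<le> \<rho>^k * B" for k using B[of "x + int k"] x \<rho> by (intro mult_left_mono) auto
  ultimately have "F x \<le> \<rho>^k * B" for k by (rule order_trans)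
  moreover have "(\<lambda>k. \<rho>^k * B) \<longlonglongrightarrow> 0" using \<rho> by (intro tendsto_mult_left_zero LIMSEQ_power_zero) simp
  ultimately have "F x \<le> 0" by (intro LIMSEQ_le_const) auto
  then show ?thesis using F[of x] by simp
qed

lemma ratio_threshold:
  fixes A B :: "int \<Rightarrow> real"
  assumes "(A \<longlongrightarrow> \<alpha>) at_top" "(B \<longlongrightarrow> \<beta>) at_top" "0 \<le> \<beta>" "\<beta> < \<alpha>"
  shows "\<exists>N \<rho>. 0 \<le> \<rho> \<and> \<rho> < 1 \<and> (\<forall>x\<ge>N. 0 < A x \<and> B x \<le> \<rho> * A x)"
proof -
  \<comment> \<open>The midpoint of the limiting ratio and 1 leaves room on both sides.\<close>
  define \<rho> where "\<rho> = (\<beta> / \<alpha> + 1) / 2"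
  have r: "0 \<le> \<beta> / \<alpha>" "\<beta> / \<alpha> < 1" using assms(3,4) by auto
  have \<rho>: "0 \<le> \<rho>" "\<rho> < 1" "\<beta> / \<alpha> < \<rho>" unfolding \<rho>_def using r by argo+
  have "((\<lambda>x. B x / A x) \<longlongrightarrow> \<beta> / \<alpha>) at_top" using assms by (intro tendsto_intros) auto
  then have "\<forall>\<^sub>F x in at_top. B x / A x < \<rho>" using \<rho>(3) by (rule order_tendstoD(2))
  moreover have "\<forall>\<^sub>F x in at_top. 0 < A x" by (rule order_tendstoD(1)[OF assms(1)]) (use assms in auto)
  ultimately have "\<forall>\<^sub>F x in at_top. 0 < A x \<and> B x \<le> \<rho> * A x"
    by eventually_elim (auto simp: field_simps)
  then show ?thesis using \<rho> unfolding eventually_at_top_linorder by blast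
qed

text \<open>The threshold depends on the coefficients alone. Quantifying over \<open>F\<close>
  inside lets one site \<open>N\<close> serve all joint eigenstates at once, so that the value at
  \<open>N\<close> can act as a linear functional.\<close>

lemma recursion_decay:
  fixes A B :: "int \<Rightarrow> real"
  assumes lim: "(A \<longlongrightarrow> \<alpha>) at_top" "(B \<longlongrightarrow> \<beta>) at_top" "0 \<le> \<beta>" "\<beta> < \<alpha>"
  shows "\<forall>\<^sub>F N in at_top. \<forall>F. (\<forall>x. 0 \<le> F x) \<longrightarrow> (\<forall>x\<ge>N. A x * F (x + 1) = B x * F x) \<longrightarrow>
    F summable_on {N..} \<and> (F N = 0 \<longrightarrow> (\<forall>x\<ge>N. F x = 0))"
proof -
  obtain N \<rho> where N: "0 \<le> \<rho>" "\<rho> < 1" "\<And>x. N \<le> x \<Longrightarrow> 0 < A x \<and> B x \<le> \<rho> * A x"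
    using ratio_threshold[OF lim] by auto
  show ?thesis
    unfolding eventually_at_top_linorder
  proof (intro exI[of _ N] allI impI)
    fix N' F assume N': "N \<le> N'" and "\<forall>x. 0 \<le> F x" "\<forall>x\<ge>N'. A x * F (x + 1) = B x * F x"
    then have F: "\<And>x. 0 \<le> F x" "\<And>x. N' \<le> x \<Longrightarrow> A x * F (x + 1) = B x * F x" by auto
    have dec: "F (x + 1) \<le> \<rho> * F x" if "N' \<le> x" for x
    proof -
      have A: "0 < A x" "B x \<le> \<rho> * A x" using N(3) N' that by auto
      have "A x * F (x + 1) \<le> A x * (\<rho> * F x)"
        using mult_right_mono[OF A(2) F(1)[of x]] F(2)[OF that] by (simp add: algebra_simps)
      then show ?thesis using A(1) by simp
    qed
    have "F x = 0" if z: "F N' = 0" and x: "N' \<le> x" for x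
      using x
    proof (induction x rule: int_ge_induct)
      case (step x)
      then show ?case using dec[of x] F(1)[of "x + 1"] by simp
    qed (rule z)
    moreover have "F summable_on {N'..}"
      by (rule geometric_decay_summable[of F \<rho>]) (use F(1) N(1,2) dec in auto)
    ultimately show "F summable_on {N'..} \<and> (F N' = 0 \<longrightarrow> (\<forall>x\<ge>N'. F x = 0))" by simp
  qed
qed

lemma recursion_vanish:
  fixes A B :: "int \<Rightarrow> real"
  assumes lim: "(A \<longlongrightarrow> \<alpha>) at_top" "(B \<longlongrightarrow> \<beta>) at_top" "0 \<le> \<alpha>" "\<alpha> < \<beta>"
  shows "\<forall>\<^sub>F N in at_top. \<forall>F. (\<forall>x. 0 \<le> F x) \<longrightarrow> (\<forall>x\<ge>N. A x * F (x + 1) = B x * F x) \<longrightarrow>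
    F summable_on {N..} \<longrightarrow> (\<forall>x\<ge>N. F x = 0)"
proof -
  obtain N \<rho> where N: "0 \<le> \<rho>" "\<rho> < 1" "\<And>x. N \<le> x \<Longrightarrow> 0 < B x \<and> A x \<le> \<rho> * B x"
    using ratio_threshold[OF lim(2,1,3,4)] by auto
  show ?thesis
    unfolding eventually_at_top_linorder
  proof (intro exI[of _ N] allI impI)
    fix N' F x assume N': "N \<le> N'" and "\<forall>x. 0 \<le> F x" "\<forall>x\<ge>N'. A x * F (x + 1) = B x * F x"
      and s: "F summable_on {N'..}" and x: "N' \<le> x"
    then have F: "\<And>x. 0 \<le> F x" "\<And>x. N' \<le> x \<Longrightarrow> A x * F (x + 1) = B x * F x" by auto
    have "F y \<le> \<rho> * F (y + 1)" if "N' \<le> y" for y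
    proof -
      have B: "0 < B y" "A y \<le> \<rho> * B y" using N(3) N' that by auto
      have "B y * F y \<le> B y * (\<rho> * F (y + 1))"
        using mult_right_mono[OF B(2) F(1)[of "y + 1"]] F(2)[OF that] by (simp add: algebra_simps)
      then show ?thesis using B(1) by simp
    qed
    then show "F x = 0" by (rule geometric_growth_zero[OF F(1) N(1,2) _ s x])
  qed
qed

section \<open>Joint eigenstates of \<Gamma> and C\<close>

context walk
begin

definition eig :: "real \<Rightarrow> real \<Rightarrow> state \<Rightarrow> bool" where
  "eig s e \<psi> \<longleftrightarrow> \<Gamma> \<psi> = hscale (of_real s) \<psi> \<and> C \<psi> = hscale (of_real e) \<psi>"

text \<open>Only the second component is tracked: on an eigenspace of \<Gamma> the first is a
  shifted multiple of it.\<close>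

definition "mass \<psi> x = (cmod (snd \<psi> x))^2"

lemma mass_nonneg: "0 \<le> mass \<psi> x"
  by (simp add: mass_def)

lemma mass_eq_0_iff: "mass \<psi> x = 0 \<longleftrightarrow> snd \<psi> x = 0"
  by (simp add: mass_def)

lemma hscale_of_minus_one: "hscale (of_real (-1)) \<psi> = - \<psi>" "hscale (of_real 1) \<psi> = \<psi>"
  by (rule state_eqI; simp)+

lemma fst_mass:
  assumes "eig s e \<psi>" "s \<in> {1, -1}"
  shows "(1 - s * p) * (cmod (fst \<psi> x))^2 = (1 + s * p) * mass \<psi> (x + 1)"
proof -
  have n: "cmod (1 + complex_of_real p) = 1 + p" "cmod (1 - complex_of_real p) = 1 - p"
    using p_bounds norm_of_real[of "1 + p", where 'a = complex] norm_of_real[of "1 - p", where 'a = complex]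
    by simp_all
  have qq: "(cmod q)^2 = (1 + p) * (1 - p)" using pq by (simp add: algebra_simps power2_eq_square)
  have nz: "1 + p \<noteq> 0" "1 - p \<noteq> 0" using p_bounds by auto
  show ?thesis
  proof (cases "s = 1")
    case True
    then have "fst \<psi> x = q / (1 - p) * snd \<psi> (x + 1)"
      using assms(1) Gam_eigen_plus_iff[of \<psi>] unfolding eig_def True hscale_of_minus_one by blast
    then have "(cmod (fst \<psi> x))^2 = (1 + p) * (1 - p) / (1 - p)^2 * mass \<psi> (x + 1)"
      by (simp add: norm_mult norm_divide n power_mult_distrib power_divide qq mass_def)
    then show ?thesis using nz True by (simp add: power2_eq_square)
  next
    case False
    then have s: "s = -1" using assms(2) by simp
    then have "fst \<psi> x = - q / (1 + p) * snd \<psi> (x + 1)"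
      using assms(1) Gam_eigen_minus_iff[of \<psi>] unfolding eig_def s hscale_of_minus_one by blast
    then have "(cmod (fst \<psi> x))^2 = (1 + p) * (1 - p) / (1 + p)^2 * mass \<psi> (x + 1)"
      by (simp add: norm_mult norm_divide n power_mult_distrib power_divide qq mass_def)
    then show ?thesis using nz s by (simp add: power2_eq_square)
  qed
qed

lemma eig_Coin_eqs:
  assumes "eig s e \<psi>"
  shows "cnj (b x) * snd \<psi> x = complex_of_real (e - a1 x) * fst \<psi> x"
    "b x * fst \<psi> x = complex_of_real (e - a2 x) * snd \<psi> x"
proof -
  have C: "C \<psi> = hscale (of_real e) \<psi>" using assms by (simp add: eig_def)
  have "fst (C \<psi>) x = e * fst \<psi> x" "snd (C \<psi>) x = e * snd \<psi> x" unfolding C by simp_all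
  then have "a1 x * fst \<psi> x + cnj (b x) * snd \<psi> x = e * fst \<psi> x"
    "b x * fst \<psi> x + a2 x * snd \<psi> x = e * snd \<psi> x"
    by (simp_all add: Coin_def)
  then show "cnj (b x) * snd \<psi> x = complex_of_real (e - a1 x) * fst \<psi> x"
    "b x * fst \<psi> x = complex_of_real (e - a2 x) * snd \<psi> x"
    by (simp_all add: algebra_simps)
qed

text \<open>The coin relates the masses of both components at x, and \<Gamma> relates the first at x
  to the second at x + 1. Avoiding division by \<open>b x\<close> keeps the relation valid where the
  coin is diagonal.\<close>

lemma eig_recursion:
  assumes eig: "eig s e \<psi>" and s: "s \<in> {1, -1}" "e \<in> {1, -1}" and a: "a2 x = - a1 x"
  shows "(1 - e * a1 x) * (1 + s * p) * mass \<psi> (x + 1) = (1 + e * a1 x) * (1 - s * p) * mass \<psi> x"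
proof -
  define P F t where "P = (cmod (fst \<psi> x))^2" and "F = mass \<psi> x" and "t = e * a1 x"
  have ee: "e * e = 1" using s(2) by auto
  have "t * t = (e * e) * (a1 x)^2" by (simp add: t_def power2_eq_square)
  then have bb: "(cmod (b x))^2 = (1 - t) * (1 + t)"
    using coin1[of x] ee by (simp add: algebra_simps)
  have "(cmod (b x))^2 * F = (e - a1 x)^2 * P"
    using arg_cong[OF eig_Coin_eqs(1)[OF eig, of x], of "\<lambda>z. (cmod z)^2"]
    by (simp add: norm_mult power_mult_distrib F_def P_def mass_def del: of_real_diff)
  moreover have "(e - a1 x)^2 = (1 - t)^2"
  proof -
    have "(e - a1 x)^2 = (e * e) * (e - a1 x)^2" by (simp add: ee)
    also have "\<dots> = (e * e - e * a1 x)^2" by (simp add: power2_eq_square algebra_simps)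
    finally show ?thesis by (simp add: ee t_def)
  qed
  ultimately have "(1 - t) * (1 + t) * F = (1 - t)^2 * P" by (simp only: bb)
  then have 1: "(1 - t) * ((1 + t) * F - (1 - t) * P) = 0"
    by (simp add: algebra_simps power2_eq_square)
  have "(cmod (b x))^2 * P = (e + a1 x)^2 * F"
    using arg_cong[OF eig_Coin_eqs(2)[OF eig, of x], of "\<lambda>z. (cmod z)^2"]
    by (simp add: norm_mult power_mult_distrib F_def P_def mass_def a del: of_real_diff of_real_add)
  moreover have "(e + a1 x)^2 = (1 + t)^2"
  proof -
    have "(e + a1 x)^2 = (e * e) * (e + a1 x)^2" by (simp add: ee)
    also have "\<dots> = (e * e + e * a1 x)^2" by (simp add: power2_eq_square algebra_simps)
    finally show ?thesis by (simp add: ee t_def)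
  qed
  ultimately have "(1 - t) * (1 + t) * P = (1 + t)^2 * F" by (simp only: bb)
  then have 2: "(1 + t) * ((1 + t) * F - (1 - t) * P) = 0"
    by (simp add: algebra_simps power2_eq_square)
  \<comment> \<open>The two rows of the coin equation carry the factors 1 - t and 1 + t, which
    cannot both vanish.\<close>
  have 3: "(1 + t) * F = (1 - t) * P" using 1 2 by (auto simp: mult_eq_0_iff)
  have "(1 - t) * (1 + s * p) * mass \<psi> (x + 1) = (1 - t) * ((1 - s * p) * P)"
    using fst_mass[OF eig s(1), of x] by (simp add: P_def)
  also have "\<dots> = (1 - s * p) * ((1 - t) * P)" by simp
  also have "\<dots> = (1 + t) * (1 - s * p) * F" unfolding 3[symmetric] by simp
  finally show ?thesis by (simp add: t_def F_def)
qed

lemma eig_Hspace_iff: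
  assumes "eig s e \<psi>" "s \<in> {1, -1}"
  shows "\<psi> \<in> Hspace \<longleftrightarrow> mass \<psi> summable_on UNIV"
proof -
  have bij: "bij_betw (\<lambda>x::int. x + 1) UNIV UNIV"
    by (rule bij_betw_byWitness[where f' = "\<lambda>x. x - 1"]) auto
  have nz: "1 - s * p \<noteq> 0" using assms(2) p_bounds by auto
  have "(cmod (fst \<psi> x))^2 = (1 + s * p) / (1 - s * p) * mass \<psi> (x + 1)" for x
    using fst_mass[OF assms, of x] nz by (simp add: field_simps)
  then have "(\<lambda>x. (cmod (fst \<psi> x))^2) summable_on UNIV" if "mass \<psi> summable_on UNIV"
    using that summable_on_reindex_bij_betw[OF bij, of "mass \<psi>"]
      summable_on_cmult_right[of "\<lambda>x. mass \<psi> (x + 1)" UNIV "(1 + s * p) / (1 - s * p)"] by simp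
  then show ?thesis unfolding Hspace_def mass_def by auto
qed

text \<open>A nonzero \<open>b x\<close> ties both components at x together, and \<Gamma> ties the
  first one to the second at x + 1.\<close>

lemma eig_snd_zero_step:
  assumes eig: "eig s e \<psi>" "s \<in> {1, -1}" and b: "b x \<noteq> 0"
  shows "snd \<psi> x = 0 \<longleftrightarrow> snd \<psi> (x + 1) = 0"
proof -
  have nz: "1 - s * p \<noteq> 0" "1 + s * p \<noteq> 0" using assms(2) p_bounds by auto
  have "fst \<psi> x = 0 \<longleftrightarrow> snd \<psi> (x + 1) = 0"
    using fst_mass[OF eig, of x] nz by (auto simp: mass_def)
  moreover have "fst \<psi> x = 0 \<longleftrightarrow> snd \<psi> x = 0"
    using eig_Coin_eqs[OF eig(1), of x] b by auto
  ultimately show ?thesis by blast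
qed

lemma eig_snd_zero_chain:
  assumes eig: "eig s e \<psi>" "s \<in> {1, -1}" and b: "\<And>x. m \<le> x \<Longrightarrow> b x \<noteq> 0" and mn: "m \<le> n"
  shows "snd \<psi> m = 0 \<longleftrightarrow> snd \<psi> n = 0"
  using mn
proof (induction n rule: int_ge_induct)
  case (step n)
  then show ?case using eig_snd_zero_step[OF eig b[of n]] by simp
qed simp

lemma eig_gauge: "eig 1 e \<psi> \<Longrightarrow> eig (-1) e (gauge \<psi>)"
  unfolding eig_def hscale_of_minus_one using Gam_gauge Coin_gauge gauge_hscale by simp

lemma eig_imp_Q_zero: "eig s e \<psi> \<Longrightarrow> Q \<psi> = 0"
  unfolding eig_def Q_zero_iff by (simp add: Gam_hscale Coin_hscale hs.scale_left_commute)

lemma snd_gauge_zero: "snd (gauge \<psi>) x = 0 \<longleftrightarrow> snd \<psi> x = 0"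
  using gauge_base_nonzero by (simp add: gauge_def)

text \<open>The spectral projection of C for eigenvalue e; on the kernel of \<open>Q\<close> it
  commutes with \<Gamma>.\<close>

definition eproj :: "real \<Rightarrow> state \<Rightarrow> state" where
  "eproj e \<psi> = hscale (1/2) (\<psi> + hscale (of_real e) (C \<psi>))"

lemma eproj_eig:
  assumes "\<Gamma> \<psi> = \<psi>" "Q \<psi> = 0" "e \<in> {1, -1}"
  shows "eig 1 e (eproj e \<psi>)"
proof -
  have "\<Gamma> (C \<psi>) = C \<psi>" using assms by (simp add: Q_zero_iff)
  then show ?thesis
    using assms unfolding eig_def eproj_def
    by (auto intro!: state_eqI simp: Gam_hscale Gam_add Gam_diff Coin_hscale Coin_add Coin_diff Coin_Coin
        Coin_minus Gam_minus field_simps)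
qed

lemma eproj_sum: "eproj 1 \<psi> + eproj (-1) \<psi> = \<psi>"
  unfolding eproj_def by (rule state_eqI) (simp_all add: field_simps)

lemma Hspace_eproj: "\<psi> \<in> Hspace \<Longrightarrow> eproj e \<psi> \<in> Hspace"
  unfolding eproj_def by (intro Hspace_hscale Hspace_add Hspace_Coin)

lemma gauge_eproj: "gauge (eproj e \<psi>) = eproj e (gauge \<psi>)"
  unfolding eproj_def by (simp add: gauge_hscale gauge_add Coin_gauge)

lemma eproj_add: "eproj e (\<psi> + \<phi>) = eproj e \<psi> + eproj e \<phi>"
  and eproj_hscale: "eproj e (hscale k \<psi>) = hscale k (eproj e \<psi>)"
  unfolding eproj_def by (auto intro!: state_eqI simp: Coin_add Coin_hscale algebra_simps)

lemma eproj_fix: "eig s e \<psi> \<Longrightarrow> e \<in> {1, -1} \<Longrightarrow> eproj e \<psi> = \<psi>"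
  unfolding eproj_def eig_def by (auto intro!: state_eqI)

lemma Kboth_iff:
  assumes "\<psi> \<in> Kplus"
  shows "\<psi> \<in> Kboth \<longleftrightarrow> gauge (eproj 1 \<psi>) \<in> Hspace \<and> gauge (eproj (-1) \<psi>) \<in> Hspace"
proof
  assume "\<psi> \<in> Kboth"
  then show "gauge (eproj 1 \<psi>) \<in> Hspace \<and> gauge (eproj (-1) \<psi>) \<in> Hspace"
    unfolding gauge_eproj Kboth_def by (auto intro: Hspace_eproj)
next
  assume "gauge (eproj 1 \<psi>) \<in> Hspace \<and> gauge (eproj (-1) \<psi>) \<in> Hspace"
  then have "gauge (eproj 1 \<psi> + eproj (-1) \<psi>) \<in> Hspace" unfolding gauge_add by (intro Hspace_add) auto
  then show "\<psi> \<in> Kboth" using assms by (simp add: Kboth_def eproj_sum)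
qed

text \<open>For \<open>p \<ge> 0\<close> the gauge factor has modulus at least \<open>1\<close>, hence decays to the left.\<close>

lemma gauge_left_summable:
  assumes "0 \<le> p" "\<psi> \<in> Hspace"
  shows "mass (gauge \<psi>) summable_on {..N}"
proof -
  have g1: "1 \<le> cmod gauge_base"
    unfolding gauge_base_def norm_minus_cancel norm_of_real using assms(1) p_bounds by simp
  have "mass \<psi> summable_on {..N}"
    using summable_on_subset_banach[of "\<lambda>x. (cmod (snd \<psi> x))^2" UNIV "{..N}"] assms(2)
    unfolding Hspace_def mass_def by simp
  then have s: "(\<lambda>x. (cmod gauge_base powi N)^2 * mass \<psi> x) summable_on {..N}" by (rule summable_on_cmult_right)
  show ?thesis
  proof (rule summable_on_comparison_test[OF s])
    fix x assume "x \<in> {..N}"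
    then have "cmod gauge_base powi x \<le> cmod gauge_base powi N" using g1 by (intro power_int_increasing) auto
    then have "(cmod gauge_base powi x)^2 \<le> (cmod gauge_base powi N)^2" by (intro power_mono) auto
    then show "mass (gauge \<psi>) x \<le> (cmod gauge_base powi N)^2 * mass \<psi> x"
      unfolding mass_def gauge_def by (simp add: norm_mult norm_power_int power_mult_distrib mult_right_mono)
  qed (simp add: mass_def)
qed

lemma gauge_Hspace_if_right:
  assumes "0 \<le> p" "eig 1 e \<psi>" "\<psi> \<in> Hspace" "mass (gauge \<psi>) summable_on {N..}"
  shows "gauge \<psi> \<in> Hspace"
  using eig_Hspace_iff[OF eig_gauge[OF assms(2)]] gauge_left_summable[OF assms(1,3), of N] assms(4)
    summable_on_int_halves[of "mass (gauge \<psi>)" N] by simp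

end

section \<open>Decay and vanishing at the two ends\<close>

context anisotropic_walk
begin

lemma limit_abs_le_1: "\<bar>a1R\<bar> \<le> 1" "\<bar>a1L\<bar> \<le> 1"
proof -
  have "a1R^2 \<le> 1" "a1L^2 \<le> 1"
    using coin_R(1) coin_L(1) zero_le_power2[of "cmod bR"] zero_le_power2[of "cmod bL"] by linarith+
  then show "\<bar>a1R\<bar> \<le> 1" "\<bar>a1L\<bar> \<le> 1" by (simp_all add: abs_square_le_1)
qed

lemma left_threshold:
  obtains N where "\<And>x. x \<le> N \<Longrightarrow> a2 x = - a1 x"
  using coin_L(3) by (auto simp: eventually_at_bot_linorder)

text \<open>The weights of the recursion differ by 2(sp - ea), so the sign of sp - ea decides
  between decay and growth.\<close>

lemma coefficient_compare:
  assumes "\<bar>e\<bar> = 1" "\<bar>s\<bar> = 1" "\<bar>a\<bar> \<le> 1"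
  shows "0 \<le> (1 + e * a) * (1 - s * p)" "0 \<le> (1 - e * a) * (1 + s * p)"
    "(1 + e * a) * (1 - s * p) < (1 - e * a) * (1 + s * p) \<longleftrightarrow> e * a < s * p"
    "(1 - e * a) * (1 + s * p) < (1 + e * a) * (1 - s * p) \<longleftrightarrow> s * p < e * a"
proof -
  have "\<bar>e * a\<bar> \<le> 1" "\<bar>s * p\<bar> \<le> 1" using assms p_bounds by (auto simp: abs_mult)
  then show "0 \<le> (1 + e * a) * (1 - s * p)" "0 \<le> (1 - e * a) * (1 + s * p)"
    by (auto intro!: mult_nonneg_nonneg)
  have "(1 + u) * (1 - v) < (1 - u) * (1 + v) \<longleftrightarrow> u < v" for u v :: real
  proof -
    have "(1 - u) * (1 + v) - (1 + u) * (1 - v) = 2 * (v - u)" by (simp add: algebra_simps)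
    then have "0 < (1 - u) * (1 + v) - (1 + u) * (1 - v) \<longleftrightarrow> 0 < 2 * (v - u)" by (rule arg_cong)
    then show ?thesis unfolding diff_gt_0_iff_gt by simp
  qed
  from this[of "e * a" "s * p"] this[of "- (e * a)" "- (s * p)"]
  show "(1 + e * a) * (1 - s * p) < (1 - e * a) * (1 + s * p) \<longleftrightarrow> e * a < s * p"
    "(1 - e * a) * (1 + s * p) < (1 + e * a) * (1 - s * p) \<longleftrightarrow> s * p < e * a"
    by simp_all
qed

lemma right_limits:
  "((\<lambda>x. (1 - e * a1 x) * (1 + s * p)) \<longlongrightarrow> (1 - e * a1R) * (1 + s * p)) at_top"
  "((\<lambda>x. (1 + e * a1 x) * (1 - s * p)) \<longlongrightarrow> (1 + e * a1R) * (1 - s * p)) at_top"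
  by (intro tendsto_intros limR1)+

lemma right_decay:
  assumes s: "s \<in> {1, -1}" "e \<in> {1, -1}" and lt: "e * a1R < s * p"
  shows "\<forall>\<^sub>F N in at_top. \<forall>\<psi>. eig s e \<psi> \<longrightarrow>
    mass \<psi> summable_on {N..} \<and> (snd \<psi> N = 0 \<longrightarrow> (\<forall>x\<ge>N. snd \<psi> x = 0))"
proof -
  have ab: "\<bar>e\<bar> = 1" "\<bar>s\<bar> = 1" using s by auto
  note cmp = coefficient_compare[OF ab limit_abs_le_1(1)]
  from recursion_decay[OF right_limits cmp(1) iffD2[OF cmp(3) lt]] eventually_all_ge_at_top[OF coin_R(3)]
  show ?thesis
  proof eventually_elim
    case (elim N)
    show ?case
    proof (intro allI impI)
      fix \<psi> assume eig: "eig s e \<psi>"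
      have "mass \<psi> summable_on {N..} \<and> (mass \<psi> N = 0 \<longrightarrow> (\<forall>x\<ge>N. mass \<psi> x = 0))"
        by (intro elim(1)[rule_format] mass_nonneg eig_recursion[OF eig s]) (use elim(2) in auto)
      then show "mass \<psi> summable_on {N..} \<and> (snd \<psi> N = 0 \<longrightarrow> (\<forall>x\<ge>N. snd \<psi> x = 0))"
        unfolding mass_eq_0_iff .
    qed
  qed
qed

lemma right_vanish:
  assumes s: "s \<in> {1, -1}" "e \<in> {1, -1}" and lt: "s * p < e * a1R"
  shows "\<forall>\<^sub>F N in at_top. \<forall>\<psi>. eig s e \<psi> \<longrightarrow> mass \<psi> summable_on {N..} \<longrightarrow> (\<forall>x\<ge>N. snd \<psi> x = 0)"
proof -
  have ab: "\<bar>e\<bar> = 1" "\<bar>s\<bar> = 1" using s by auto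
  note cmp = coefficient_compare[OF ab limit_abs_le_1(1)]
  from recursion_vanish[OF right_limits cmp(2) iffD2[OF cmp(4) lt]] eventually_all_ge_at_top[OF coin_R(3)]
  show ?thesis
  proof eventually_elim
    case (elim N)
    show ?case
    proof (intro allI impI)
      fix \<psi> x assume eig: "eig s e \<psi>" and sm: "mass \<psi> summable_on {N..}" "N \<le> x"
      have "mass \<psi> x = 0"
        by (rule elim(1)[rule_format, OF mass_nonneg _ sm])
          (use elim(2) in \<open>auto intro!: eig_recursion[OF eig s]\<close>)
      then show "snd \<psi> x = 0" unfolding mass_eq_0_iff .
    qed
  qed
qed

text \<open>With y = -x, the recursion at site -y - 1 leads from -y to -(y + 1) and has its weights
  exchanged. Hence the inequalities for decay and vanishing are reversed at the left end.\<close>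

lemma left_limits:
  "((\<lambda>y. (1 + e * a1 (- y - 1)) * (1 - s * p)) \<longlongrightarrow> (1 + e * a1L) * (1 - s * p)) at_top"
  "((\<lambda>y. (1 - e * a1 (- y - 1)) * (1 + s * p)) \<longlongrightarrow> (1 - e * a1L) * (1 + s * p)) at_top"
proof -
  have "filterlim (\<lambda>y::int. - y - 1) at_bot at_top"
    using filterlim_compose[OF filterlim_int_shift(2)[of "-1"] filterlim_int_shift(3)] by simp
  then have a: "((\<lambda>y. a1 (- y - 1)) \<longlongrightarrow> a1L) at_top" by (rule filterlim_compose[OF limL1])
  show "((\<lambda>y. (1 + e * a1 (- y - 1)) * (1 - s * p)) \<longlongrightarrow> (1 + e * a1L) * (1 - s * p)) at_top"
    "((\<lambda>y. (1 - e * a1 (- y - 1)) * (1 + s * p)) \<longlongrightarrow> (1 - e * a1L) * (1 + s * p)) at_top"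
    by (intro tendsto_intros a)+
qed

lemma left_decay:
  assumes s: "s \<in> {1, -1}" "e \<in> {1, -1}" and lt: "s * p < e * a1L"
  shows "\<exists>N. \<forall>\<psi>. eig s e \<psi> \<longrightarrow> mass \<psi> summable_on {..N}"
proof -
  have ab: "\<bar>e\<bar> = 1" "\<bar>s\<bar> = 1" using s by auto
  obtain N0 where N0: "\<And>x. x \<le> N0 \<Longrightarrow> a2 x = - a1 x" using left_threshold by blast
  note cmp = coefficient_compare[OF ab limit_abs_le_1(2)]
  obtain N1 where N1: "\<forall>N'\<ge>N1. \<forall>F. (\<forall>x. 0 \<le> F x) \<longrightarrow>
     (\<forall>y\<ge>N'. (1 + e * a1 (- y - 1)) * (1 - s * p) * F (y + 1) = (1 - e * a1 (- y - 1)) * (1 + s * p) * F y) \<longrightarrow>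
    F summable_on {N'..} \<and> (F N' = 0 \<longrightarrow> (\<forall>x\<ge>N'. F x = 0))"
    using recursion_decay[OF left_limits cmp(2) iffD2[OF cmp(4) lt]]
    unfolding eventually_at_top_linorder by (rule exE)
  define N where "N = max (- N0) N1"
  show ?thesis
  proof (intro exI[of _ "- N"] allI impI)
    fix \<psi> assume eig: "eig s e \<psi>"
    have "(\<lambda>y. mass \<psi> (- y)) summable_on {N..}"
    proof (rule N1[rule_format, THEN conjunct1])
      fix y assume "N \<le> y"
      then have "a2 (- y - 1) = - a1 (- y - 1)" by (intro N0) (auto simp: N_def)
      from eig_recursion[OF eig s this]
      show "(1 + e * a1 (- y - 1)) * (1 - s * p) * mass \<psi> (- (y + 1)) = (1 - e * a1 (- y - 1)) * (1 + s * p) * mass \<psi> (- y)"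
        by simp
    qed (auto simp: N_def mass_nonneg)
    then show "mass \<psi> summable_on {..- N}" using summable_on_int_uminus[of "mass \<psi>" "- N"] by simp
  qed
qed

lemma left_vanish:
  assumes s: "s \<in> {1, -1}" "e \<in> {1, -1}" and lt: "e * a1L < s * p"
  shows "\<exists>N. \<forall>\<psi>. eig s e \<psi> \<longrightarrow> \<psi> \<in> Hspace \<longrightarrow> (\<forall>x\<le>N. snd \<psi> x = 0)"
proof -
  have ab: "\<bar>e\<bar> = 1" "\<bar>s\<bar> = 1" using s by auto
  obtain N0 where N0: "\<And>x. x \<le> N0 \<Longrightarrow> a2 x = - a1 x" using left_threshold by blast
  note cmp = coefficient_compare[OF ab limit_abs_le_1(2)]
  obtain N1 where N1: "\<forall>N'\<ge>N1. \<forall>F. (\<forall>x. 0 \<le> F x) \<longrightarrow>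
     (\<forall>y\<ge>N'. (1 + e * a1 (- y - 1)) * (1 - s * p) * F (y + 1) = (1 - e * a1 (- y - 1)) * (1 + s * p) * F y) \<longrightarrow>
    F summable_on {N'..} \<longrightarrow> (\<forall>x\<ge>N'. F x = 0)"
    using recursion_vanish[OF left_limits cmp(1) iffD2[OF cmp(3) lt]]
    unfolding eventually_at_top_linorder by (rule exE)
  define N where "N = max (- N0) N1"
  show ?thesis
  proof (intro exI[of _ "- N"] allI impI)
    fix \<psi> x assume eig: "eig s e \<psi>" and H: "\<psi> \<in> Hspace" and x: "x \<le> - N"
    have "mass \<psi> summable_on {..- N}" using H eig_Hspace_iff[OF eig s(1)] summable_on_int_halves[of "mass \<psi>" "- N"] by simp
    then have sm: "(\<lambda>y. mass \<psi> (- y)) summable_on {N..}" using summable_on_int_uminus[of "mass \<psi>" "- N"] by simp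
    have "mass \<psi> (- (- x)) = 0"
    proof (rule N1[rule_format, of N "\<lambda>y. mass \<psi> (- y)" "- x"])
      fix y assume "N \<le> y"
      then have "a2 (- y - 1) = - a1 (- y - 1)" by (intro N0) (auto simp: N_def)
      from eig_recursion[OF eig s this]
      show "(1 + e * a1 (- y - 1)) * (1 - s * p) * mass \<psi> (- (y + 1)) = (1 - e * a1 (- y - 1)) * (1 + s * p) * mass \<psi> (- y)"
        by simp
    qed (use x sm in \<open>auto simp: N_def mass_nonneg\<close>)
    then show "snd \<psi> x = 0" by (simp add: mass_eq_0_iff)
  qed
qed

end

section \<open>Counting kernel states\<close>

context walk
begin

lemma eigI:
  assumes "\<And>x. cnj (b x) * f x = complex_of_real (e - a1 x) * (q / (1 - p) * f (x + 1))"
    "\<And>x. b x * (q / (1 - p) * f (x + 1)) = complex_of_real (e - a2 x) * f x"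
  shows "eig 1 e (\<lambda>x. q / (1 - p) * f (x + 1), f)" (is "eig 1 e ?\<psi>")
  unfolding eig_def hscale_of_minus_one Gam_eigen_plus_iff
proof
  show "C ?\<psi> = hscale (of_real e) ?\<psi>"
  proof (rule state_eqI)
    fix x
    have "fst (C ?\<psi>) x = a1 x * (q / (1 - p) * f (x + 1)) + cnj (b x) * f x"
      by (simp add: Coin_def)
    also have "\<dots> = e * (q / (1 - p) * f (x + 1))"
      unfolding assms(1) of_real_diff left_diff_distrib by simp
    finally show "fst (C ?\<psi>) x = fst (hscale (of_real e) ?\<psi>) x" by simp
    have "snd (C ?\<psi>) x = b x * (q / (1 - p) * f (x + 1)) + a2 x * f x"
      by (simp add: Coin_def)
    also have "\<dots> = e * f x" unfolding assms(2) by (simp add: algebra_simps)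
    finally show "snd (C ?\<psi>) x = snd (hscale (of_real e) ?\<psi>) x" by simp
  qed
qed simp

text \<open>The transfer factor from \<open>snd \<psi> x\<close> to
  \<open>snd \<psi> (x + 1)\<close>, found by solving the second row of the coin equation where
  \<open>b x\<close> is nonzero.\<close>

definition "hop e x = complex_of_real (e + a1 x) * (1 - p) / (b x * q)"

lemma a2_eq: "b x \<noteq> 0 \<Longrightarrow> a2 x = - a1 x"
proof -
  assume "b x \<noteq> 0"
  then have "complex_of_real (a1 x + a2 x) = 0" using coin3[of x] by simp
  then show "a2 x = - a1 x" unfolding of_real_eq_0_iff by linarith
qed

lemma hop_nonzero:
  assumes "b x \<noteq> 0" "e \<in> {1, -1}"
  shows "hop e x \<noteq> 0"
proof -
  have "0 < (cmod (b x))^2" using assms(1) by simp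
  then have "(a1 x)^2 < 1" using coin1[of x] by linarith
  then have "\<bar>a1 x\<bar> < 1" by (simp add: abs_square_less_1)
  then have "e + a1 x \<noteq> 0" using assms(2) by auto
  then have "complex_of_real (e + a1 x) \<noteq> 0" unfolding of_real_eq_0_iff .
  then show ?thesis unfolding hop_def using assms(1) q0 p_complex_ne(1) by simp
qed

lemma hop_solves:
  assumes b: "b x \<noteq> 0" and e: "e \<in> {1, -1}" and f: "f (x + 1) = hop e x * f x"
  shows "cnj (b x) * f x = complex_of_real (e - a1 x) * (q / (1 - p) * f (x + 1))"
    "b x * (q / (1 - p) * f (x + 1)) = complex_of_real (e - a2 x) * f x"
proof -
  have u: "q / (1 - p) * f (x + 1) = complex_of_real (e + a1 x) / b x * f x"
    unfolding f hop_def using q0 p_complex_ne(1) by simp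
  have ee: "e * e = 1" using e by auto
  have "complex_of_real (e - a1 x) * complex_of_real (e + a1 x) = complex_of_real (1 - (a1 x)^2)"
    unfolding of_real_mult[symmetric] using ee by (simp add: algebra_simps power2_eq_square)
  also have "1 - (a1 x)^2 = (cmod (b x))^2" using coin1[of x] by simp
  finally have *: "complex_of_real (e - a1 x) * complex_of_real (e + a1 x) = b x * cnj (b x)"
    unfolding complex_norm_square .
  have "complex_of_real (e - a1 x) * (complex_of_real (e + a1 x) / b x * f x)
      = (complex_of_real (e - a1 x) * complex_of_real (e + a1 x)) / b x * f x" by simp
  also have "\<dots> = cnj (b x) * f x" unfolding * using b by simp
  finally show "cnj (b x) * f x = complex_of_real (e - a1 x) * (q / (1 - p) * f (x + 1))"
    unfolding u by simp
  show "b x * (q / (1 - p) * f (x + 1)) = complex_of_real (e - a2 x) * f x"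
    unfolding u a2_eq[OF b] using b by simp
qed

text \<open>At a zero of \<open>b\<close> the coin is diagonal, so the second component may vanish
  up to m while the first is nonzero at m, provided the eigenvalue is \<open>a1 m\<close>. The empty
  product starts the recursion with value 1 at m + 1.\<close>

lemma half_line_solution:
  assumes bm: "b m = 0" and b: "\<And>x. m < x \<Longrightarrow> b x \<noteq> 0"
  obtains \<psi> where "eig 1 (a1 m) \<psi>" "\<And>x. x \<le> m \<Longrightarrow> snd \<psi> x = 0" "\<And>x. m < x \<Longrightarrow> snd \<psi> x \<noteq> 0"
proof -
  have e: "a1 m \<in> {1, -1}" using coin1[of m] bm by (auto simp: power2_eq_1_iff)
  define f where "f x = (if x \<le> m then 0 else \<Prod>k\<in>{m + 1..<x}. hop (a1 m) k)" for x
  have f: "f (x + 1) = hop (a1 m) x * f x" if "m < x" for x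
  proof -
    have "{m + 1..<x + 1} = insert x {m + 1..<x}" using that by auto
    then show ?thesis using that by (simp add: f_def)
  qed
  have "eig 1 (a1 m) (\<lambda>x. q / (1 - p) * f (x + 1), f)"
  proof (rule eigI)
    fix x
    consider "x < m" | "x = m" | "m < x" by linarith
    then have "cnj (b x) * f x = complex_of_real (a1 m - a1 x) * (q / (1 - p) * f (x + 1)) \<and>
      b x * (q / (1 - p) * f (x + 1)) = complex_of_real (a1 m - a2 x) * f x"
    proof cases
      case 3
      then show ?thesis using hop_solves[OF b e, of x f] f by blast
    qed (auto simp: f_def bm)
    then show "cnj (b x) * f x = complex_of_real (a1 m - a1 x) * (q / (1 - p) * f (x + 1))"
      "b x * (q / (1 - p) * f (x + 1)) = complex_of_real (a1 m - a2 x) * f x" by auto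
  qed
  moreover have "f x \<noteq> 0" if "m < x" for x
    using that hop_nonzero[OF b e] by (auto simp: f_def)
  ultimately show thesis by (intro that) (auto simp: f_def)
qed

lemma full_line_solution:
  assumes b: "\<And>x. b x \<noteq> 0" and e: "e \<in> {1, -1}"
  obtains \<psi> where "eig 1 e \<psi>" "\<And>x. snd \<psi> x \<noteq> 0"
proof -
  define f where "f x = (if 0 \<le> x then \<Prod>k\<in>{0..<x}. hop e k else \<Prod>k\<in>{x..<0}. inverse (hop e k))" for x
  have f: "f (x + 1) = hop e x * f x" for x
  proof (cases "0 \<le> x")
    case True
    then have "{0..<x + 1} = insert x {0..<x}" by auto
    then show ?thesis using True by (simp add: f_def)
  next
    case False
    then have "{x..<0} = insert x {x + 1..<0}" by auto
    then have "f x = inverse (hop e x) * (\<Prod>k\<in>{x + 1..<0}. inverse (hop e k))" using False by (simp add: f_def)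
    moreover have "f (x + 1) = (\<Prod>k\<in>{x + 1..<0}. inverse (hop e k))" using False by (auto simp: f_def)
    ultimately show ?thesis using hop_nonzero[OF b e, of x] by simp
  qed
  have "eig 1 e (\<lambda>x. q / (1 - p) * f (x + 1), f)"
    by (rule eigI) (rule hop_solves[OF b e f])+
  moreover have "f x \<noteq> 0" for x
    using hop_nonzero[OF b e] by (auto simp: f_def)
  ultimately show thesis by (intro that) auto
qed

end

section \<open>The codimension of the common part\<close>

context anisotropic_walk
begin

text \<open>For each eigenvalue e of C there are two cases. If e times \<open>a1R\<close> exceeds p,
  square-summable eigenstates already vanish near the right end; if it is below -p, the gauged
  states decay there. Gauging imposes no condition in either case.\<close>

lemma Kboth_eq_Kplus_if_strong_R:
  assumes p: "0 \<le> p" and lt: "p < \<bar>a1R\<bar>"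
  shows "Kboth = Kplus"
proof -
  have key: "gauge \<psi> \<in> Hspace" if eig: "eig 1 e \<psi>" and H: "\<psi> \<in> Hspace" and e: "e \<in> {1, -1}" for e \<psi>
  proof -
    have s: "(1::real) \<in> {1, -1}" "(-1::real) \<in> {1, -1}" by auto
    consider "1 * p < e * a1R" | "e * a1R < (-1) * p" using e lt by fastforce
    then show ?thesis
    proof cases
      case 1
      obtain N where N: "\<forall>\<psi>. eig 1 e \<psi> \<longrightarrow> mass \<psi> summable_on {N..} \<longrightarrow> (\<forall>x\<ge>N. snd \<psi> x = 0)"
        using eventually_happens'[OF trivial_limit_at_top_linorder right_vanish[OF s(1) e 1]] by (rule exE)
      have "mass \<psi> summable_on {N..}"
        using H eig_Hspace_iff[OF eig s(1)] summable_on_int_halves[of "mass \<psi>" N] by simp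
      then have "mass (gauge \<psi>) x = 0" if "N \<le> x" for x
        using N[rule_format, OF eig _ that] by (simp add: mass_eq_0_iff snd_gauge_zero)
      then have "mass (gauge \<psi>) summable_on {N..} \<longleftrightarrow> (\<lambda>x::int. 0::real) summable_on {N..}"
        by (intro summable_on_cong) auto
      then show ?thesis using gauge_Hspace_if_right[OF p eig H] by simp
    next
      case 2
      obtain N where N: "\<forall>\<psi>. eig (-1) e \<psi> \<longrightarrow>
          mass \<psi> summable_on {N..} \<and> (snd \<psi> N = 0 \<longrightarrow> (\<forall>x\<ge>N. snd \<psi> x = 0))"
        using eventually_happens'[OF trivial_limit_at_top_linorder right_decay[OF s(2) e 2]] by (rule exE)
      then have "mass (gauge \<psi>) summable_on {N..}" using eig_gauge[OF eig] by blast
      then show ?thesis by (rule gauge_Hspace_if_right[OF p eig H])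
    qed
  qed
  have "\<psi> \<in> Kboth" if "\<psi> \<in> Kplus" for \<psi>
    unfolding Kboth_iff[OF that] using that
    by (intro conjI key[OF eproj_eig Hspace_eproj]) (auto simp: Kplus_def)
  then show ?thesis by (auto simp: Kboth_def)
qed

text \<open>Now, for both eigenvalues of C, eigenstates with \<Gamma> = 1 decay to the right while
  square-summable ones with \<Gamma> = -1 vanish there. So a gauged state is square summable only if
  it has no right tail at all, which is visible at the single site \<open>N\<close>.\<close>

lemma Kboth_iff_vanishing:
  assumes p: "0 \<le> p" and lt: "\<bar>a1R\<bar> < p"
  shows "\<forall>\<^sub>F N in at_top.
    (\<forall>\<psi>\<in>Kplus. \<psi> \<in> Kboth \<longleftrightarrow> snd (eproj 1 \<psi>) N = 0 \<and> snd (eproj (-1) \<psi>) N = 0) \<and>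
    (\<forall>e\<in>{1, -1}. \<forall>\<psi>. eig 1 e \<psi> \<longrightarrow> mass \<psi> summable_on {N..}) \<and> (\<forall>x\<ge>N. b x \<noteq> 0)"
proof -
  have s: "(1::real) \<in> {1, -1}" "(-1::real) \<in> {1, -1}" by auto
  have l: "e * a1R < 1 * p" "(-1) * p < e * a1R" if "e \<in> {1, -1}" for e using that lt by auto
  note decay = right_decay[OF s(1) _ l(1)] and vanish = right_vanish[OF s(2) _ l(2)]
  \<comment> \<open>Since |\<open>a1R\<close>| < p < 1, the limit of \<open>b\<close> is nonzero, so
    the zeros of \<open>b\<close> are bounded on the right.\<close>
  have "a1R^2 < 1" using lt p_bounds by (simp add: abs_square_less_1)
  then have "bR \<noteq> 0" using coin_R(1) by auto
  then have "\<forall>\<^sub>F x in at_top. b x \<noteq> 0" by (rule tendsto_imp_eventually_ne[OF limRb])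
  from decay[OF s(1) s(1)] decay[OF s(2) s(2)] vanish[OF s(1) s(1)] vanish[OF s(2) s(2)]
    eventually_all_ge_at_top[OF this]
  show ?thesis
  proof eventually_elim
    case (elim N)
    have decay: "mass \<psi> summable_on {N..} \<and> (snd \<psi> N = 0 \<longrightarrow> (\<forall>x\<ge>N. snd \<psi> x = 0))"
      if "eig 1 e \<psi>" "e \<in> {1, -1}" for e \<psi>
      using that elim(1)[rule_format, of \<psi>] elim(2)[rule_format, of \<psi>] by blast
    have vanish: "snd \<psi> N = 0" if "eig (-1) e \<psi>" "mass \<psi> summable_on {N..}" "e \<in> {1, -1}" for e \<psi>
      using that elim(3)[rule_format, of \<psi> N] elim(4)[rule_format, of \<psi> N] by auto
    have key: "gauge \<psi> \<in> Hspace \<longleftrightarrow> snd \<psi> N = 0"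
      if eig: "eig 1 e \<psi>" and H: "\<psi> \<in> Hspace" and e: "e \<in> {1, -1}" for e \<psi>
    proof
      assume "gauge \<psi> \<in> Hspace"
      then have "mass (gauge \<psi>) summable_on {N..}"
        using eig_Hspace_iff[OF eig_gauge[OF eig] s(2)] summable_on_int_halves[of "mass (gauge \<psi>)" N] by simp
      then have "snd (gauge \<psi>) N = 0" by (rule vanish[OF eig_gauge[OF eig] _ e])
      then show "snd \<psi> N = 0" by (simp add: snd_gauge_zero)
    next
      assume "snd \<psi> N = 0"
      then have "mass (gauge \<psi>) x = 0" if "N \<le> x" for x
        using decay[OF eig e] that by (simp add: mass_eq_0_iff snd_gauge_zero)
      then have "mass (gauge \<psi>) summable_on {N..} \<longleftrightarrow> (\<lambda>x::int. 0::real) summable_on {N..}"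
        by (intro summable_on_cong) auto
      then show "gauge \<psi> \<in> Hspace" using gauge_Hspace_if_right[OF p eig H] by simp
    qed
    show ?case
    proof (intro conjI ballI allI impI)
      fix \<psi> assume \<psi>: "\<psi> \<in> Kplus"
      then have k: "\<psi> \<in> Hspace" "\<Gamma> \<psi> = \<psi>" "Q \<psi> = 0" by (auto simp: Kplus_def)
      show "\<psi> \<in> Kboth \<longleftrightarrow> snd (eproj 1 \<psi>) N = 0 \<and> snd (eproj (-1) \<psi>) N = 0"
        unfolding Kboth_iff[OF \<psi>]
        using key[OF eproj_eig[OF k(2,3) s(1)] Hspace_eproj[OF k(1)] s(1)]
          key[OF eproj_eig[OF k(2,3) s(2)] Hspace_eproj[OF k(1)] s(2)] by simp
    qed (use decay elim(5) in blast)+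
  qed
qed

text \<open>\<open>Kboth\<close> is cut out of \<open>Kplus\<close> by one functional, the tail
  value of the e-part: the (-e)-part has no tail by \<open>uniq\<close>, and \<phi> shows that the
  functional is nonzero.\<close>

lemma dim_Kplus_if_tail_solution:
  assumes fin: "\<exists>F. finite F \<and> {\<psi> \<in> Hspace. Q \<psi> = 0} \<subseteq> hs.span F"
    and iff: "\<And>\<psi>. \<psi> \<in> Kplus \<Longrightarrow> \<psi> \<in> Kboth \<longleftrightarrow> snd (eproj 1 \<psi>) n = 0 \<and> snd (eproj (-1) \<psi>) n = 0"
    and e: "e \<in> {1, -1}"
    and uniq: "\<And>\<psi>. eig 1 (- e) \<psi> \<Longrightarrow> \<psi> \<in> Hspace \<Longrightarrow> snd \<psi> n = 0"
    and ex: "eig 1 e \<phi>" "\<phi> \<in> Hspace" "snd \<phi> n \<noteq> 0"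
  shows "hs.dim Kplus = hs.dim Kboth + 1"
proof -
  obtain F where F: "finite F" "{\<psi> \<in> Hspace. Q \<psi> = 0} \<subseteq> hs.span F" using fin by blast
  have e': "- e \<in> {1, -1}" using e by auto
  have "Kboth = {\<psi> \<in> Kplus. snd (eproj e \<psi>) n = 0}"
  proof -
    have "\<psi> \<in> Kboth \<longleftrightarrow> snd (eproj e \<psi>) n = 0" if \<psi>: "\<psi> \<in> Kplus" for \<psi>
    proof -
      have "snd (eproj (- e) \<psi>) n = 0"
        using \<psi> by (intro uniq eproj_eig Hspace_eproj e') (auto simp: Kplus_def)
      then show ?thesis using iff[OF \<psi>] e by auto
    qed
    then show ?thesis by (auto simp: Kboth_def)
  qed
  moreover have "hs.dim Kplus = hs.dim {\<psi> \<in> Kplus. snd (eproj e \<psi>) n = 0} + 1"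
  proof (rule dim_functional_kernel[OF subspace_Kplus F(1)])
    show "Kplus \<subseteq> hs.span F" using F(2) by (auto simp: Kplus_def)
    show "\<phi> \<in> Kplus"
      using ex eig_imp_Q_zero[OF ex(1)] by (simp add: Kplus_def eig_def)
    show "snd (eproj e \<phi>) n \<noteq> 0" using eproj_fix[OF ex(1) e] ex(3) by simp
  qed (simp_all add: eproj_add eproj_hscale)
  ultimately show ?thesis by simp
qed

text \<open>Right tails decay freely, so the question is what a solution meets going left. The last
  zero of \<open>b\<close> stops it and selects one eigenvalue of C; without zeros it runs to the
  left end, where decay requires p < |\<open>a1L\<close>| and again fixes the eigenvalue.\<close>

lemma dim_Kplus:
  assumes p: "0 \<le> p" and ne: "\<bar>p\<bar> \<noteq> \<bar>a1L\<bar>" "\<bar>p\<bar> \<noteq> \<bar>a1R\<bar>"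
  shows "hs.dim Kplus = hs.dim Kboth +
    (if \<bar>a1R\<bar> < p \<and> ((\<exists>x. b x = 0) \<or> p < \<bar>a1L\<bar>) then 1 else 0)"
proof (cases "\<bar>a1R\<bar> < p")
  case False
  then have "p < \<bar>a1R\<bar>" using ne p by simp
  then show ?thesis using Kboth_eq_Kplus_if_strong_R[OF p] False by simp
next
  case True
  note fin = fredholm_and_finite_kernel(2)[OF ne]
  have s: "(1::real) \<in> {1, -1}" by simp
  obtain N where iff: "\<And>\<psi>. \<psi> \<in> Kplus \<Longrightarrow>
      \<psi> \<in> Kboth \<longleftrightarrow> snd (eproj 1 \<psi>) N = 0 \<and> snd (eproj (-1) \<psi>) N = 0"
    and R: "\<And>e \<psi>. eig 1 e \<psi> \<Longrightarrow> e \<in> {1, -1} \<Longrightarrow> mass \<psi> summable_on {N..}"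
    and bN: "\<And>x. N \<le> x \<Longrightarrow> b x \<noteq> 0"
    using eventually_happens'[OF trivial_limit_at_top_linorder Kboth_iff_vanishing[OF p True]] by blast
  show ?thesis
  proof (cases "\<exists>x. b x = 0")
    case zero: True
    obtain x0 where x0: "b x0 = 0" using zero by blast
    have x0N: "x0 < N" using bN[of x0] x0 by (meson not_le)
    have "\<exists>m. m < N \<and> b m = 0 \<and> (\<forall>x>m. b x \<noteq> 0)"
    proof -
      let ?S = "{x \<in> {x0..N}. b x = 0}"
      have "x0 \<in> ?S" using x0 x0N by simp
      then have fS: "finite ?S" "?S \<noteq> {}" by (auto intro: finite_subset[of _ "{x0..N}"])
      define m where "m = Max ?S"
      have m: "m \<in> ?S" unfolding m_def by (rule Max_in[OF fS])
      have "b x \<noteq> 0" if "m < x" for x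
      proof
        assume bx: "b x = 0"
        then have "x < N" using bN[of x] by (meson not_le)
        then have "x \<in> ?S" using bx that m by auto
        then have "x \<le> m" unfolding m_def using fS(1) by (intro Max_ge)
        then show False using that by simp
      qed
      moreover have "m < N" using m bN[of m] by (cases "N \<le> m") auto
      ultimately show ?thesis using m by blast
    qed
    then obtain m where m: "m < N" "b m = 0" "\<And>x. m < x \<Longrightarrow> b x \<noteq> 0" by blast
    have e: "a1 m \<in> {1, -1}" using coin1[of m] m(2) by (auto simp: power2_eq_1_iff)
    obtain \<phi> where \<phi>: "eig 1 (a1 m) \<phi>" "\<And>x. x \<le> m \<Longrightarrow> snd \<phi> x = 0" "\<And>x. m < x \<Longrightarrow> snd \<phi> x \<noteq> 0"
      using half_line_solution[OF m(2,3)] by metis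
    have "mass \<phi> summable_on {..m} \<longleftrightarrow> (\<lambda>x::int. 0::real) summable_on {..m}"
      by (intro summable_on_cong) (simp add: mass_eq_0_iff \<phi>(2))
    moreover have "mass \<phi> summable_on {m..}" by (rule summable_on_int_above[OF R[OF \<phi>(1) e]])
    ultimately have "mass \<phi> summable_on UNIV" using summable_on_int_halves[of "mass \<phi>" m] by simp
    then have \<phi>H: "\<phi> \<in> Hspace" using eig_Hspace_iff[OF \<phi>(1) s] by blast
    \<comment> \<open>At m the coin is diagonal with first entry \<open>a1 m\<close>, so the
      opposite eigenvalue kills the first component there, hence the second at m + 1, and the zero
      travels on to \<open>N\<close>.\<close>
    have uniq: "snd \<psi> N = 0" if eig: "eig 1 (- a1 m) \<psi>" "\<psi> \<in> Hspace" for \<psi>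
    proof -
      have "complex_of_real (- a1 m - a1 m) * fst \<psi> m = 0" using eig_Coin_eqs(1)[OF eig(1), of m] m(2) by simp
      moreover have "complex_of_real (- a1 m - a1 m) \<noteq> 0" unfolding of_real_eq_0_iff using e by auto
      ultimately have "fst \<psi> m = 0" by simp
      then have "snd \<psi> (m + 1) = 0" using fst_mass[OF eig(1) s, of m] p_bounds by (simp add: mass_def)
      then show ?thesis using eig_snd_zero_chain[OF eig(1) s, of "m + 1" N] m by auto
    qed
    have "hs.dim Kplus = hs.dim Kboth + 1"
      by (rule dim_Kplus_if_tail_solution[OF fin iff e uniq \<phi>(1) \<phi>H \<phi>(3)[OF m(1)]])
    then show ?thesis using True zero by simp
  next
    case nonzero: False
    then have bnz: "\<And>x. b x \<noteq> 0" by blast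
    have uniq_left: "snd \<psi> N = 0" if eig: "eig 1 e \<psi>" "\<psi> \<in> Hspace" and e: "e \<in> {1, -1}" and lt: "e * a1L < p" for e \<psi>
    proof -
      have "e * a1L < 1 * p" using lt by simp
      then obtain M where M: "\<forall>\<psi>. eig 1 e \<psi> \<longrightarrow> \<psi> \<in> Hspace \<longrightarrow> (\<forall>x\<le>M. snd \<psi> x = 0)"
        using left_vanish[OF s e] by blast
      have "snd \<psi> (min M N) = 0" by (rule M[rule_format, OF eig]) simp
      then show ?thesis using eig_snd_zero_chain[OF eig(1) s bnz, of "min M N" N] by simp
    qed
    show ?thesis
    proof (cases "p < \<bar>a1L\<bar>")
      case gt: True
      \<comment> \<open>The only sign for which p < e times \<open>a1L\<close>, that is, for which
        eigenstates decay to the left.\<close>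
      define e where "e = sgn a1L"
      have e: "e \<in> {1, -1}" "e * a1L = \<bar>a1L\<bar>" using gt p by (auto simp: e_def sgn_real_def)
      obtain \<phi> where \<phi>: "eig 1 e \<phi>" "\<And>x. snd \<phi> x \<noteq> 0"
        using full_line_solution[OF bnz e(1)] by metis
      have "1 * p < e * a1L" using e(2) gt by simp
      then obtain M where M: "\<forall>\<psi>. eig 1 e \<psi> \<longrightarrow> mass \<psi> summable_on {..M}"
        using left_decay[OF s e(1)] by blast
      then have "mass \<phi> summable_on {..M}" using \<phi>(1) by blast
      moreover have "mass \<phi> summable_on {M..}" by (rule summable_on_int_above[OF R[OF \<phi>(1) e(1)]])
      ultimately have "mass \<phi> summable_on UNIV" using summable_on_int_halves[of "mass \<phi>" M] by simp
      then have \<phi>H: "\<phi> \<in> Hspace" using eig_Hspace_iff[OF \<phi>(1) s] by blast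
      have uniq: "snd \<psi> N = 0" if "eig 1 (- e) \<psi>" "\<psi> \<in> Hspace" for \<psi>
        using that by (rule uniq_left) (use e gt p in auto)
      have "hs.dim Kplus = hs.dim Kboth + 1"
        by (rule dim_Kplus_if_tail_solution[OF fin iff e(1) uniq \<phi>(1) \<phi>H \<phi>(2)])
      then show ?thesis using True gt by simp
    next
      case le: False
      then have lt: "\<bar>a1L\<bar> < p" using ne(1) p by simp
      have "\<psi> \<in> Kboth" if \<psi>: "\<psi> \<in> Kplus" for \<psi>
      proof -
        have "snd (eproj e \<psi>) N = 0" if e: "e \<in> {1, -1}" for e
          using \<psi> e lt by (intro uniq_left[of e] eproj_eig Hspace_eproj) (auto simp: Kplus_def)
        then show ?thesis using iff[OF \<psi>] by simp
      qed
      then have "Kplus = Kboth" by (auto simp: Kboth_def)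
      then show ?thesis using nonzero le by simp
    qed
  qed
qed

text \<open>The reflected walk yields the codimension in \<open>Kminus\<close> with the ends
  interchanged. A zero of \<open>b\<close> matters in both counts when p exceeds both limits, and
  the two contributions cancel.\<close>

lemma index_nonneg_p:
  assumes p: "0 \<le> p" and ne: "\<bar>p\<bar> \<noteq> \<bar>a1L\<bar>" "\<bar>p\<bar> \<noteq> \<bar>a1R\<bar>"
  shows "real_of_int (witten_index p q a1 a2 b) =
    (if \<bar>a1R\<bar> < \<bar>p\<bar> \<and> \<bar>p\<bar> < \<bar>a1L\<bar> then sgn p
     else if \<bar>a1L\<bar> < \<bar>p\<bar> \<and> \<bar>p\<bar> < \<bar>a1R\<bar> then - sgn p else 0)"
proof -
  have aL: "a2L = - a1L" and aR: "a2R = - a1R" by (rule coin_L(2), rule coin_R(2))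
  have lim: "(f \<longlongrightarrow> l) at_bot \<Longrightarrow> ((\<lambda>x::int. f (- x)) \<longlongrightarrow> l) at_top" for f :: "int \<Rightarrow> 'z::topological_space" and l
    by (rule filterlim_compose[OF _ filterlim_int_shift(3)])
  have up: "filterlim (\<lambda>x::int. - x) at_top at_bot"
    unfolding filterlim_at_top eventually_at_bot_linorder by (metis le_minus_iff)
  have lim': "(f \<longlongrightarrow> l) at_top \<Longrightarrow> ((\<lambda>x::int. f (- x)) \<longlongrightarrow> l) at_bot" for f :: "int \<Rightarrow> 'z::topological_space" and l
    by (rule filterlim_compose[OF _ up])
  interpret refl: anisotropic_walk p "- cnj q" "\<lambda>x. a2 (- x)" "\<lambda>x. a1 (- x)" "\<lambda>x. cnj (b (- x))"
    a2R a1R a2L a1L "cnj bR" "cnj bL"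
  proof
    fix x
    show "cnj (b (- x)) * complex_of_real (a2 (- x) + a1 (- x)) = 0"
      using coin3[of "- x"] by (auto simp: add.commute)
    show "((\<lambda>x. cnj (b (- x))) \<longlongrightarrow> cnj bR) at_bot" "((\<lambda>x. cnj (b (- x))) \<longlongrightarrow> cnj bL) at_top"
      by (intro tendsto_cnj lim' lim limLb limRb)+
    show "\<not> trivial_coin a2R a1R (cnj bR)" "\<not> trivial_coin a2L a1L (cnj bL)"
      using ntL ntR by (auto simp: trivial_coin_def)
  qed (use pq q0 coin1 coin2 limL1 limL2 limR1 limR2 in \<open>auto intro: lim lim'\<close>)
  have 1: "hs.dim Kplus = hs.dim Kboth + (if \<bar>a1R\<bar> < p \<and> ((\<exists>x. b x = 0) \<or> p < \<bar>a1L\<bar>) then 1 else 0)"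
    by (rule dim_Kplus[OF p ne])
  have "hs.dim refl.Kplus = hs.dim refl.Kboth +
      (if \<bar>a2L\<bar> < p \<and> ((\<exists>x. cnj (b (- x)) = 0) \<or> p < \<bar>a2R\<bar>) then 1 else 0)"
    by (rule refl.dim_Kplus[OF p]) (use ne in \<open>simp_all add: aL aR\<close>)
  moreover have "(\<exists>x. cnj (b (- x)) = 0) \<longleftrightarrow> (\<exists>x. b x = 0)"
    by (metis complex_cnj_zero_iff minus_minus)
  ultimately have 2: "hs.dim Kminus = hs.dim Kboth +
      (if \<bar>a1L\<bar> < p \<and> ((\<exists>x. b x = 0) \<or> p < \<bar>a1R\<bar>) then 1 else 0)"
    unfolding dim_refl_Kplus dim_refl_Kboth aL aR by simp
  show ?thesis
  \<comment> \<open>At p = 0 both codimensions are 0, because no absolute value is below 0, in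
    accordance with \<open>sgn 0 = 0\<close>.\<close>
  proof (cases "p = 0")
    case True
    then show ?thesis unfolding witten_index_eq 1 2 by simp
  next
    case False
    then have "\<bar>p\<bar> = p" "sgn p = 1" using p by auto
    then show ?thesis unfolding witten_index_eq 1 2 using ne by auto
  qed
qed

end

text \<open>Negating p and q turns \<Gamma> into -\<Gamma>, which leaves H unchanged and exchanges
  the two eigenspaces; this settles negative p.\<close>

lemma witten_index_minus: "witten_index (- p) (- q) a1 a2 b = - witten_index p q a1 a2 b"
proof -
  have Q: "Qop (- p) (- q) a1 a2 b \<psi> = - Qop p q a1 a2 b \<psi>" for \<psi>
    unfolding Qop_def Gam_neg by (rule state_eqI) (simp_all add: Coin_minus algebra_simps)
  have "Qop p q a1 a2 b (- \<psi>) = - Qop p q a1 a2 b \<psi>" for \<psi>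
    using Qop_diff[of p q a1 a2 b 0 \<psi>] by (simp add: Qop_zero)
  then have H: "Hop (- p) (- q) a1 a2 b \<psi> = Hop p q a1 a2 b \<psi>" for \<psi>
    unfolding Hop_def Q by simp
  have "Hplus (- p) (- q) = Hminus p q" "Hminus (- p) (- q) = Hplus p q"
    unfolding Hplus_def Hminus_def Gam_neg by (auto simp: minus_equation_iff)
  then show ?thesis unfolding witten_index_def H by simp
qed

theorem mainTheorem1:
  fixes p :: real and q :: complex
    and a1 a2 :: "int \<Rightarrow> real" and b :: "int \<Rightarrow> complex"
    and a1L a2L a1R a2R :: real and bL bR :: complex
  assumes pq: "p^2 + (cmod q)^2 = 1" and q0: "q \<noteq> 0"
    and coin1: "\<And>x. (a1 x)^2 + (cmod (b x))^2 = 1"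
    and coin2: "\<And>x. (a2 x)^2 + (cmod (b x))^2 = 1"
    and coin3: "\<And>x. b x * complex_of_real (a1 x + a2 x) = 0"
    and limL1: "(a1 \<longlongrightarrow> a1L) at_bot" and limL2: "(a2 \<longlongrightarrow> a2L) at_bot"
    and limLb: "(b \<longlongrightarrow> bL) at_bot"
    and limR1: "(a1 \<longlongrightarrow> a1R) at_top" and limR2: "(a2 \<longlongrightarrow> a2R) at_top"
    and limRb: "(b \<longlongrightarrow> bR) at_top"
    and ntL: "\<not> trivial_coin a1L a2L bL"
    and ntR: "\<not> trivial_coin a1R a2R bR"
  shows "(is_fredholm p q a1 a2 b \<longleftrightarrow> \<bar>p\<bar> \<noteq> \<bar>a1L\<bar> \<and> \<bar>p\<bar> \<noteq> \<bar>a1R\<bar>) \<and>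
         (is_fredholm p q a1 a2 b \<longrightarrow>
            real_of_int (witten_index p q a1 a2 b) =
              (if \<bar>a1R\<bar> < \<bar>p\<bar> \<and> \<bar>p\<bar> < \<bar>a1L\<bar> then sgn p
               else if \<bar>a1L\<bar> < \<bar>p\<bar> \<and> \<bar>p\<bar> < \<bar>a1R\<bar> then - sgn p
               else 0))"
proof -
  interpret P: anisotropic_walk p q a1 a2 b a1L a2L a1R a2R bL bR
    by unfold_locales (use assms in auto)
  interpret M: anisotropic_walk "- p" "- q" a1 a2 b a1L a2L a1R a2R bL bR
    by unfold_locales (use assms in auto)
  have "real_of_int (witten_index p q a1 a2 b) =
      (if \<bar>a1R\<bar> < \<bar>p\<bar> \<and> \<bar>p\<bar> < \<bar>a1L\<bar> then sgn p
       else if \<bar>a1L\<bar> < \<bar>p\<bar> \<and> \<bar>p\<bar> < \<bar>a1R\<bar> then - sgn p else 0)"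
    if ne: "\<bar>p\<bar> \<noteq> \<bar>a1L\<bar>" "\<bar>p\<bar> \<noteq> \<bar>a1R\<bar>"
  proof (cases "0 \<le> p")
    case True
    then show ?thesis by (rule P.index_nonneg_p[OF _ ne])
  next
    case False
    then show ?thesis using M.index_nonneg_p ne unfolding witten_index_minus by (auto simp: sgn_minus split: if_splits)
  qed
  then show ?thesis using P.fredholm_iff by blast
qed

end
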